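(* The following statements are equivalent for any domain $U\subset\widehat{\mathbb{C}}$: (1) $U$ is a generalized Jordan domain; (2) $U$ is simply connected at the boundary; (3) for any continuous map $f$ of $U$ into a compact metric space $X$, all cluster sets $C(f,z)$ with $z\in\partial U$ are connected.
   Context: A domain is a connected open subset of the extended complex plane $\widehat{\mathbb{C}}$, which carries the spherical metric; $D_r(z_0)$ denotes the open disk centered at $z_0$ with radius $r$. A generalized Jordan domain is a domain $U\subset\widehat{\mathbb{C}}$ every component of whose boundary is a point or a Jordan curve, such that at most countably many boundary components are Jordan curves and the diameters of these form a null sequence (a finite sequence, or an infinite one converging to zero). $U$ is simply connected at a point $z_0\in\partial U$ if for any $r>0$ there is a set $N_r$ open in $\widehat{\mathbb{C}}$ with $z_0\in N_r\subset D_r(z_0)$ such that $N_r\cap U$ is connected. $U$ is simply connected at the boundary if it is simply connected at every point of $\partial U$. For a continuous map $f:U\to X$ into a compact metric space and $z_0\in\partial U$, the cluster set $C(f,z_0)$ is the set of all $w\in X$ for which there is an infinite sequence $z_k\in U$ with $z_k\to z_0$ and $f(z_k)\to w$; equivalently $C(f,z_0)=\bigcap_{r>0}\overline{f(D_r(z_0)\cap U)}$. *)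

theory Defs
  imports "HOL-Analysis.Analysis"
begin

section \<open>The extended complex plane with the spherical metric\<close>

datatype ecomplex = Finite complex | Infty

text \<open>Inverse stereographic projection onto the unit sphere of \<open>complex \<times> real\<close>
  (a copy of Euclidean 3-space), sending infinity to the north pole.\<close>

fun stereo :: "ecomplex \<Rightarrow> complex \<times> real" where
  "stereo (Finite z) =
     ((2 / (1 + (norm z)\<^sup>2)) *\<^sub>R z, ((norm z)\<^sup>2 - 1) / ((norm z)\<^sup>2 + 1))"
| "stereo Infty = (0, 1)"

lemma norm_stereo [simp]: "norm (stereo x) = 1"
proof (cases x)
  case (Finite z)
  define a where "a = (norm z)\<^sup>2"
  have a: "a \<ge> 0" by (simp add: a_def)
  have "(norm (stereo x))\<^sup>2 = (norm ((2 / (1 + a)) *\<^sub>R z))\<^sup>2 + ((a - 1) / (a + 1))\<^sup>2"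
    by (simp add: Finite norm_Pair a_def power_divide)
  also have "(norm ((2 / (1 + a)) *\<^sub>R z))\<^sup>2 = (2 / (1 + a))\<^sup>2 * a"
    by (simp add: power_mult_distrib power_divide a_def)
  also have "(2 / (1 + a))\<^sup>2 * a + ((a - 1) / (a + 1))\<^sup>2 = 1"
    using a by (simp add: power_divide add.commute flip: add_divide_distrib)
      (simp add: power2_eq_square algebra_simps)
  finally show ?thesis
    by (metis norm_ge_zero power2_eq_1_iff real_sqrt_abs real_sqrt_one abs_of_nonneg)
qed (simp add: norm_Pair)

lemma stereo_left_inverse:
  "stereo (Finite z) = (w, t) \<Longrightarrow> t \<noteq> 1 \<and> z = (1 / (1 - t)) *\<^sub>R w"
proof -
  assume *: "stereo (Finite z) = (w, t)"
  define a where "a = (norm z)\<^sup>2"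
  have a: "a + 1 > 0" by (simp add: a_def add_nonneg_pos)
  from * have w: "w = (2 / (1 + a)) *\<^sub>R z" and t: "t = (a - 1) / (a + 1)"
    by (auto simp: a_def)
  have 1: "1 - t = 2 / (1 + a)" using a by (simp add: t field_simps)
  then have "1 - t > 0" using a by (simp add: add.commute)
  moreover have "(1 / (1 - t)) * (2 / (1 + a)) = 1" using a by (simp add: 1)
  ultimately show ?thesis by (simp only: w scaleR_scaleR scaleR_one) simp
qed

lemma inj_stereo: "inj stereo"
proof (rule injI)
  fix x y assume *: "stereo x = stereo y"
  show "x = y"
  proof (cases x; cases y)
    fix z w assume "x = Finite z" "y = Finite w"
    with * show ?thesis
      by (metis stereo_left_inverse surj_pair)
  next
    fix z assume "x = Finite z" "y = Infty"
    with * show ?thesis using stereo_left_inverse[of z 0 1] by simp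
  next
    fix z assume "x = Infty" "y = Finite z"
    with * show ?thesis using stereo_left_inverse[of z 0 1] by simp
  qed simp
qed

lemma arccos_inner_triangle:
  fixes u v w :: "'a::real_inner"
  assumes u: "norm u = 1" and v: "norm v = 1" and w: "norm w = 1"
  shows "arccos (u \<bullet> w) \<le> arccos (u \<bullet> v) + arccos (v \<bullet> w)"
proof -
  have b: "\<bar>x \<bullet> y\<bar> \<le> 1" if "norm x = 1" "norm y = 1" for x y :: 'a
    using Cauchy_Schwarz_ineq2[of x y] that by simp
  define p q where "p = u \<bullet> v" and "q = v \<bullet> w"
  have p: "-1 \<le> p" "p \<le> 1" and q: "-1 \<le> q" "q \<le> 1"
    using b[OF u v] b[OF v w] by (auto simp: p_def q_def abs_le_iff)
  have uw: "-1 \<le> u \<bullet> w" "u \<bullet> w \<le> 1" using b[OF u w] by (auto simp: abs_le_iff)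
  have sq: "u \<bullet> u = 1" "v \<bullet> v = 1" "w \<bullet> w = 1"
    using u v w by (simp_all add: dot_square_norm)
  define u' w' where "u' = u - p *\<^sub>R v" and "w' = w - q *\<^sub>R v"
  have eq: "u' \<bullet> w' = u \<bullet> w - p * q"
    by (simp add: u'_def w'_def inner_diff_left inner_diff_right sq p_def q_def inner_commute)
  have nu: "norm u' = sqrt (1 - p\<^sup>2)"
    by (simp add: norm_eq_sqrt_inner u'_def inner_diff_left inner_diff_right sq p_def
        inner_commute power2_eq_square)
  have nw: "norm w' = sqrt (1 - q\<^sup>2)"
    by (simp add: norm_eq_sqrt_inner w'_def inner_diff_left inner_diff_right sq q_def
        inner_commute power2_eq_square)
  have "- (norm u' * norm w') \<le> u' \<bullet> w'"
    using Cauchy_Schwarz_ineq2[of u' w'] by linarith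
  then have le: "cos (arccos p + arccos q) \<le> u \<bullet> w"
    using p q by (simp add: eq nu nw cos_add sin_arccos)
  show ?thesis
  proof (cases "arccos p + arccos q \<le> pi")
    case True
    have "0 \<le> arccos p + arccos q" using p q by (simp add: arccos_lbound)
    then have "arccos p + arccos q = arccos (cos (arccos p + arccos q))"
      using True by (simp add: arccos_cos)
    also have "\<dots> \<ge> arccos (u \<bullet> w)"
      using le uw by (intro arccos_le_arccos) auto
    finally show ?thesis by (simp add: p_def q_def)
  next
    case False
    then show ?thesis using arccos_ubound[OF uw] by (simp add: p_def q_def)
  qed
qed

instantiation ecomplex :: metric_space
begin

text \<open>The length (great-circle) metric of the unit sphere.\<close>

definition dist_ecomplex :: "ecomplex \<Rightarrow> ecomplex \<Rightarrow> real" where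
  "dist_ecomplex x y = arccos (stereo x \<bullet> stereo y)"

definition uniformity_ecomplex :: "(ecomplex \<times> ecomplex) filter" where
  "uniformity_ecomplex = (INF e\<in>{0 <..}. principal {(x, y). dist x y < e})"

definition open_ecomplex :: "ecomplex set \<Rightarrow> bool" where
  "open_ecomplex S \<longleftrightarrow> (\<forall>x\<in>S. \<forall>\<^sub>F (x', y) in uniformity. x' = x \<longrightarrow> y \<in> S)"

instance
proof
  fix x y z :: ecomplex
  have "\<bar>stereo x \<bullet> stereo y\<bar> \<le> 1"
    using Cauchy_Schwarz_ineq2[of "stereo x" "stereo y"] by simp
  then have "arccos (stereo x \<bullet> stereo y) = 0 \<longleftrightarrow> stereo x \<bullet> stereo y = 1"
    by (metis abs_le_iff arccos_1 cos_arccos cos_zero minus_le_iff)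
  also have "\<dots> \<longleftrightarrow> stereo x = stereo y"
    using norm_cauchy_schwarz_eq[of "stereo x" "stereo y"] by auto
  also have "\<dots> \<longleftrightarrow> x = y" using inj_stereo by (auto dest: injD)
  finally show "dist x y = 0 \<longleftrightarrow> x = y" by (simp add: dist_ecomplex_def)
  show "dist x y \<le> dist x z + dist y z"
    using arccos_inner_triangle[of "stereo x" "stereo z" "stereo y"]
    by (simp add: dist_ecomplex_def inner_commute)
qed (simp_all add: uniformity_ecomplex_def open_ecomplex_def)

end


section \<open>Generalized Jordan domains\<close>

text \<open>The empty set is not excluded; it has empty boundary.\<close>

definition domain :: "ecomplex set \<Rightarrow> bool" where
  "domain U \<longleftrightarrow> open U \<and> connected U"

definition Jordan_curve :: "ecomplex set \<Rightarrow> bool" where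
  "Jordan_curve C \<longleftrightarrow> C homeomorphic sphere (0::complex) 1"

definition Jordan_boundary_components :: "ecomplex set \<Rightarrow> ecomplex set set" where
  "Jordan_boundary_components U = {C \<in> components (frontier U). Jordan_curve C}"

text \<open>In an infinite family, the choice of the enumeration is immaterial for convergence
  of the diameters to zero.\<close>

definition null_diameters :: "ecomplex set set \<Rightarrow> bool" where
  "null_diameters J \<longleftrightarrow> finite J \<or>
     (\<exists>C :: nat \<Rightarrow> ecomplex set. bij_betw C UNIV J \<and> (\<lambda>n. diameter (C n)) \<longlonglongrightarrow> 0)"

definition generalized_Jordan_domain :: "ecomplex set \<Rightarrow> bool" where
  "generalized_Jordan_domain U \<longleftrightarrow>
     domain U \<and>
     (\<forall>C\<in>components (frontier U). (\<exists>z. C = {z}) \<or> Jordan_curve C) \<and>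
     countable (Jordan_boundary_components U) \<and>
     null_diameters (Jordan_boundary_components U)"


section \<open>Simple connectivity at the boundary\<close>

definition simply_connected_at :: "ecomplex set \<Rightarrow> ecomplex \<Rightarrow> bool" where
  "simply_connected_at U z0 \<longleftrightarrow>
     (\<forall>r>0. \<exists>N. open N \<and> z0 \<in> N \<and> N \<subseteq> ball z0 r \<and> connected (N \<inter> U))"

definition simply_connected_at_boundary :: "ecomplex set \<Rightarrow> bool" where
  "simply_connected_at_boundary U \<longleftrightarrow> (\<forall>z\<in>frontier U. simply_connected_at U z)"


section \<open>Cluster sets\<close>

definition cluster_set ::
    "'x metric \<Rightarrow> ecomplex set \<Rightarrow> (ecomplex \<Rightarrow> 'x) \<Rightarrow> ecomplex \<Rightarrow> 'x set" where
  "cluster_set X U f z0 =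
     {w \<in> mspace X. \<exists>z :: nat \<Rightarrow> ecomplex. (\<forall>k. z k \<in> U) \<and> z \<longlonglongrightarrow> z0 \<and>
        limitin (mtopology_of X) (\<lambda>k. f (z k)) w sequentially}"

text \<open>Quantification over all compact metric spaces whose points are drawn from the type \<open>'x\<close>
  (\<open>'x metric\<close> is the type of metric spaces with an arbitrary carrier set in \<open>'x\<close> and an
  arbitrary metric on it).  A compact metric space has at most continuum many points, so
  as soon as \<open>real\<close> injects into \<open>'x\<close> every compact metric space is isometric to one of these.\<close>

definition connected_cluster_sets :: "'x itself \<Rightarrow> ecomplex set \<Rightarrow> bool" where
  "connected_cluster_sets TYPE('x) U \<longleftrightarrow>
     (\<forall>(X :: 'x metric) f.
        compact_space (mtopology_of X) \<and> continuous_map (top_of_set U) (mtopology_of X) f \<longrightarrow>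
        (\<forall>z\<in>frontier U. connectedin (mtopology_of X) (cluster_set X U f z)))"

end

theory Submission
  imports Defs "HOL-Complex_Analysis.Complex_Analysis"
begin

text \<open>
  The equivalence of connected cluster sets with simple connectivity at the boundary is soft.  If
  \<open>U\<close> has small neighbourhoods of \<open>z\<close> with connected trace, then a splitting of the cluster set at
  \<open>z\<close> into two closed pieces would split the image of such a trace (\<open>connected_cluster_set\<close>).
  Conversely, if some disc about \<open>z\<close> contains no such neighbourhood, then the part of \<open>U\<close> in the
  disc falls into two open pieces that both accumulate at \<open>z\<close>
  (\<open>splitting_if_not_connected_nbhds\<close>), and a bump function living on one of the pieces has
  cluster set \<open>{0, 1}\<close> at \<open>z\<close>.

  The equivalence with generalized Jordan domains is a theorem of plane topology.  A point of \<open>U\<close>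
  is moved to infinity; then \<open>U\<close> becomes the complement of a compact plane set \<open>E\<close> with connected
  complement, and the boundary components of \<open>U\<close> are the boundaries of the components of \<open>E\<close>
  (\<open>component_frontier_eq\<close>).  The plane version is \<open>plane_boundary_iff\<close>.

  Suppose that the boundary components are points or Jordan curves of diameters tending to zero.
  Janiszewski's theorem shows that the complement of one component \<open>K\<close> is locally connected at the
  points of its Jordan boundary (\<open>Jordan_curve_local_side\<close>).  A small connected piece of that
  complement is enlarged by small regions around all the components of \<open>E\<close> that it meets, which
  is possible because all but finitely many of these are small.  Removing a whole family of
  components from a connected open set that contains each of them entirely leaves a connected set,
  again by Janiszewski's theorem (\<open>connected_diff_saturated\<close>).

  Suppose conversely that \<open>U\<close> is simply connected at its boundary.  If infinitely many boundary
  components were large, then infinitely many of them would contain continua that cross a common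
  strip and come close to a common point inside the strip.  Of three disjoint continua crossing a
  strip one separates the other two (\<open>no_third_crossing\<close>), yet a small connected piece of \<open>U\<close> touches all three.  It remains to see that the boundary of a
  nondegenerate component \<open>K\<close> is a Jordan curve.  Local connectivity passes from \<open>U\<close> to the
  complement of \<open>K\<close> (\<open>connected_nbhds_component\<close>), which is the image of a punctured disc under a
  Riemann map \<open>\<Phi>\<close>, and Caratheodory's argument applies.  By a length-area estimate there are
  arbitrarily small crosscuts of the disc around a boundary point with arbitrarily small images; as the
  traces of small neighbourhoods are connected, \<open>\<Phi>\<close> has a limit at every point of the circle
  (\<open>boundary_limit_exists\<close>).  If the limit were the same at two points of the circle, it would be
  constant on one of the two arcs between them, which is impossible for a nonconstant holomorphic
  function (\<open>vanishing_on_boundary_arc\<close>).  So the boundary function is a homeomorphism of the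
  circle onto the boundary of \<open>K\<close>.
\<close>

section \<open>Components of a compact set\<close>

lemma compact_components:
  fixes S :: "'a::t2_space set"
  assumes "compact S" "C \<in> components S"
  shows "compact C"
proof -
  have "closed C" using assms closed_components compact_imp_closed by blast
  moreover have "S \<inter> C = C" using assms(2) in_components_subset by blast
  ultimately show ?thesis using compact_Int_closed[OF assms(1), of C] by simp
qed

text \<open>In a compact set the components coincide with the quasi-components (Sura-Bura).\<close>

lemma component_clopen_superset:
  fixes E :: "'a::euclidean_space set"
  assumes "compact E" "K \<in> components E" "open O'" "K \<subseteq> O'"
  obtains A where "compact A" "compact (E - A)" "K \<subseteq> A" "A \<subseteq> O'" "A \<subseteq> E"
proof -
  have "compact K" by (rule compact_components[OF assms(1,2)])
  then obtain A where A: "openin (top_of_set E) A" "compact A" "K \<subseteq> A" "A \<subseteq> O'"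
    using Sura_Bura_clopen_subset[of E K O'] assms closed_imp_locally_compact compact_imp_closed by metis
  have "closedin (top_of_set E) (E - A)"
    using A(1) closedin_diff by fastforce
  then have "compact (E - A)"
    using assms(1) closedin_compact by blast
  with A show ?thesis using that openin_imp_subset by blast
qed

lemma component_subset_clopen:
  assumes "closed A" "closed (E - A)" "A \<subseteq> E" "K \<in> components E" "K \<inter> A \<noteq> {}"
  shows "K \<subseteq> A"
proof -
  have "connected K" "K \<subseteq> E" using assms in_components_connected in_components_subset by blast+
  then show ?thesis
    using connected_closedD[of K A "E - A"] assms by blast
qed

text \<open>The region is a component of an open set that meets \<open>E\<close> only in a clopen piece of \<open>E\<close>; a component of \<open>E\<close> cannot leave such a piece and cannot cross the boundary of the region.\<close>

lemma component_isolating_region: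
  fixes E :: "'a::euclidean_space set"
  assumes "compact E" "K \<in> components E" "open O'" "K \<subseteq> O'"
  obtains G where "open G" "connected G" "K \<subseteq> G" "G \<subseteq> O'"
    "\<And>L. L \<in> components E \<Longrightarrow> L \<inter> G \<noteq> {} \<Longrightarrow> L \<subseteq> G"
proof -
  obtain A where A: "compact A" "compact (E - A)" "K \<subseteq> A" "A \<subseteq> O'" "A \<subseteq> E"
    using component_clopen_superset[OF assms] by metis
  obtain x where x: "x \<in> K" using assms(2) in_components_nonempty by blast
  define W where "W = O' - (E - A)"
  define G where "G = connected_component_set W x"
  have oW: "open W" unfolding W_def using assms A by (simp add: compact_imp_closed open_Diff)
  have AW: "A \<subseteq> W" and WE: "W \<inter> E \<subseteq> A" using A by (auto simp: W_def)
  show ?thesis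
  proof
    show "open G" using oW by (simp add: G_def open_connected_component)
    show "connected G" by (simp add: G_def)
    show "K \<subseteq> G" unfolding G_def
      by (rule connected_component_maximal) (use x assms(2) A AW in_components_connected in auto)
    show "G \<subseteq> O'" unfolding G_def using connected_component_subset W_def by fastforce
    fix L assume L: "L \<in> components E" "L \<inter> G \<noteq> {}"
    have "G \<subseteq> W" by (simp add: G_def connected_component_subset)
    then have "L \<inter> A \<noteq> {}" using L WE in_components_subset by blast
    then have "L \<subseteq> A"
      using component_subset_clopen[of A E L] A L compact_imp_closed by blast
    then have "L \<subseteq> W" using AW by simp
    moreover have "G \<in> components W" unfolding G_def using x A AW by (intro componentsI) auto
    ultimately show "L \<subseteq> G"
      using components_maximal[of G W L] L in_components_connected by blast
  qed
qed

text \<open>Finitely many of the clopen pieces around the components through points of \<open>Q\<close> suffice to cover \<open>Q\<close>.\<close>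

lemma saturated_clopen_superset:
  fixes E :: "'a::euclidean_space set"
  assumes E: "compact E" and Q: "compact Q" "Q \<subseteq> E" and M: "open M"
    and sat: "\<And>L. L \<in> components E \<Longrightarrow> L \<inter> Q \<noteq> {} \<Longrightarrow> L \<subseteq> M"
  obtains B where "compact B" "compact (E - B)" "Q \<subseteq> B" "B \<subseteq> M" "B \<subseteq> E"
proof -
  have "\<exists>A. compact A \<and> compact (E - A) \<and> x \<in> A \<and> A \<subseteq> M \<and> A \<subseteq> E" if x: "x \<in> Q" for x
  proof -
    define L where "L = connected_component_set E x"
    have "L \<in> components E" "x \<in> L" using x Q by (auto simp: L_def componentsI)
    moreover then have "L \<subseteq> M" using sat x by blast
    ultimately show ?thesis using component_clopen_superset[OF E _ M] by (metis subsetD)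
  qed
  then obtain A where A: "\<And>x. x \<in> Q \<Longrightarrow> compact (A x) \<and> compact (E - A x) \<and> x \<in> A x \<and> A x \<subseteq> M \<and> A x \<subseteq> E"
    by metis
  have "open (- (E - A x))" if "x \<in> Q" for x
    using A[OF that] compact_imp_closed open_Compl by blast
  moreover have "Q \<subseteq> (\<Union>x\<in>Q. - (E - A x))" using A by blast
  ultimately obtain D where D: "D \<subseteq> Q" "finite D" "Q \<subseteq> (\<Union>x\<in>D. - (E - A x))"
    using compactE_image[OF Q(1), of Q "\<lambda>x. - (E - A x)"] by blast
  define B where "B = (\<Union>x\<in>D. A x)"
  have AD: "compact (A x) \<and> A x \<subseteq> M \<and> A x \<subseteq> E" if "x \<in> D" for x using A D(1) that by blast
  have "compact B" unfolding B_def using D(2) AD by (intro compact_UN) auto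
  moreover have "Q \<subseteq> B" 
  proof
    fix x assume "x \<in> Q"
    then have "x \<in> E" "\<exists>d\<in>D. x \<in> - (E - A d)" using D(3) Q(2) by blast+
    then show "x \<in> B" unfolding B_def by blast
  qed
  ultimately have B: "compact B" "B \<subseteq> M" "B \<subseteq> E" "Q \<subseteq> B" using AD unfolding B_def by blast+
  have "E - B = E \<inter> (\<Inter>x\<in>D. E - A x)" unfolding B_def by blast
  moreover have "compact (E \<inter> (\<Inter>x\<in>D. E - A x))"
  proof (rule compact_Int_closed[OF E], rule closed_INT)
    show "\<forall>x\<in>D. closed (E - A x)" using A D(1) compact_imp_closed by blast
  qed
  ultimately have cl: "compact (E - B)" by simp
  show thesis using that B cl by blast
qed

text \<open>A component of \<open>- A\<close> that misses \<open>- E\<close> would be contained in \<open>E - A\<close>.  Its frontier lies in \<open>A\<close>, so it would be closed as well as open.\<close>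

lemma connected_Compl_clopen:
  fixes E :: "'a::euclidean_space set"
  assumes "2 \<le> DIM('a)" "compact E" "connected (- E)" "A \<subseteq> E" "closed A" "closed (E - A)"
  shows "connected (- A)"
proof -
  have "E \<noteq> UNIV" using compact_imp_bounded[OF assms(2)] not_bounded_UNIV by metis
  then have ne: "- E \<noteq> {}" by blast
  have meets: "C \<inter> - E \<noteq> {}" if C: "C \<in> components (- A)" for C
  proof
    assume d: "C \<inter> - E = {}"
    have CA: "C \<subseteq> - A" "C \<noteq> {}" using C in_components_subset in_components_nonempty by auto
    have oC: "open C" using C assms(5) open_components by blast
    have fr: "frontier C \<subseteq> A" using C assms(5) frontier_of_components_closed_complement by blast
    have "closure C \<subseteq> E - A"
      by (rule closure_minimal) (use d CA assms in auto)
    then have "frontier C = {}" using fr by (auto simp: frontier_def)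
    then have "C = UNIV" using frontier_eq_empty CA by blast
    then show False using d ne by simp
  qed
  have "connected_component (- A) x y" if "x \<in> - A" "y \<in> - A" for x y
  proof -
    have *: "\<exists>z\<in>- E. connected_component (- A) x z" if "x \<in> - A" for x
      using meets[of "connected_component_set (- A) x"] that componentsI[of x "- A"] by blast
    obtain u v where uv: "u \<in> - E" "v \<in> - E" "connected_component (- A) x u" "connected_component (- A) y v"
      using *[OF \<open>x \<in> - A\<close>] *[OF \<open>y \<in> - A\<close>] by blast
    have "connected_component (- A) u v"
      unfolding connected_component_def using assms(3,4) uv by blast
    then show ?thesis using uv connected_component_trans connected_component_sym by metis
  qed
  then show ?thesis by (simp add: connected_iff_connected_component)
qed

text \<open>The complement of \<open>K\<close> is the union of the complements of the clopen pieces around \<open>K\<close>, and all of these contain \<open>- E\<close>.\<close>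

lemma connected_Compl_component:
  fixes E :: "'a::euclidean_space set"
  assumes "2 \<le> DIM('a)" "compact E" "connected (- E)" "K \<in> components E"
  shows "connected (- K)"
proof -
  have KE: "K \<subseteq> E" using assms in_components_subset by blast
  have "E \<noteq> UNIV" using compact_imp_bounded[OF assms(2)] not_bounded_UNIV by metis
  then have ne: "- E \<noteq> {}" by blast
  have "\<exists>S. connected S \<and> S \<subseteq> - K \<and> - E \<subseteq> S \<and> x \<in> S" if x: "x \<in> - K" for x
  proof -
    obtain A where A: "compact A" "compact (E - A)" "K \<subseteq> A" "A \<subseteq> - {x}" "A \<subseteq> E"
      using component_clopen_superset[of E K "- {x}"] assms x by blast
    then have "connected (- A)"
      using assms by (intro connected_Compl_clopen[of E A]) (auto simp: compact_imp_closed)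
    with A show ?thesis by (intro exI[of _ "- A"]) auto
  qed
  then obtain S where S: "\<And>x. x \<in> - K \<Longrightarrow> connected (S x) \<and> S x \<subseteq> - K \<and> - E \<subseteq> S x \<and> x \<in> S x"
    by metis
  have "- K = (\<Union>x\<in>- K. S x)" using S by blast
  moreover have "connected (\<Union>x\<in>- K. S x)"
    by (rule connected_Union) (use S ne KE in \<open>auto, blast?\<close>)
  ultimately show ?thesis by simp
qed

lemma frontier_component:
  fixes E :: "'a::euclidean_space set"
  assumes "compact E" "K \<in> components E"
  shows "frontier K = K \<inter> frontier E"
proof -
  have clK: "closed K" using assms closed_components compact_imp_closed by blast
  have clE: "closed E" using assms compact_imp_closed by blast
  have KE: "K \<subseteq> E" using assms in_components_subset by blast
  have "x \<in> interior K" if x: "x \<in> K" "x \<in> interior E" for x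
  proof -
    obtain e where e: "e > 0" "ball x e \<subseteq> E" using x(2) mem_interior by blast
    have "ball x e \<subseteq> K" using components_maximal[OF assms(2), of "ball x e"] e x(1)
      by (metis IntI centre_in_ball connected_ball emptyE)
    then show ?thesis using e mem_interior by blast
  qed
  moreover have "interior K \<subseteq> interior E" using KE interior_mono by blast
  ultimately show ?thesis using clK clE KE by (auto simp: frontier_def)
qed

text \<open>Since both \<open>K\<close> and its complement are connected, unicoherence of the space makes the frontier of \<open>K\<close> connected.  Hence no component splits when \<open>E\<close> is replaced by its frontier.\<close>

lemma component_frontier_eq:
  fixes E :: "'a::euclidean_space set"
  assumes "2 \<le> DIM('a)" "compact E" "connected (- E)"
  shows "components (frontier E) = frontier ` components E"
proof -
  have clE: "closed E" using assms compact_imp_closed by blast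
  then have fE: "frontier E \<subseteq> E" using frontier_subset_closed by blast
  have 1: "frontier K \<in> components (frontier E)" if K: "K \<in> components E" for K
  proof -
    have cK: "compact K" by (rule compact_components[OF assms(2) K])
    have "connected (frontier K)"
      using connected_frontier_simple connected_Compl_component[OF assms K] in_components_connected K by blast
    moreover have "frontier K \<noteq> {}"
      using frontier_eq_empty[of K] K in_components_nonempty cK compact_imp_bounded not_bounded_UNIV by metis
    moreover have "frontier K = K \<inter> frontier E" by (rule frontier_component[OF assms(2) K])
    moreover have "T = frontier K" if "connected T" "T \<noteq> {}" "T \<subseteq> frontier E" "frontier K \<subseteq> T" for T
    proof -
      have "T \<subseteq> K" using components_maximal[OF K that(1)] that fE calculation(2,3) by blast
      then show ?thesis using that calculation by blast
    qed
    ultimately show ?thesis unfolding in_components_maximal by blast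
  qed
  have 2: "C \<in> frontier ` components E" if C: "C \<in> components (frontier E)" for C
  proof -
    obtain K where K: "K \<in> components E" "C \<subseteq> K"
      using exists_component_superset[of C E] C in_components_connected in_components_subset in_components_nonempty fE
      by (metis subset_empty subset_trans)
    have "C \<subseteq> frontier K" using frontier_component[OF assms(2) K(1)] K C in_components_subset by blast
    then have "C = frontier K" using 1[OF K(1)] C
      by (metis components_eq in_components_nonempty inf.absorb_iff1)
    then show ?thesis using K by blast
  qed
  show ?thesis using 1 2 by blast
qed

text \<open>Join two points by a path in \<open>M\<close> and enclose the part of \<open>E\<close> that the path meets in a clopen
  piece \<open>B\<close> of \<open>E\<close> inside \<open>M\<close>.  Neither \<open>B\<close> nor \<open>- M \<union> (E - B)\<close> separates the two points:
  the former because its complement is connected, the latter because it misses the path.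
  The two sets are disjoint, so by Janiszewski's theorem their union does not separate either.\<close>

lemma connected_diff_saturated:
  fixes E M :: "complex set"
  assumes E: "compact E" "connected (- E)" and M: "open M" "connected M"
    and sat: "\<And>L. L \<in> components E \<Longrightarrow> L \<inter> M \<noteq> {} \<Longrightarrow> L \<subseteq> M"
  shows "connected (M - E)"
proof -
  have "connected_component (M - E) a b" if a: "a \<in> M - E" and b: "b \<in> M - E" for a b
  proof -
    have "path_component M a b" using M a b
      by (simp add: open_path_connected_component connected_iff_connected_component)
    then obtain P where P: "path P" "path_image P \<subseteq> M" "pathstart P = a" "pathfinish P = b"
      unfolding path_component_def by blast
    obtain B where B: "compact B" "compact (E - B)" "E \<inter> path_image P \<subseteq> B" "B \<subseteq> M" "B \<subseteq> E"
    proof (rule saturated_clopen_superset[OF E(1)])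
      show "compact (E \<inter> path_image P)" using E P by (simp add: compact_Int compact_path_image)
    qed (use M sat P in auto)
    then have cl: "compact (E - B)" by simp
    have "connected_component (- (B \<union> (- M \<union> (E - B)))) a b"
    proof (rule Janiszewski)
      show "compact B" by fact
      show "closed (- M \<union> (E - B))" using M cl by (simp add: closed_Un compact_imp_closed closed_Compl)
      have "B \<inter> (- M \<union> (E - B)) = {}" using B by blast
      then show "connected (B \<inter> (- M \<union> (E - B)))" by simp
      have "connected (- B)"
        by (rule connected_Compl_clopen[of E]) (use E B cl compact_imp_closed in auto)
      then show "connected_component (- B) a b"
        unfolding connected_component_def using a b B by blast
      show "connected_component (- (- M \<union> (E - B))) a b"
        unfolding connected_component_def
        apply (rule exI[of _ "path_image P"])
        using P B by (auto simp: connected_path_image)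
    qed
    moreover have "- (B \<union> (- M \<union> (E - B))) = M - E" using B by blast
    ultimately show ?thesis by simp
  qed
  then show ?thesis by (simp add: connected_iff_connected_component)
qed

section \<open>Jordan boundary components give connected neighbourhoods\<close>

text \<open>Simple connectivity at a point, for any metric space, so that it can be used on the sphere and in the plane.\<close>

definition connected_nbhds :: "'a::metric_space set \<Rightarrow> 'a \<Rightarrow> bool" where
  "connected_nbhds U z \<longleftrightarrow> (\<forall>r>0. \<exists>N. open N \<and> z \<in> N \<and> N \<subseteq> ball z r \<and> connected (N \<inter> U))"

lemma connected_nbhdsE:
  assumes "connected_nbhds U z" "0 < r"
  obtains N where "open N" "z \<in> N" "N \<subseteq> ball z r" "connected (N \<inter> U)"
proof -
  have "\<forall>r>0. \<exists>N. open N \<and> z \<in> N \<and> N \<subseteq> ball z r \<and> connected (N \<inter> U)"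
    using assms(1) unfolding connected_nbhds_def .
  with assms(2) show ?thesis using that by blast
qed

text \<open>Let \<open>\<beta>\<close> be a closed subarc of \<open>C\<close> that avoids \<open>z\<close> and contains the part of \<open>C\<close> outside
  \<open>ball z r\<close>.  The curve \<open>C\<close> and the set \<open>- ball z r \<union> \<beta>\<close> meet exactly in the connected set
  \<open>\<beta>\<close>, and the latter does not separate points close to \<open>z\<close>.  Janiszewski's theorem therefore
  reduces separation by the union of both sets to separation by \<open>C\<close> alone.\<close>

lemma Jordan_curve_local_side:
  fixes C :: "complex set"
  assumes C: "C homeomorphic sphere (0::complex) 1" and z: "z \<in> C" and r: "r > 0"
  obtains s where "s > 0" "s \<le> r"
    "\<And>a b. a \<in> ball z s \<Longrightarrow> b \<in> ball z s \<Longrightarrow> connected_component (- C) a b \<Longrightarrow>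
       connected_component (ball z r - C) a b"
proof -
  obtain f g where fg: "homeomorphism (sphere (0::complex) 1) C f g"
    using C homeomorphic_sym unfolding homeomorphic_def by blast
  have compC: "compact C" using homeomorphic_compactness[OF C] by simp
  have contf: "continuous_on (sphere 0 1) f" and fim: "f ` sphere 0 1 = C"
    and gf: "\<And>x. x \<in> sphere 0 1 \<Longrightarrow> g (f x) = x"
    using fg by (auto simp: homeomorphism_def)
  define c where "c = g z"
  have c: "c \<in> sphere 0 1" "f c = z" using fg z by (auto simp: homeomorphism_def c_def)
  define h where "h = (\<lambda>t. f (c * cis t))"
  have nc: "c * cis t \<in> sphere 0 1" for t using c by (simp add: norm_mult)
  have conth: "continuous_on UNIV h" unfolding h_def
    by (rule continuous_on_compose2[OF contf]) (use nc in \<open>auto intro!: continuous_intros\<close>)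
  have h0: "h 0 = z" using c by (simp add: h_def)
  have "isCont h 0" using conth by (simp add: continuous_on_eq_continuous_at)
  then obtain \<eta> where \<eta>: "\<eta> > 0" "\<And>t. \<bar>t\<bar> < \<eta> \<Longrightarrow> dist (h t) z < r"
    unfolding continuous_at_eps_delta using h0 r by (metis dist_norm diff_zero real_norm_def)
  \<comment> \<open>The parameters that are left out are close to \<open>0\<close> modulo \<open>2 * pi\<close>, so their images lie in the ball.\<close>
  define \<beta> where "\<beta> = h ` {min \<eta> 1..2 * pi - min \<eta> 1}"
  have comp\<beta>: "compact \<beta>" unfolding \<beta>_def
    by (rule compact_continuous_image) (use continuous_on_subset[OF conth] in auto)
  have conn\<beta>: "connected \<beta>" unfolding \<beta>_def
    by (rule connected_continuous_image) (use continuous_on_subset[OF conth] in auto)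
  have z\<beta>: "z \<notin> \<beta>"
  proof
    assume "z \<in> \<beta>"
    then obtain t where t: "t \<in> {min \<eta> 1..2 * pi - min \<eta> 1}" "f (c * cis t) = f c"
      using c by (auto simp: \<beta>_def h_def)
    then have "c * cis t = c" using gf[OF nc[of t]] gf[OF c(1)] by simp
    then have "cis t = 1" using c by auto
    then have "cos t = 1" by (metis cis.simps(1) one_complex.simps(1))
    moreover have "0 < t" "t < 2 * pi" using t \<eta> by auto
    ultimately show False
      using cos_double_sin[of "t/2"] sin_gt_zero[of "t/2"] by simp
  qed
  have "\<beta> \<subseteq> C" unfolding \<beta>_def h_def using fim nc by blast
  have C_out: "x \<in> \<beta>" if x: "x \<in> C" "x \<notin> ball z r" for x
  proof -
    obtain u where u: "u \<in> sphere 0 1" "f u = x" using fim x by blast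
    have "norm (u / c) = 1" using u c by (simp add: norm_divide)
    then obtain t where t: "0 \<le> t" "t < 2 * pi" "u / c = cis t"
      using Arg2pi[of "u / c"] that[of "Arg2pi (u / c)"] by (simp only: cis_conv_exp is_Arg_def) simp
    moreover have "c \<noteq> 0" using c(1) by auto
    ultimately have "c * cis t = u" by (metis nonzero_mult_div_cancel_left times_divide_eq_right)
    then have ut: "h t = x" using u by (simp add: h_def)
    have "\<not> \<bar>t\<bar> < \<eta>" using \<eta>(2)[of t] ut x by (auto simp: dist_commute)
    moreover have "\<not> \<bar>t - 2 * pi\<bar> < \<eta>"
    proof -
      have "cis (t - 2 * pi) = cis t" by (simp add: complex_eq_iff cos_diff sin_diff)
      then have "h (t - 2 * pi) = h t" by (simp add: h_def)
      then show ?thesis using \<eta>(2)[of "t - 2*pi"] ut x by (auto simp: dist_commute)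
    qed
    ultimately show ?thesis unfolding \<beta>_def using t ut by (intro image_eqI[of _ _ t]) auto
  qed
  have "open (ball z r - \<beta>)" using comp\<beta> by (simp add: open_Diff compact_imp_closed)
  moreover have "z \<in> ball z r - \<beta>" using z\<beta> r by simp
  ultimately obtain s where s: "s > 0" "ball z s \<subseteq> ball z r - \<beta>"
    using open_contains_ball by metis
  show ?thesis
  proof
    show "s > 0" by fact
    have "ball z s \<subseteq> ball z r" using s by blast
    then show "s \<le> r" using s r by (simp add: ball_subset_ball_iff)
    fix a b assume ab: "a \<in> ball z s" "b \<in> ball z s" "connected_component (- C) a b"
    have "connected_component (- (C \<union> (- ball z r \<union> \<beta>))) a b"
    proof (rule Janiszewski)
      show "compact C" by fact
      show "closed (- ball z r \<union> \<beta>)" using comp\<beta> by (simp add: compact_imp_closed closed_Un closed_Compl)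
      have "C \<inter> (- ball z r \<union> \<beta>) = \<beta>" using \<open>\<beta> \<subseteq> C\<close> C_out by blast
      then show "connected (C \<inter> (- ball z r \<union> \<beta>))" using conn\<beta> by simp
      show "connected_component (- C) a b" by fact
      show "connected_component (- (- ball z r \<union> \<beta>)) a b"
        unfolding connected_component_def
        by (rule exI[of _ "ball z s"]) (use ab s in auto)
    qed
    moreover have "- (C \<union> (- ball z r \<union> \<beta>)) = ball z r - C" using \<open>\<beta> \<subseteq> C\<close> by blast
    ultimately show "connected_component (ball z r - C) a b" by simp
  qed
qed

text \<open>Outside of the ball there is nothing but one connected unbounded set, which does not meet the frontier of \<open>K\<close>.\<close>

lemma component_subset_cball:
  fixes K :: "'a::euclidean_space set"
  assumes "2 \<le> DIM('a)" "compact K" "frontier K \<subseteq> cball x e"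
  shows "K \<subseteq> cball x e"
proof -
  have cc: "connected (- cball x e)" using connected_complement_bounded_convex[of "cball x e"] assms by auto
  have "(- cball x e) \<inter> K = {}"
  proof (rule ccontr)
    assume "(- cball x e) \<inter> K \<noteq> {}"
    then have "- cball x e - K = {}" using connected_Int_frontier[OF cc] assms(3) by blast
    then have "- cball x e \<subseteq> K" by blast
    then have "UNIV = K \<union> cball x e" by blast
    then show False using assms(2) compact_imp_bounded bounded_Un bounded_cball not_bounded_UNIV by metis
  qed
  then show ?thesis by blast
qed

text \<open>A component that is a point has arbitrarily small isolating regions, whose traces are connected
  by \<open>connected_diff_saturated\<close>.  In the other case, start with the local side \<open>M0\<close> of the Jordan curve at \<open>z\<close> and add to
  it an isolating region for every component of \<open>E\<close> that it meets.  The result contains every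
  component that it meets, and it is still small since large components stay away from \<open>z\<close>.\<close>

lemma connected_nbhds_if_Jordan_components:
  fixes E :: "complex set"
  assumes E: "compact E" "connected (- E)"
    and comp: "\<And>C. C \<in> components (frontier E) \<Longrightarrow> (\<exists>z. C = {z}) \<or> C homeomorphic sphere (0::complex) 1"
    and null: "\<And>e. e > 0 \<Longrightarrow> finite {C \<in> components (frontier E). e \<le> diameter C}"
    and z: "z \<in> frontier E"
  shows "connected_nbhds (- E) z"
  unfolding connected_nbhds_def
proof (intro allI impI)
  fix r :: real assume r: "r > 0"
  have dim: "2 \<le> DIM(complex)" by simp
  have clE: "closed E" using E compact_imp_closed by blast
  have zE: "z \<in> E" using z clE frontier_subset_closed by blast
  define K where "K = connected_component_set E z"
  have K: "K \<in> components E" "z \<in> K" using zE by (auto simp: K_def componentsI)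
  have compL: "compact L" "connected L" "L \<subseteq> E" "L \<noteq> {}" "connected (- L)" "frontier L \<in> components (frontier E)"
    if L: "L \<in> components E" for L
  proof -
    show "compact L" by (rule compact_components[OF E(1) L])
    show "connected L" "L \<subseteq> E" "L \<noteq> {}" using in_components_connected[OF L] in_components_subset[OF L] in_components_nonempty[OF L] by auto
    show "connected (- L)" using connected_Compl_component[OF dim E L] .
    show "frontier L \<in> components (frontier E)" using component_frontier_eq[OF dim E] L by blast
  qed
  have zfK: "z \<in> frontier K" using frontier_component[OF E(1) K(1)] K z by blast
  show "\<exists>N. open N \<and> z \<in> N \<and> N \<subseteq> ball z r \<and> connected (N \<inter> - E)"
    using comp[OF compL(6)[OF K(1)]]
  proof
    assume "\<exists>w. frontier K = {w}"
    then have fK: "frontier K = {z}" using zfK by auto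
    have "K \<subseteq> cball z 0"
      using component_subset_cball[OF dim compL(1)[OF K(1)], of z 0] fK by simp
    then have "K \<subseteq> ball z r" using r by auto
    then obtain G where G: "open G" "connected G" "K \<subseteq> G" "G \<subseteq> ball z r"
      "\<And>L. L \<in> components E \<Longrightarrow> L \<inter> G \<noteq> {} \<Longrightarrow> L \<subseteq> G"
      using component_isolating_region[OF E(1) K(1), of "ball z r"] by auto
    have "connected (G - E)" using connected_diff_saturated[OF E G(1,2) G(5)] .
    then show ?thesis using G K by (intro exI[of _ G]) (auto simp: Diff_eq)
  next
    assume Jor: "frontier K homeomorphic sphere (0::complex) 1"
    define e where "e = r / 4"
    have e: "e > 0" using r by (simp add: e_def)
    define B where "B = {C \<in> components (frontier E). e \<le> diameter C} - {frontier K}"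
    have finB: "finite B" using null[OF e] by (simp add: B_def)
    have clB: "closed (\<Union>B)"
      by (rule closed_Union[OF finB]) (auto simp: B_def intro: closed_components)
    have "z \<notin> \<Union>B"
    proof
      assume "z \<in> \<Union>B"
      then obtain C where "C \<in> components (frontier E)" "C \<noteq> frontier K" "z \<in> C" by (auto simp: B_def)
      then show False using components_eq[OF _ compL(6)[OF K(1)]] zfK by blast
    qed
    \<comment> \<open>Large components of \<open>E\<close> other than \<open>K\<close> are finite in number and closed, so a small disc about \<open>z\<close> avoids them.\<close>
    define BL where "BL = {L \<in> components E. frontier L \<in> B}"
    have inj: "inj_on frontier (components E)"
    proof (rule inj_onI)
      fix L L' assume *: "L \<in> components E" "L' \<in> components E" "frontier L = frontier L'"
      then obtain x where "x \<in> frontier L" using compL(6) in_components_nonempty by blast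
      then show "L = L'" using * components_eq[of L E L'] frontier_component[OF E(1)] by blast
    qed
    have "finite BL" unfolding BL_def
      by (rule finite_imageD[of frontier]) (use finB inj in \<open>auto intro: finite_subset inj_on_subset\<close>)
    then have clBL: "closed (\<Union>BL)"
      by (rule closed_Union) (auto simp: BL_def intro: closed_components clE)
    have zBL: "z \<notin> \<Union>BL"
    proof
      assume "z \<in> \<Union>BL"
      then obtain L where L: "L \<in> components E" "frontier L \<in> B" "z \<in> L" by (auto simp: BL_def)
      then have "L = K" using components_eq[OF L(1) K(1)] K by blast
      then show False using L(2) by (simp add: B_def)
    qed
    have "open (ball z e - \<Union>BL)" using clBL by (simp add: open_Diff)
    then obtain r' where r': "r' > 0" "ball z r' \<subseteq> ball z e - \<Union>BL"
      using open_contains_ball_eq[of "ball z e - \<Union>BL" z] zBL e by (meson DiffI centre_in_ball)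
    then have r'e: "r' \<le> e" using ball_subset_ball_iff[of z r' z e] by auto
    obtain s where s: "s > 0" "s \<le> r'"
      "\<And>a b. a \<in> ball z s \<Longrightarrow> b \<in> ball z s \<Longrightarrow> connected_component (- frontier K) a b \<Longrightarrow>
       connected_component (ball z r' - frontier K) a b"
      using Jordan_curve_local_side[OF Jor zfK r'(1)] by blast
    have clK: "closed K" using compL(1)[OF K(1)] compact_imp_closed by blast
    have fKK: "frontier K \<subseteq> K" using clK frontier_subset_closed by blast
    have join: "connected_component (ball z r' - K) a b" if ab: "a \<in> ball z s - K" "b \<in> ball z s - K" for a b
    proof -
      have "connected_component (- frontier K) a b" unfolding connected_component_def
        by (rule exI[of _ "- K"]) (use compL(5)[OF K(1)] fKK ab in auto)
      then obtain T where T: "connected T" "T \<subseteq> ball z r' - frontier K" "a \<in> T" "b \<in> T"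
        using s(3)[of a b] ab unfolding connected_component_def by blast
      then have "T \<inter> K = {}" using connected_Int_frontier[OF T(1), of K] ab by blast
      then show ?thesis unfolding connected_component_def using T by (intro exI[of _ T]) blast
    qed
    have "z \<in> closure (- K)" using zfK by (simp add: frontier_closures)
    then obtain a where a: "a \<in> ball z s - K"
      by (metis ComplD DiffI closure_approachable dist_commute mem_ball s(1))
    define M0 where "M0 = connected_component_set (ball z r' - K) a"
    have aM0: "a \<in> M0" using a s by (auto simp: M0_def)
    have M0: "open M0" "connected M0" "M0 \<subseteq> ball z r' - K" "ball z s - K \<subseteq> M0"
      using clK join[OF a] by (auto simp: M0_def connected_component_subset open_Diff open_connected_component)
    define \<L> where "\<L> = {L \<in> components E. L \<inter> M0 \<noteq> {}}"
    have small: "L \<subseteq> ball z (3 * e) - K" if L: "L \<in> \<L>" for L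
    proof -
      have L1: "L \<in> components E" "L \<inter> M0 \<noteq> {}" using L by (auto simp: \<L>_def)
      then obtain y where y: "y \<in> L" "y \<in> ball z r'" "y \<notin> K" using M0(3) by blast
      then have "L \<noteq> K" by blast
      then have LK: "L \<inter> K = {}" using components_eq[OF L1(1) K(1)] by blast
      have "L \<notin> BL" using r'(2) y by blast
      moreover have "frontier L \<noteq> frontier K" using inj \<open>L \<noteq> K\<close> L1(1) K(1) by (meson inj_onD)
      ultimately have d: "diameter (frontier L) < e"
        using compL(6)[OF L1(1)] L1(1) by (force simp: BL_def B_def)
      obtain x where x: "x \<in> frontier L" using compL(6)[OF L1(1)] in_components_nonempty by blast
      have "bounded (frontier L)"
        using compL(1)[OF L1(1)] compact_frontier compact_imp_bounded by blast
      then have "frontier L \<subseteq> cball x e"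
        using diameter_bounded_bound[of "frontier L" x] x d by fastforce
      then have Lx: "L \<subseteq> cball x e" using component_subset_cball[OF dim compL(1)[OF L1(1)]] by blast
      have "w \<in> ball z (3 * e)" if "w \<in> L" for w
      proof -
        have "dist x w \<le> e" "dist x y \<le> e" using Lx y(1) that by auto
        moreover have "dist z y < e" using y(2) r'e by simp
        ultimately show ?thesis using dist_triangle[of z w y] dist_triangle[of y w x] by (simp add: dist_commute)
      qed
      then show ?thesis using LK by blast
    qed
    have "\<exists>G. open G \<and> connected G \<and> L \<subseteq> G \<and> G \<subseteq> ball z (3*e) - K \<and> (\<forall>L'. L' \<in> components E \<longrightarrow> L' \<inter> G \<noteq> {} \<longrightarrow> L' \<subseteq> G)"
      if L: "L \<in> \<L>" for L
    proof -
      have "open (ball z (3*e) - K)" "L \<in> components E" using clK L by (auto simp: open_Diff \<L>_def)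
      then show ?thesis using component_isolating_region[OF E(1) _ _ small[OF L]] by metis
    qed
    then obtain G where G: "\<And>L. L \<in> \<L> \<Longrightarrow> open (G L) \<and> connected (G L) \<and> L \<subseteq> G L \<and> G L \<subseteq> ball z (3*e) - K
        \<and> (\<forall>L'. L' \<in> components E \<longrightarrow> L' \<inter> G L \<noteq> {} \<longrightarrow> L' \<subseteq> G L)" by metis
    define M where "M = M0 \<union> (\<Union>L\<in>\<L>. G L)"
    have "open M" unfolding M_def using M0(1) G by (auto intro!: open_Un open_UN)
    moreover have "connected M"
    proof -
      have M': "M = (\<Union>L\<in>\<L>. M0 \<union> G L) \<union> M0" by (auto simp: M_def)
      have "connected (M0 \<union> G L)" if "L \<in> \<L>" for L
      proof (rule connected_Un)
        show "M0 \<inter> G L \<noteq> {}" using G[OF that] that by (auto simp: \<L>_def)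
      qed (use M0 G[OF that] in auto)
      then have "connected (\<Union> (insert M0 ((\<lambda>L. M0 \<union> G L) ` \<L>)))"
        by (intro connected_Union) (use M0 aM0 in auto)
      moreover have "\<Union> (insert M0 ((\<lambda>L. M0 \<union> G L) ` \<L>)) = M" by (auto simp: M_def)
      ultimately show ?thesis by simp
    qed
    moreover have "L \<subseteq> M" if L: "L \<in> components E" "L \<inter> M \<noteq> {}" for L
    proof (cases "L \<inter> M0 = {}")
      case True
      then obtain L' where "L' \<in> \<L>" "L \<inter> G L' \<noteq> {}" using L(2) by (auto simp: M_def)
      then show ?thesis using G[of L'] L(1) by (force simp: M_def)
    next
      case False
      then have "L \<in> \<L>" using L(1) by (simp add: \<L>_def)
      then show ?thesis using G[of L] by (force simp: M_def)
    qed
    ultimately have cM: "connected (M - E)" and oM: "open M" using connected_diff_saturated[OF E] by blast+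
    have "(M \<union> ball z s) \<inter> - E = M - E"
      using M0(4) compL(3)[OF K(1)] by (auto simp: M_def)
    moreover have "M \<union> ball z s \<subseteq> ball z r"
    proof -
      have "M0 \<subseteq> ball z r" "ball z s \<subseteq> ball z r"
        using M0(3) s r'e r by (auto simp: e_def)
      moreover have "G L \<subseteq> ball z r" if "L \<in> \<L>" for L
        using G[OF that] r by (auto simp: e_def)
      ultimately show ?thesis by (auto simp: M_def)
    qed
    ultimately show ?thesis using cM oM s(1) by (intro exI[of _ "M \<union> ball z s"]) auto
  qed
qed

section \<open>Disjoint continua crossing a strip are ordered\<close>

abbreviation vstrip :: "real \<Rightarrow> real \<Rightarrow> complex set" where
  "vstrip a b \<equiv> {z. a \<le> Re z \<and> Re z \<le> b}"

lemma convex_vstrip: "convex (vstrip a b)"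
proof -
  have "vstrip a b = {z. Re z \<ge> a} \<inter> {z. Re z \<le> b}" by auto
  then show ?thesis using convex_halfspace_Re_ge convex_halfspace_Re_le convex_Int by metis
qed

lemma closed_vstrip: "closed (vstrip a b)"
proof -
  have "vstrip a b = {z. Re z \<ge> a} \<inter> {z. Re z \<le> b}" by auto
  then show ?thesis using closed_halfspace_Re_ge closed_halfspace_Re_le closed_Int by metis
qed

lemma openin_vstrip_path_component:
  assumes "openin (top_of_set (vstrip a b)) W" "connected_component W x y"
  shows "path_component W x y"
proof -
  have "locally path_connected W"
    using assms(1) convex_imp_locally_path_connected[OF convex_vstrip] locally_open_subset by blast
  then show ?thesis using assms(2) path_component_eq_connected_component by metis
qed

text \<open>The bound \<open>m\<close> is shared by several continua, so that the points with imaginary parts \<open>- m\<close> and \<open>m\<close> can serve as common reference points below and above all of them.\<close>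

definition crossing :: "real \<Rightarrow> real \<Rightarrow> real \<Rightarrow> complex set \<Rightarrow> bool" where
  "crossing a b m D \<longleftrightarrow> compact D \<and> connected D \<and> D \<subseteq> vstrip a b \<and> (\<forall>z\<in>D. \<bar>Im z\<bar> < m)
     \<and> (\<exists>z\<in>D. Re z = a) \<and> (\<exists>z\<in>D. Re z = b)"

text \<open>A connection from the bottom to the top would give a path in the strip, and a thin neighbourhood of \<open>D\<close> contains a path from the left side to the right side.  By Fashoda's theorem the two paths meet.\<close>

lemma crossing_separates:
  assumes D: "crossing a b m D" and u: "Im u = - m" and v: "Im v = m"
  shows "\<not> connected_component (vstrip a b - D) u v"
proof
  assume cc: "connected_component (vstrip a b - D) u v"
  obtain za zb where z: "za \<in> D" "Re za = a" "zb \<in> D" "Re zb = b"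
    and cD: "compact D" "connected D" "D \<subseteq> vstrip a b" and Dm: "\<And>z. z \<in> D \<Longrightarrow> \<bar>Im z\<bar> < m"
    using D unfolding crossing_def by blast
  have m: "m > 0" using Dm[OF z(1)] by linarith
  have "openin (top_of_set (vstrip a b)) (vstrip a b - D)"
    using cD(1) by (simp add: compact_imp_closed openin_diff closedin_closed_Int openin_open_Int Diff_eq open_Compl)
  from openin_vstrip_path_component[OF this cc]
  obtain f where f: "path f" "path_image f \<subseteq> vstrip a b - D" "pathstart f = u" "pathfinish f = v"
    unfolding path_component_def by blast
  \<comment> \<open>Clamping the imaginary part puts the path into the box; the moved points end on the horizontal sides, where there are no points of \<open>D\<close>.\<close>
  define k where "k = (\<lambda>z. Complex (Re z) (max (- m) (min m (Im z))))"
  have contk: "continuous_on UNIV k"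
  proof -
    have "k = (\<lambda>z. complex_of_real (Re z) + \<i> * complex_of_real (max (- m) (min m (Im z))))"
      by (auto simp: k_def complex_eq_iff)
    then show ?thesis by (auto intro!: continuous_intros)
  qed
  define f' where "f' = k \<circ> f"
  have f': "path f'" unfolding f'_def by (rule path_continuous_image[OF f(1)]) (use continuous_on_subset[OF contk] in auto)
  have pf': "path_image f' = k ` path_image f" by (simp add: f'_def path_image_compose)
  have f'D: "path_image f' \<inter> D = {}"
  proof -
    have "k x \<notin> D" if "x \<in> path_image f" for x
    proof
      assume kx: "k x \<in> D"
      from Dm[OF kx] have "k x = x" by (auto simp: k_def complex_eq_iff max_def min_def split: if_splits)
      then show False using kx f(2) that by auto
    qed
    then show ?thesis unfolding pf' by auto
  qed
  define Z where "Z = path_image f' \<union> {z. Im z \<ge> m} \<union> {z. Im z \<le> - m}"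
  have "closed (path_image f')" using f' by (simp add: closed_path_image)
  then have "closed Z" unfolding Z_def
    using closed_halfspace_Im_ge[of m] closed_halfspace_Im_le[of "- m"] by (simp add: closed_Un)
  moreover have "D \<inter> Z = {}"
  proof -
    have "z \<notin> {z. Im z \<ge> m} \<union> {z. Im z \<le> - m}" if "z \<in> D" for z using Dm[OF that] by auto
    then show ?thesis unfolding Z_def using f'D by blast
  qed
  ultimately obtain \<delta> where \<delta>: "\<delta> > 0" "\<And>x y. x \<in> D \<Longrightarrow> y \<in> Z \<Longrightarrow> \<delta> \<le> dist x y"
    using separate_compact_closed[OF cD(1), of Z] by blast
  define W where "W = (\<Union>d\<in>D. ball d \<delta> \<inter> vstrip a b)"
  have oW: "openin (top_of_set (vstrip a b)) W"
  proof -
    have "W = vstrip a b \<inter> (\<Union>d\<in>D. ball d \<delta>)" by (auto simp: W_def)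
    then show ?thesis by (metis openin_open_Int open_UN open_ball)
  qed
  have DW: "D \<subseteq> W"
  proof
    fix d assume "d \<in> D"
    then show "d \<in> W" unfolding W_def using cD(3) \<delta>(1) by (intro UN_I[of d]) auto
  qed
  have WZ: "W \<inter> Z = {}"
  proof -
    have False if "d \<in> D" "y \<in> Z" "dist d y < \<delta>" for d y using \<delta>(2)[of d y] that by linarith
    then show ?thesis unfolding W_def by auto
  qed
  have "connected (\<Union>d\<in>D. D \<union> (ball d \<delta> \<inter> vstrip a b))"
  proof (rule connected_Union)
    fix S assume "S \<in> (\<lambda>d. D \<union> ball d \<delta> \<inter> vstrip a b) ` D"
    then obtain d where d: "d \<in> D" "S = D \<union> ball d \<delta> \<inter> vstrip a b" by blast
    have "connected (ball d \<delta> \<inter> vstrip a b)"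
      by (intro convex_connected convex_Int convex_ball convex_vstrip)
    then show "connected S" unfolding d(2)
      by (intro connected_Un cD) (use d cD \<delta> in auto)
  qed (use z in auto)
  moreover have "(\<Union>d\<in>D. D \<union> (ball d \<delta> \<inter> vstrip a b)) = W" using DW by (auto simp: W_def)
  ultimately have "connected W" by simp
  then have "connected_component W za zb" unfolding connected_component_def using z DW by blast
  from openin_vstrip_path_component[OF oW this]
  obtain g where g: "path g" "path_image g \<subseteq> W" "pathstart g = za" "pathfinish g = zb"
    unfolding path_component_def by blast
  define \<phi> :: "complex \<Rightarrow> real^2" where "\<phi> = (\<lambda>z. \<chi> i. if i = 1 then Re z else Im z)"
  have \<phi>: "\<phi> z $ 1 = Re z" "\<phi> z $ 2 = Im z" for z by (auto simp: \<phi>_def)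
  have cont\<phi>: "continuous_on A \<phi>" for A
    unfolding \<phi>_def
  proof (rule continuous_on_vec_lambda)
    fix i :: 2 show "continuous_on A (\<lambda>z. if i = 1 then Re z else Im z)"
      by (cases "i = 1") (auto intro!: continuous_intros)
  qed
  have inj\<phi>: "\<phi> x = \<phi> y \<Longrightarrow> x = y" for x y using \<phi> by (metis complex_eq_iff)
  have box: "\<phi> z \<in> cbox (\<phi> (Complex a (-m))) (\<phi> (Complex b m))"
    if "z \<in> vstrip a b" "\<bar>Im z\<bar> \<le> m" for z
    using that by (auto simp: mem_box_cart forall_2 \<phi>)
  obtain w where w: "w \<in> path_image (\<phi> \<circ> g)" "w \<in> path_image (\<phi> \<circ> f')"
  proof (rule fashoda[of "\<phi> \<circ> g" "\<phi> \<circ> f'" "\<phi> (Complex a (-m))" "\<phi> (Complex b m)"])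
    show "path (\<phi> \<circ> g)" "path (\<phi> \<circ> f')" using g f' cont\<phi> path_continuous_image by blast+
    show "path_image (\<phi> \<circ> g) \<subseteq> cbox (\<phi> (Complex a (-m))) (\<phi> (Complex b m))"
    proof -
      have "z \<in> vstrip a b \<and> \<bar>Im z\<bar> \<le> m" if "z \<in> path_image g" for z
      proof -
        have "z \<in> W" using that g by blast
        moreover from this have "z \<notin> Z" using WZ by blast
        ultimately show ?thesis by (auto simp: W_def Z_def)
      qed
      then show ?thesis using box by (auto simp: path_image_compose)
    qed
    show "path_image (\<phi> \<circ> f') \<subseteq> cbox (\<phi> (Complex a (-m))) (\<phi> (Complex b m))"
    proof -
      have "z \<in> vstrip a b \<and> \<bar>Im z\<bar> \<le> m" if "z \<in> path_image f'" for z
        using that f(2) m by (auto simp: pf' k_def)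
      then show ?thesis using box by (auto simp: path_image_compose)
    qed
    show "pathstart (\<phi> \<circ> g) $ 1 = \<phi> (Complex a (- m)) $ 1" using g z by (simp add: pathstart_compose \<phi>)
    show "pathfinish (\<phi> \<circ> g) $ 1 = \<phi> (Complex b m) $ 1" using g z by (simp add: pathfinish_compose \<phi>)
    show "pathstart (\<phi> \<circ> f') $ 2 = \<phi> (Complex a (- m)) $ 2" using f u m by (simp add: f'_def pathstart_compose \<phi> k_def)
    show "pathfinish (\<phi> \<circ> f') $ 2 = \<phi> (Complex b m) $ 2" using f v m by (simp add: f'_def pathfinish_compose \<phi> k_def)
  qed blast
  then obtain x y where "x \<in> path_image g" "y \<in> path_image f'" "\<phi> x = \<phi> y"
    by (auto simp: path_image_compose)
  then have "x \<in> W" "x \<in> Z" using inj\<phi> g by (auto simp: Z_def)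
  then show False using WZ by blast
qed

text \<open>The component of \<open>u\<close> in \<open>S - D'\<close> must accumulate at \<open>D'\<close>, for otherwise it would be clopen in \<open>S\<close>.  Together with \<open>D'\<close> it forms a connected set that avoids \<open>D\<close>.\<close>

lemma disjoint_continuum_in_component:
  fixes S :: "'a::topological_space set"
  assumes S: "connected S" "locally connected S" and D': "D' \<subseteq> S" "closed D'" "connected D'" "D' \<noteq> {}"
    and u: "u \<in> S - D'" "u \<notin> D"
    and disj: "D \<inter> D' = {}" "D \<inter> connected_component_set (S - D') u = {}"
  shows "D' \<subseteq> connected_component_set (S - D) u"
proof -
  define W where "W = connected_component_set (S - D') u"
  have W: "connected W" "u \<in> W" "W \<subseteq> S - D'" using u by (auto simp: W_def connected_component_subset)
  have "\<exists>x. x \<in> D' \<inter> closure W"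
  proof (rule ccontr)
    assume no: "\<nexists>x. x \<in> D' \<inter> closure W"
    obtain d where d: "d \<in> D'" using D' by blast
    have sub: "S \<inter> closure W \<subseteq> W"
    proof -
      have "connected (S \<inter> closure W)"
        by (rule connected_intermediate_closure[OF W(1)]) (use W closure_subset in auto)
      moreover have "S \<inter> closure W \<subseteq> S - D'" using no by blast
      moreover have "u \<in> S \<inter> closure W" using W u closure_subset by blast
      ultimately show ?thesis unfolding W_def by (intro connected_component_maximal)
    qed
    then have "closedin (top_of_set S) W"
      using W by (metis Diff_subset closed_closure closedin_closed_Int closure_subset inf_greatest subset_antisym subset_trans)
    moreover have "openin (top_of_set S) (S - D')"
      using D'(2) by (simp add: Diff_eq openin_open_Int open_Compl)
    then have "openin (top_of_set S) W"
      unfolding W_def using S(2) locally_open_subset openin_connected_component_locally_connected openin_trans by blast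
    ultimately have "W = S" using S(1) W(2) connected_clopen by blast
    then show False using W(3) d D'(1) by blast
  qed
  then obtain x where x: "x \<in> D'" "x \<in> closure W" by blast
  have "connected (insert x W)"
    by (rule connected_intermediate_closure[OF W(1)]) (use x closure_subset in auto)
  then have "connected (insert x W \<union> D')" using D' x by (intro connected_Un) auto
  moreover have "insert x W \<union> D' \<subseteq> S - D" using W x D' disj by (auto simp: W_def)
  ultimately show ?thesis using W(2) connected_component_maximal[of u "insert x W \<union> D'" "S - D"] by blast
qed

text \<open>Of two disjoint crossing continua each lies entirely above or entirely below the other, and
  these relations are opposite to each other.  Among three continua there is always one, say \<open>X\<close>,
  with a second one below and the third above it.  A connected set that touches the second and the
  third would connect the bottom to the top outside \<open>X\<close>.\<close>

lemma no_third_crossing: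
  assumes D: "crossing a b m D1" "crossing a b m D2" "crossing a b m D3"
    and disj: "D1 \<inter> D2 = {}" "D2 \<inter> D3 = {}" "D1 \<inter> D3 = {}"
    and Q: "connected Q" "Q \<subseteq> vstrip a b" "Q \<inter> (D1 \<union> D2 \<union> D3) = {}"
    and t: "closure Q \<inter> D1 \<noteq> {}" "closure Q \<inter> D2 \<noteq> {}" "closure Q \<inter> D3 \<noteq> {}"
  shows False
proof -
  have "a \<le> b" using D(1) by (auto simp: crossing_def)
  define S where "S = vstrip a b"
  define u v where "u = Complex a (- m)" and "v = Complex a m"
  have cS: "connected S" "locally connected S" unfolding S_def
    using convex_vstrip convex_connected convex_imp_locally_connected by blast+
  define below where "below = (\<lambda>X. connected_component_set (S - X) u)"
  define above where "above = (\<lambda>X. connected_component_set (S - X) v)"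
  have uv: "u \<in> S - X" "v \<in> S - X" if "crossing a b m X" for X
    using that \<open>a \<le> b\<close> by (force simp: S_def u_def v_def crossing_def)+
  have apart: "below X \<inter> above X = {}" if X: "crossing a b m X" for X
  proof (rule ccontr)
    assume "below X \<inter> above X \<noteq> {}"
    then have "connected_component (S - X) u v"
      unfolding below_def above_def by (metis IntE connected_component_sym connected_component_trans ex_in_conv mem_Collect_eq)
    then show False using crossing_separates[OF X, of u v] by (simp add: S_def u_def v_def)
  qed
  have cr: "closed X" "connected X" "X \<subseteq> S" "X \<noteq> {}" if "crossing a b m X" for X
    using that by (auto simp: crossing_def S_def compact_imp_closed)
  have or: "Y \<subseteq> below X \<or> Y \<subseteq> above X"
    and ba: "Y \<subseteq> below X \<Longrightarrow> X \<subseteq> above Y" and ab: "Y \<subseteq> above X \<Longrightarrow> X \<subseteq> below Y"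
    if XY: "crossing a b m X" "crossing a b m Y" "X \<inter> Y = {}" for X Y
  proof -
    have 1: "X \<inter> below Y = {} \<Longrightarrow> Y \<subseteq> below X" if "crossing a b m X" "crossing a b m Y" "X \<inter> Y = {}" for X Y
      unfolding below_def
      by (rule disjoint_continuum_in_component) (use cS cr uv that in \<open>auto simp: below_def\<close>)
    have 2: "X \<inter> above Y = {} \<Longrightarrow> Y \<subseteq> above X" if "crossing a b m X" "crossing a b m Y" "X \<inter> Y = {}" for X Y
      unfolding above_def
      by (rule disjoint_continuum_in_component) (use cS cr uv that in \<open>auto simp: above_def\<close>)
    have "X \<inter> below Y = {} \<or> X \<inter> above Y = {}"
    proof (rule ccontr)
      assume "\<not> ?thesis"
      then have *: "X \<inter> below Y \<noteq> {}" "X \<inter> above Y \<noteq> {}" by auto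
      have "X \<subseteq> S - Y" using XY cr by blast
      then have "X \<subseteq> below Y" "X \<subseteq> above Y"
        using * cr(2)[OF XY(1)] components_maximal[of "below Y" "S - Y" X] components_maximal[of "above Y" "S - Y" X]
          componentsI[OF uv(1)[OF XY(2)]] componentsI[OF uv(2)[OF XY(2)]]
        by (auto simp: below_def above_def Int_commute)
      then show False using apart[OF XY(2)] cr(4)[OF XY(1)] by blast
    qed
    then show "Y \<subseteq> below X \<or> Y \<subseteq> above X" using 1 2 XY by blast
    show "X \<subseteq> above Y" if "Y \<subseteq> below X"
      using 2[of Y X] XY that apart[OF XY(1)] by blast
    show "X \<subseteq> below Y" if "Y \<subseteq> above X"
      using 1[of Y X] XY that apart[OF XY(1)] by blast
  qed
  have mid: False if X: "crossing a b m X" "crossing a b m Y" "crossing a b m Z"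
    "X \<inter> Y = {}" "X \<inter> Z = {}" "Y \<subseteq> below X" "Z \<subseteq> above X" "Q \<inter> X = {}"
    "closure Q \<inter> Y \<noteq> {}" "closure Q \<inter> Z \<noteq> {}" for X Y Z
  proof -
    obtain y z where yz: "y \<in> closure Q" "y \<in> Y" "z \<in> closure Q" "z \<in> Z" using X by blast
    have "connected (insert y (insert z Q))"
      by (rule connected_intermediate_closure[OF Q(1)]) (use yz closure_subset in auto)
    moreover have "y \<in> S - X" "z \<in> S - X"
      using yz X(6,7) connected_component_subset unfolding below_def above_def by blast+
    moreover have "Q \<subseteq> S - X" using Q(2) X(8) unfolding S_def by blast
    ultimately have "connected_component (S - X) y z"
      unfolding connected_component_def by (intro exI[of _ "insert y (insert z Q)"]) simp
    moreover have "connected_component (S - X) u y" "connected_component (S - X) v z"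
      using X yz by (auto simp: below_def above_def)
    ultimately have "connected_component (S - X) u v"
      by (meson connected_component_sym connected_component_trans)
    then show False using crossing_separates[OF X(1), of u v] by (simp add: S_def u_def v_def)
  qed
  have d': "D2 \<inter> D1 = {}" "D3 \<inter> D2 = {}" "D3 \<inter> D1 = {}" using disj by auto
  have q: "Q \<inter> D1 = {}" "Q \<inter> D2 = {}" "Q \<inter> D3 = {}" using Q by auto
  note o12 = or[OF D(1,2) disj(1)] and o23 = or[OF D(2,3) disj(2)] and o13 = or[OF D(1,3) disj(3)]
  show False
    using o12 o23 o13 mid[OF D(1,2,3) disj(1,3) _ _ q(1) t(2,3)] mid[OF D(1,3,2) disj(3,1) _ _ q(1) t(3,2)]
      mid[OF D(2,1,3) d'(1) disj(2) _ _ q(2) t(1,3)] mid[OF D(2,3,1) disj(2) d'(1) _ _ q(2) t(3,1)]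
      mid[OF D(3,1,2) d'(3,2) _ _ q(3) t(1,2)] mid[OF D(3,2,1) d'(2,3) _ _ q(3) t(2,1)]
      ba[OF D(1,2) disj(1)] ab[OF D(1,2) disj(1)] ba[OF D(2,3) disj(2)] ab[OF D(2,3) disj(2)]
      ba[OF D(1,3) disj(3)] ab[OF D(1,3) disj(3)]
    by argo
qed

text \<open>If no component of \<open>K\<close> inside the strip touched both sides, then a clopen piece of that part of \<open>K\<close> would separate the left side from the right side, and with it would separate \<open>K\<close>.\<close>

lemma crossing_subcontinuum:
  assumes K: "compact K" "connected K" and ab: "a < b"
    and x: "x \<in> K" "Re x \<le> a" and y: "y \<in> K" "Re y \<ge> b"
  obtains D where "compact D" "connected D" "D \<subseteq> K \<inter> vstrip a b" "\<exists>z\<in>D. Re z = a" "\<exists>z\<in>D. Re z = b"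
proof -
  define X where "X = K \<inter> vstrip a b"
  have cX: "compact X" unfolding X_def using K closed_vstrip by (intro compact_Int_closed)
  have "\<exists>D\<in>components X. D \<inter> {z. Re z = a} \<noteq> {} \<and> D \<inter> {z. Re z = b} \<noteq> {}"
  proof (rule ccontr)
    assume no: "\<not> ?thesis"
    obtain A where A: "compact A" "compact (X - A)" "X \<inter> {z. Re z = a} \<subseteq> A" "A \<subseteq> {z. Re z < b}" "A \<subseteq> X"
    proof (rule saturated_clopen_superset[OF cX, of "X \<inter> {z. Re z = a}" "{z. Re z < b}"])
      have "closed {z. Re z = a}" by (intro closed_Collect_eq continuous_intros)
      then show "compact (X \<inter> {z. Re z = a})" using cX by (simp add: compact_Int_closed)
      show "open {z. Re z < b}" by (rule open_halfspace_Re_lt)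
      fix L assume L: "L \<in> components X" "L \<inter> (X \<inter> {z. Re z = a}) \<noteq> {}"
      then have "L \<inter> {z. Re z = b} = {}" using no by blast
      moreover have "L \<subseteq> X" using L in_components_subset by blast
      ultimately show "L \<subseteq> {z. Re z < b}" unfolding X_def by fastforce
    qed auto
    define P where "P = (K \<inter> {z. Re z \<le> a}) \<union> A"
    define R where "R = (K \<inter> {z. Re z \<ge> b}) \<union> (X - A)"
    have "closed P" "closed R" unfolding P_def R_def
      using A K by (auto intro!: closed_Un closed_Int compact_imp_closed closed_halfspace_Re_le closed_halfspace_Re_ge)
    moreover have "K \<subseteq> P \<union> R" unfolding P_def R_def X_def by auto
    moreover have "P \<inter> R \<inter> K = {}"
    proof -
      have "\<not> (Re z \<le> a)" if "z \<in> X - A" for z using that A(3) unfolding X_def by fastforce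
      then show ?thesis unfolding P_def R_def using ab A(4) by force
    qed
    moreover have "x \<in> P \<inter> K" "y \<in> R \<inter> K" using x y by (auto simp: P_def R_def)
    ultimately show False using connected_closedD[OF K(2), of P R] by blast
  qed
  then obtain D where D: "D \<in> components X" "D \<inter> {z. Re z = a} \<noteq> {}" "D \<inter> {z. Re z = b} \<noteq> {}" by blast
  have "compact D" by (rule compact_components[OF cX D(1)])
  then show ?thesis using that[of D] D in_components_connected in_components_subset unfolding X_def by blast
qed

section \<open>Connected neighbourhoods force small boundary components\<close>

text \<open>Choose points of \<open>C n\<close> that stay apart and pass to the limits \<open>x0\<close> and \<open>y0\<close>.  The strip lies
  strictly between these limits, so its middle line contains a limit point \<open>w0\<close> of the crossing
  subcontinua.  A connected trace of \<open>- E\<close> near \<open>w0\<close> is inside the strip, misses all \<open>C n\<close>, and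
  touches infinitely many of the crossing subcontinua.\<close>

lemma finite_large_components:
  fixes E :: "complex set"
  assumes E: "compact E"
    and nb: "\<And>z. z \<in> frontier E \<Longrightarrow> connected_nbhds (- E) z"
    and e: "e > 0"
  shows "finite {C \<in> components (frontier E). e \<le> diameter C}"
proof (rule ccontr)
  assume inf: "infinite {C \<in> components (frontier E). e \<le> diameter C}"
  obtain C :: "nat \<Rightarrow> complex set" where C: "inj C" "range C \<subseteq> {C \<in> components (frontier E). e \<le> diameter C}"
    using infinite_countable_subset[OF inf] by blast
  have cF: "compact (frontier E)" using E compact_frontier by blast
  have Cn: "C n \<in> components (frontier E)" "e \<le> diameter (C n)" for n using C(2) by auto
  have compC: "compact (C n)" "connected (C n)" "C n \<subseteq> frontier E" for n
  proof -
    show s: "C n \<subseteq> frontier E" using Cn(1) in_components_subset by blast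
    show "connected (C n)" using Cn(1) in_components_connected by blast
    show "compact (C n)" by (rule compact_components[OF cF Cn(1)])
  qed
  have disjC: "C i \<inter> C j = {}" if "i \<noteq> j" for i j
    using components_eq[OF Cn(1) Cn(1), of i j] C(1) that by (auto dest: injD)
  have "\<exists>x\<in>C n. \<exists>y\<in>C n. e / 2 < dist x y" for n
  proof -
    have "bounded (C n)" using compC(1) compact_imp_bounded by blast
    moreover have "0 < e / 2" "e / 2 < diameter (C n)" using Cn(2)[of n] e by auto
    ultimately show ?thesis using diameter_lower_bounded by blast
  qed
  then obtain x y where xy: "\<And>n. x n \<in> C n" "\<And>n. y n \<in> C n" "\<And>n. e / 2 < dist (x n) (y n)" by metis
  have "\<forall>n. (x n, y n) \<in> frontier E \<times> frontier E" using xy compC(3) by blast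
  then obtain l r where l: "strict_mono r" "((\<lambda>n. (x n, y n)) \<circ> r) \<longlonglongrightarrow> l"
    using seq_compactE[OF compact_imp_seq_compact[OF compact_Times[OF cF cF]]] by metis
  define x0 y0 where "x0 = fst l" and "y0 = snd l"
  have lx: "(\<lambda>n. x (r n)) \<longlonglongrightarrow> x0" and ly: "(\<lambda>n. y (r n)) \<longlonglongrightarrow> y0"
    using tendsto_fst[OF l(2)] tendsto_snd[OF l(2)] by (auto simp: o_def x0_def y0_def)
  have "e / 2 \<le> dist x0 y0"
    by (rule LIMSEQ_le_const[OF tendsto_dist[OF lx ly]]) (use xy(3) less_imp_le in blast)
  define d where "d = norm (y0 - x0)"
  have "x0 \<noteq> y0" using \<open>e/2 \<le> dist x0 y0\<close> e by auto
  then have d: "d > 0" by (simp add: d_def)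
  \<comment> \<open>The rotation by \<open>c\<close> makes the direction from \<open>x0\<close> to \<open>y0\<close> horizontal.\<close>
  define c where "c = cnj (y0 - x0) / of_real d"
  have nc: "norm c = 1" using d by (simp add: c_def norm_divide d_def norm_minus_commute flip: complex_cnj_diff)
  have "c * (y0 - x0) = of_real d"
  proof -
    have "c * (y0 - x0) = (y0 - x0) * cnj (y0 - x0) / of_real d" by (simp add: c_def)
    also have "\<dots> = of_real (d\<^sup>2) / of_real d" using complex_norm_square[of "y0 - x0"] by (simp only: d_def)
    finally show ?thesis using d by (simp add: power2_eq_square)
  qed
  then have Red: "Re (c * y0) = Re (c * x0) + d"
    by (metis Re_complex_of_real add.commute add_diff_cancel_right' diff_add_cancel minus_complex.simps(1) right_diff_distrib)
  define a b where "a = Re (c * x0) + d / 4" and "b = Re (c * x0) + 3 * d / 4"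
  have ab: "a < b" using d by (simp add: a_def b_def)
  have "(\<lambda>n. Re (c * x (r n))) \<longlonglongrightarrow> Re (c * x0)" "(\<lambda>n. Re (c * y (r n))) \<longlonglongrightarrow> Re (c * y0)"
    using lx ly by (auto intro!: tendsto_intros)
  then have "\<forall>\<^sub>F n in sequentially. Re (c * x (r n)) < a" "\<forall>\<^sub>F n in sequentially. Re (c * y (r n)) > b"
    using d Red by (auto intro!: order_tendstoD simp: a_def b_def)
  then have "\<forall>\<^sub>F n in sequentially. Re (c * x (r n)) < a \<and> Re (c * y (r n)) > b" by eventually_elim simp
  then obtain n0 where n0: "\<And>n. n \<ge> n0 \<Longrightarrow> Re (c * x (r n)) < a \<and> Re (c * y (r n)) > b"
    by (auto simp: eventually_sequentially)
  define j where "j = (\<lambda>n. r (n0 + n))"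
  have injj: "inj j" using l(1) by (auto simp: j_def inj_on_def strict_mono_eq)
  define M where "M = (\<lambda>z. c * z)"
  have contM: "continuous_on A M" for A by (auto simp: M_def intro!: continuous_intros)
  have injM: "M z = M z' \<longleftrightarrow> z = z'" for z z' using nc by (auto simp: M_def)
  have "\<exists>D. compact D \<and> connected D \<and> D \<subseteq> M ` C (j n) \<inter> vstrip a b \<and> (\<exists>z\<in>D. Re z = a) \<and> (\<exists>z\<in>D. Re z = b)" for n
  proof -
    have c: "compact (M ` C (j n))" "connected (M ` C (j n))"
      using compC contM compact_continuous_image connected_continuous_image by blast+
    have m: "M (x (j n)) \<in> M ` C (j n)" "M (y (j n)) \<in> M ` C (j n)" using xy by blast+
    have l: "Re (M (x (j n))) \<le> a" "Re (M (y (j n))) \<ge> b"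
      using n0[of "n0 + n"] by (simp_all add: M_def j_def)
    show ?thesis
      by (rule crossing_subcontinuum[OF c ab m(1) l(1) m(2) l(2)]) blast
  qed
  then have "\<forall>n. \<exists>D. compact D \<and> connected D \<and> D \<subseteq> M ` C (j n) \<inter> vstrip a b \<and> (\<exists>z\<in>D. Re z = a) \<and> (\<exists>z\<in>D. Re z = b)"
    by blast
  from choice[OF this] obtain D where D: "\<And>n. compact (D n)" "\<And>n. connected (D n)" "\<And>n. D n \<subseteq> M ` C (j n) \<inter> vstrip a b"
    "\<And>n. \<exists>z\<in>D n. Re z = a" "\<And>n. \<exists>z\<in>D n. Re z = b" by blast
  have disjD: "D n \<inter> D n' = {}" if "n \<noteq> n'" for n n'
  proof -
    have "C (j n) \<inter> C (j n') = {}" using disjC injj that by (auto dest: injD)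
    then have "M ` C (j n) \<inter> M ` C (j n') = {}" using injM by auto
    then show ?thesis using D(3)[of n] D(3)[of n'] by blast
  qed
  define mid where "mid = Re (c * x0) + d / 2"
  have "\<exists>w\<in>C (j n). M w \<in> D n \<and> Re (M w) = mid" for n
  proof -
    obtain p q where "p \<in> D n" "Re p = a" "q \<in> D n" "Re q = b" using D(4,5) by blast
    moreover have "a \<le> mid" "mid \<le> b" using d by (auto simp: a_def b_def mid_def)
    moreover have "connected (Re ` D n)" by (rule connected_continuous_image) (use D in \<open>auto intro!: continuous_intros\<close>)
    ultimately have "mid \<in> Re ` D n" by (metis connected_contains_Icc atLeastAtMost_iff imageI subsetD)
    then show ?thesis using D(3) by blast
  qed
  then obtain w where w: "\<And>n. w n \<in> C (j n)" "\<And>n. M (w n) \<in> D n" "\<And>n. Re (M (w n)) = mid" by metis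
  have "\<forall>n. w n \<in> frontier E" using w(1) compC(3) by blast
  then obtain w0 k where w0: "w0 \<in> frontier E" "strict_mono k" "(w \<circ> k) \<longlonglongrightarrow> w0"
    using seq_compactE[OF compact_imp_seq_compact[OF cF]] by metis
  have "(\<lambda>n. Re (M ((w \<circ> k) n))) \<longlonglongrightarrow> Re (M w0)"
    unfolding M_def using w0(3) by (intro tendsto_intros)
  then have Rw0: "Re (M w0) = mid" using w(3) by (simp add: LIMSEQ_const_iff)
  obtain N where N: "open N" "w0 \<in> N" "N \<subseteq> ball w0 (d/4)" "connected (N \<inter> - E)"
    using nb[OF w0(1)] d unfolding connected_nbhds_def by (metis divide_pos_pos zero_less_numeral)
  have "\<forall>\<^sub>F n in sequentially. (w \<circ> k) n \<in> N" using topological_tendstoD[OF w0(3) N(1,2)] .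
  then obtain n1 where n1: "\<And>n. n \<ge> n1 \<Longrightarrow> w (k n) \<in> N" by (auto simp: eventually_sequentially)
  define Q where "Q = M ` (N \<inter> - E)"
  have "connected Q" unfolding Q_def using N(4) contM connected_continuous_image by blast
  moreover have "Q \<subseteq> vstrip a b"
  proof -
    have "M z \<in> vstrip a b" if "z \<in> N" for z
    proof -
      have "\<bar>Re (M z - M w0)\<bar> \<le> norm (M z - M w0)" by (rule abs_Re_le_cmod)
      also have "\<dots> = norm (z - w0)" using nc by (simp add: M_def norm_mult flip: right_diff_distrib)
      also have "\<dots> < d/4" using that N(3) by (auto simp: dist_norm norm_minus_commute)
      finally have "\<bar>Re (M z) - mid\<bar> < d/4" using Rw0 by simp
      then have "a \<le> Re (M z)" "Re (M z) \<le> b" unfolding a_def b_def mid_def by linarith+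
      then show ?thesis by simp
    qed
    then show ?thesis by (auto simp: Q_def)
  qed
  moreover have QD: "Q \<inter> D n = {}" for n
  proof -
    have "C (j n) \<subseteq> E" using compC(3) E frontier_subset_closed compact_imp_closed by blast
    then have "M ` (N \<inter> - E) \<inter> M ` C (j n) = {}" by (auto simp: injM)
    then show ?thesis using D(3)[of n] unfolding Q_def by blast
  qed
  moreover have touch: "closure Q \<inter> D (k n) \<noteq> {}" if "n \<ge> n1" for n
  proof -
    have "w (k n) \<in> closure (- E)" using w(1) compC(3) by (auto simp: frontier_closures)
    then have "w (k n) \<in> closure (N \<inter> - E)" using open_Int_closure_subset[OF N(1)] n1[OF that] by blast
    moreover have "M ` closure (N \<inter> - E) \<subseteq> closure Q"
      unfolding Q_def by (rule image_closure_subset[OF contM]) (auto simp: closure_subset)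
    ultimately show ?thesis using w(2) by blast
  qed
  ultimately have Q: "connected Q" "Q \<subseteq> vstrip a b" by blast+
  define D' where "D' = (\<lambda>i. D (k (n1 + i)))"
  have disjD': "D' i \<inter> D' i' = {}" if "i \<noteq> i'" for i i'
    unfolding D'_def using w0(2) that by (intro disjD) (simp add: strict_mono_eq)
  have "compact (D' 0 \<union> D' 1 \<union> D' 2)" unfolding D'_def by (intro compact_Un D)
  then obtain m where m: "\<And>z. z \<in> D' 0 \<union> D' 1 \<union> D' 2 \<Longrightarrow> norm z < m"
    using compact_imp_bounded bounded_pos_less by metis
  have cr: "crossing a b m (D' i)" if "i \<in> {0,1,2}" for i
  proof -
    have "\<bar>Im z\<bar> < m" if "z \<in> D' i" for z
      using m[of z] that \<open>i \<in> {0,1,2}\<close> abs_Im_le_cmod[of z] by fastforce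
    then show ?thesis unfolding crossing_def using D unfolding D'_def by auto
  qed
  show False
  proof (rule no_third_crossing[OF cr[of 0] cr[of 1] cr[of 2] _ _ _ Q])
    show "D' 0 \<inter> D' 1 = {}" "D' 1 \<inter> D' 2 = {}" "D' 0 \<inter> D' 2 = {}"
      by (rule disjD'; simp)+
    have "Q \<inter> D' i = {}" for i unfolding D'_def by (rule QD)
    then show "Q \<inter> (D' 0 \<union> D' 1 \<union> D' 2) = {}" by blast
    have "closure Q \<inter> D' i \<noteq> {}" for i unfolding D'_def by (rule touch) simp
    then show "closure Q \<inter> D' 0 \<noteq> {}" "closure Q \<inter> D' 1 \<noteq> {}" "closure Q \<inter> D' 2 \<noteq> {}" by blast+
  qed auto
qed

text \<open>The other components of \<open>E\<close> are added to the trace of \<open>- E\<close>.  A piece \<open>P\<close> of \<open>N - K\<close> close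
  to \<open>z\<close> that misses \<open>- E\<close> lies in \<open>E\<close>; a segment towards \<open>z\<close> leaves \<open>P\<close> at a point of \<open>K\<close>, so
  that \<open>P \<union> K\<close> would be connected, contrary to \<open>K\<close> being a component of \<open>E\<close>.\<close>

lemma connected_nbhds_component:
  fixes E :: "'a::euclidean_space set"
  assumes E: "compact E" and K: "K \<in> components E" and z: "z \<in> frontier K"
    and nb: "connected_nbhds (- E) z"
  shows "connected_nbhds (- K) z"
  unfolding connected_nbhds_def
proof (intro allI impI)
  fix r :: real assume "r > 0"
  then obtain N where N: "open N" "z \<in> N" "N \<subseteq> ball z r" "connected (N \<inter> - E)"
    using nb unfolding connected_nbhds_def by blast
  have KE: "K \<subseteq> E" "connected K" using K in_components_subset in_components_connected by auto
  have clK: "closed K" using K E closed_components compact_imp_closed by blast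
  have zK: "z \<in> K" using z clK frontier_subset_closed by blast
  have "z \<in> closure (- E)" using z frontier_component[OF E K] by (auto simp: frontier_closures)
  then obtain q where q: "q \<in> N \<inter> - E" using N(1,2) closure_iff_nhds_not_empty by blast
  define W where "W = connected_component_set (N - K) q"
  have oNK: "open (N - K)" using N(1) clK by blast
  have NW: "N \<inter> - E \<subseteq> W" unfolding W_def
    by (rule connected_component_maximal) (use q N(4) KE in auto)
  obtain s where s: "s > 0" "ball z s \<subseteq> N" using N(1,2) open_contains_ball by blast
  have sub: "ball z s - K \<subseteq> W"
  proof
    fix x assume x: "x \<in> ball z s - K"
    define P where "P = connected_component_set (N - K) x"
    have P: "x \<in> P" "connected P" "P \<subseteq> N - K" "open P"
      using x s oNK by (auto simp: P_def connected_component_subset open_connected_component)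
    show "x \<in> W"
    proof (cases "P \<inter> - E = {}")
      case False
      then have "P \<inter> W \<noteq> {}" using NW P(3) by blast
      then show ?thesis using P(1) unfolding P_def W_def
        by (metis connected_component_eq connected_component_nonoverlap)
    next
      case True
      have "connected (closed_segment x z)" by simp
      moreover have "closed_segment x z \<inter> P \<noteq> {}" using P(1) by auto
      moreover have "closed_segment x z - P \<noteq> {}" using zK P(3) by auto
      ultimately obtain y where y: "y \<in> closed_segment x z" "y \<in> frontier P"
        using connected_Int_frontier by blast
      have "closed_segment x z \<subseteq> ball z s" using x s by (intro closed_segment_subset) auto
      then have yN: "y \<in> N" using y s by blast
      have ycl: "y \<in> closure P" "y \<notin> P" using y(2) P(4) by (auto simp: frontier_def interior_open)
      have conn: "connected (insert y P)"
        by (rule connected_intermediate_closure[OF P(2)]) (use ycl closure_subset in auto)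
      have "y \<in> K"
      proof (rule ccontr)
        assume "y \<notin> K"
        then have "insert y P \<subseteq> P" unfolding P_def
          by (intro connected_component_maximal) (use conn P yN in \<open>auto simp: P_def\<close>)
        then show False using ycl by blast
      qed
      then have "connected (insert y P \<union> K)" using conn KE by (intro connected_Un) auto
      moreover have "insert y P \<union> K \<subseteq> E" using KE True \<open>y \<in> K\<close> by blast
      ultimately have "insert y P \<union> K \<subseteq> K" using components_maximal[OF K] zK by blast
      then show ?thesis using P by blast
    qed
  qed
  have W: "connected W" "W \<subseteq> N - K" "open W"
    using oNK by (auto simp: W_def connected_component_subset open_connected_component)
  have "(W \<union> ball z s) \<inter> - K = W" using W(2) sub by blast
  then show "\<exists>N. open N \<and> z \<in> N \<and> N \<subseteq> ball z r \<and> connected (N \<inter> - K)"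
    using W s N(3) by (intro exI[of _ "W \<union> ball z s"]) auto
qed

section \<open>A discrete length-area estimate\<close>

text \<open>By Bloch's theorem the image of a disc of radius \<open>d / 2\<close> contains a disc whose radius is
  \<open>d / 24\<close> times the derivative at the centre.  As \<open>F\<close> is injective, these image discs are
  disjoint, so their total area is at most that of the large disc.  This replaces the formula that
  expresses the area of the image by the integral of \<open>\<bar>F'\<bar>\<^sup>2\<close>.\<close>

lemma separated_derivative_area:
  fixes F :: "complex \<Rightarrow> complex"
  assumes hol: "F holomorphic_on S" and inj: "inj_on F S" and B: "F ` S \<subseteq> cball 0 B" "0 \<le> B"
    and I: "finite I" and d: "d > 0"
    and ball: "\<And>i. i \<in> I \<Longrightarrow> ball (u i) (d / 2) \<subseteq> S"
    and sep: "\<And>i j. i \<in> I \<Longrightarrow> j \<in> I \<Longrightarrow> i \<noteq> j \<Longrightarrow> d \<le> dist (u i) (u j)"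
  shows "(\<Sum>i\<in>I. (norm (deriv F (u i)))\<^sup>2) \<le> 576 * B\<^sup>2 / d\<^sup>2"
proof -
  define r where "r = (\<lambda>i. d / 24 * norm (deriv F (u i)))"
  have r0: "r i \<ge> 0" for i using d by (simp add: r_def)
  have "\<exists>c. ball c (r i) \<subseteq> F ` ball (u i) (d / 2)" if "i \<in> I" for i
  proof -
    have "F holomorphic_on ball (u i) (d / 2)" using holomorphic_on_subset[OF hol ball[OF that]] .
    moreover have "r i \<le> d / 2 * norm (deriv F (u i)) / 12" by (simp add: r_def)
    ultimately show ?thesis using Bloch[of F "u i" "d/2" "r i"] d by (metis half_gt_zero)
  qed
  then obtain c where c: "\<And>i. i \<in> I \<Longrightarrow> ball (c i) (r i) \<subseteq> F ` ball (u i) (d / 2)" by metis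
  have disj: "ball (c i) (r i) \<inter> ball (c j) (r j) = {}" if ij: "i \<in> I" "j \<in> I" "i \<noteq> j" for i j
  proof -
    have "ball (u i) (d/2) \<inter> ball (u j) (d/2) = {}"
      by (rule disjoint_ballI) (use sep[OF ij] in auto)
    then have "F ` ball (u i) (d/2) \<inter> F ` ball (u j) (d/2) = {}"
      using inj_on_image_Int[OF inj ball[OF ij(1)] ball[OF ij(2)]] by auto
    then show ?thesis using c[OF ij(1)] c[OF ij(2)] by blast
  qed
  have "(\<Sum>i\<in>I. measure lebesgue (ball (c i) (r i))) = measure lebesgue (\<Union>i\<in>I. ball (c i) (r i))"
  proof (rule measure_UNION'[symmetric, OF I])
    show "pairwise (\<lambda>i j. disjnt (ball (c i) (r i)) (ball (c j) (r j))) I"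
      unfolding pairwise_def disjnt_def using disj by blast
  qed simp
  also have "\<dots> \<le> measure lebesgue (cball (0::complex) B)"
  proof (rule measure_mono_fmeasurable)
    show "(\<Union>i\<in>I. ball (c i) (r i)) \<subseteq> cball 0 B" 
    proof (rule UN_least)
      fix i assume i: "i \<in> I"
      have "F ` ball (u i) (d / 2) \<subseteq> F ` S" by (rule image_mono[OF ball[OF i]])
      then show "ball (c i) (r i) \<subseteq> cball 0 B" using c[OF i] B(1) by blast
    qed
    show "(\<Union>i\<in>I. ball (c i) (r i)) \<in> sets lebesgue" using I by auto
    show "cball (0::complex) B \<in> lmeasurable" by simp
  qed
  finally have "(\<Sum>i\<in>I. unit_ball_vol 2 * (r i)\<^sup>2) \<le> unit_ball_vol 2 * B\<^sup>2"
    using r0 B(2) by (simp add: content_ball content_cball)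
  then have "unit_ball_vol 2 * (\<Sum>i\<in>I. (r i)\<^sup>2) \<le> unit_ball_vol 2 * B\<^sup>2"
    by (simp add: sum_distrib_left)
  then have "(\<Sum>i\<in>I. (r i)\<^sup>2) \<le> B\<^sup>2" by (simp add: unit_ball_vol_pos)
  moreover have "(\<Sum>i\<in>I. (r i)\<^sup>2) = d\<^sup>2 / 576 * (\<Sum>i\<in>I. (norm (deriv F (u i)))\<^sup>2)"
    by (simp add: r_def power_mult_distrib power_divide sum_distrib_left)
  ultimately show ?thesis using d by (simp add: field_simps)
qed

text \<open>The rectangle is divided into squares of side \<open>d\<close>.  If every vertical line had an image of
  diameter above \<open>\<epsilon>\<close>, then the Cauchy-Schwarz inequality would bound the sum of the squared
  derivatives over each column from below, whereas the total sum over all columns is bounded by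
  the area.  So the rectangle cannot be too long.  In every square the derivative is taken at the
  point of the vertical segment where it is largest; such points of adjacent squares may be close
  together, and so the squares of even and of odd height are summed separately; whence the constant
  \<open>9216 = 8 * 2 * 24\<^sup>2\<close>.\<close>

lemma short_image_segment_rect:
  fixes F :: "complex \<Rightarrow> complex" and h k s1 s2 T \<epsilon> :: real
  defines "S \<equiv> {u. Re u < T \<and> \<bar>Im u\<bar> < h}"
  assumes hol: "F holomorphic_on S" and inj: "inj_on F S" and B: "F ` S \<subseteq> cball 0 B" "0 \<le> B"
    and k: "0 < k" "k < h" and s: "s1 < s2" "s2 < T" and e: "\<epsilon> > 0"
    and long: "9216 * k * B\<^sup>2 \<le> \<epsilon>\<^sup>2 * (s2 - s1)"
  shows "\<exists>s\<in>{s1..s2}. \<forall>y1\<in>{-k..k}. \<forall>y2\<in>{-k..k}. dist (F (Complex s y1)) (F (Complex s y2)) \<le> \<epsilon>"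
proof (rule ccontr)
  assume neg: "\<not> ?thesis"
  have oS: "open S"
  proof -
    have "S = {u. Re u < T} \<inter> {u. Im u < h} \<inter> {u. Im u > - h}" by (auto simp: S_def)
    then show ?thesis by (simp add: open_halfspace_Re_lt open_halfspace_Im_lt open_halfspace_Im_gt open_Int)
  qed
  obtain n :: nat where n: "n > 0" "2 * k / n < min (h - k) (T - s2)"
  proof -
    define g where "g = min (h - k) (T - s2)"
    have g: "g > 0" using k s by (simp add: g_def)
    obtain n :: nat where n: "2 * k / g < n" using reals_Archimedean2 by blast
    have "0 < 2 * k / g" using k g by simp
    then have "n > 0" using n by (metis less_trans of_nat_0_less_iff)
    have "2 * k / n < g" using n g \<open>n > 0\<close> by (simp add: pos_divide_less_eq mult.commute)
    then have "2 * k / n < min (h - k) (T - s2)" by (simp add: g_def)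
    then show ?thesis using that[of n] \<open>n > 0\<close> by blast
  qed
  define d where "d = 2 * k / n"
  have d: "d > 0" "n * d = 2 * k" "d < h - k" "d < T - s2" using n k by (auto simp: d_def)
  define J where "J = nat \<lfloor>(s2 - s1) / d\<rfloor> + 1"
  define seg where "seg = (\<lambda>(j::nat) (i::nat). {u. Re u = s1 + j * d \<and> - k + i * d \<le> Im u \<and> Im u \<le> - k + (real i + 1) * d})"
  have Jd: "s2 - s1 \<le> J * d"
  proof -
    have "(s2 - s1) / d \<le> J" using s d by (simp add: J_def) linarith
    then show ?thesis using d by (simp add: field_simps)
  qed
  have js: "s1 + j * d \<le> s2" if "j < J" for j :: nat
  proof -
    have "real j \<le> (s2 - s1) / d" using that s d(1) unfolding J_def
      by (metis add.commute divide_pos_pos floor_less_cancel diff_gt_0_iff_gt le_floor_iff less_Suc_eq_le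
          less_imp_le nat_floor_neg of_int_of_nat_eq plus_1_eq_Suc le_nat_floor nat_le_eq_zle le_nat_iff zero_le_floor)
    then show ?thesis using d by (simp add: field_simps)
  qed
  have segS: "seg j i \<subseteq> S" and seg_ball: "u \<in> seg j i \<Longrightarrow> ball u (d / 2) \<subseteq> S"
    if ji: "j < J" "i < n" for j i u
  proof -
    have "real (i + 1) * d \<le> n * d" using ji d by (intro mult_right_mono) auto
    then have top: "- k + (real i + 1) * d \<le> k" using d(2) by (simp add: add.commute)
    have bot: "0 \<le> i * d" using d(1) by simp
    have *: "Re u \<le> s2 \<and> \<bar>Im u\<bar> \<le> k" if u: "u \<in> seg j i" for u
    proof -
      from u have "Re u = s1 + j * d" "- k + i * d \<le> Im u" "Im u \<le> - k + (real i + 1) * d"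
        by (auto simp: seg_def)
      then show ?thesis using top bot js[OF ji(1)] by linarith
    qed
    then show "seg j i \<subseteq> S" using k s by (force simp: S_def)
    show "ball u (d / 2) \<subseteq> S" if u: "u \<in> seg j i"
    proof
      fix v assume "v \<in> ball u (d/2)"
      then have "norm (v - u) < d / 2" by (simp add: dist_norm norm_minus_commute)
      then have "\<bar>Re v - Re u\<bar> < d/2" "\<bar>Im v - Im u\<bar> < d/2"
        using abs_Re_le_cmod[of "v - u"] abs_Im_le_cmod[of "v - u"] by auto
      then have "Re v < T" "\<bar>Im v\<bar> < h" using *[OF u] d by linarith+
      then show "v \<in> S" by (simp add: S_def)
    qed
  qed
  have compseg: "compact (seg j i)" "seg j i \<noteq> {}" "convex (seg j i)" for j i
  proof -
    have *: "seg j i = closed_segment (Complex (s1 + j*d) (-k+i*d)) (Complex (s1+j*d) (-k+(real i+1)*d))"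
      using d(1) by (auto simp: seg_def closed_segment_same_Re closed_segment_eq_real_ivl)
    show "compact (seg j i)" "seg j i \<noteq> {}" "convex (seg j i)" unfolding * by auto
  qed
  have contd: "continuous_on S (\<lambda>u. norm (deriv F u))"
    using holomorphic_deriv[OF hol oS] by (intro continuous_intros holomorphic_on_imp_continuous_on)
  have "\<exists>u\<in>seg j i. \<forall>v\<in>seg j i. norm (deriv F v) \<le> norm (deriv F u)" if "j < J" "i < n" for j i
    by (rule continuous_attains_sup) (use compseg continuous_on_subset[OF contd segS[OF that]] in auto)
  then obtain u where u: "\<And>j i. j < J \<Longrightarrow> i < n \<Longrightarrow> u j i \<in> seg j i \<and> (\<forall>v\<in>seg j i. norm (deriv F v) \<le> norm (deriv F (u j i)))"
    by metis
  define m where "m = (\<lambda>j i. norm (deriv F (u j i)))"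
  have dist_le: "dist (F (Complex (s1 + j * d) y)) (F (Complex (s1 + j * d) (- k))) \<le> (\<Sum>i<l. d * m j i)"
    if "j < J" "l \<le> n" "y \<in> {-k..-k + l * d}" for j l y
    using that(2,3)
  proof (induction l arbitrary: y)
    case 0
    then show ?case by simp
  next
    case (Suc l)
    define p where "p = - k + l * d"
    show ?case
    proof (cases "y \<le> p")
      case True
      then have "dist (F (Complex (s1 + j * d) y)) (F (Complex (s1 + j * d) (- k))) \<le> (\<Sum>i<l. d * m j i)"
        using Suc by (intro Suc.IH) (auto simp: p_def)
      moreover have "0 \<le> d * m j l" using d by (simp add: m_def)
      ultimately show ?thesis by simp
    next
      case False
      have sg: "Complex (s1 + j * d) y \<in> seg j l" "Complex (s1 + j * d) p \<in> seg j l"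
        using False Suc.prems d(1) by (auto simp: seg_def p_def algebra_simps)
      have 1: "norm (F (Complex (s1 + j * d) y) - F (Complex (s1 + j * d) p))
            \<le> m j l * norm (Complex (s1 + j * d) y - Complex (s1 + j * d) p)"
      proof (rule field_differentiable_bound[OF compseg(3)[of j l] _ _ sg])
        fix z assume z: "z \<in> seg j l"
        then have "z \<in> S" using segS[of j l] that(1) Suc.prems by auto
        then show "(F has_field_derivative deriv F z) (at z within seg j l)"
          using holomorphic_derivI[OF hol oS] by blast
        show "norm (deriv F z) \<le> m j l" using u[of j l] that(1) Suc.prems z by (auto simp: m_def)
      qed
      have "norm (Complex (s1 + j * d) y - Complex (s1 + j * d) p) = \<bar>y - p\<bar>"
        by (simp add: cmod_def)
      also have "\<dots> \<le> d" using False Suc.prems by (auto simp: p_def algebra_simps)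
      finally have "m j l * norm (Complex (s1 + j * d) y - Complex (s1 + j * d) p) \<le> m j l * d"
        by (intro mult_left_mono) (auto simp: m_def)
      with 1 have "dist (F (Complex (s1 + j * d) y)) (F (Complex (s1 + j * d) p)) \<le> d * m j l"
        by (simp add: dist_norm mult.commute)
      moreover have "dist (F (Complex (s1 + j * d) p)) (F (Complex (s1 + j * d) (- k))) \<le> (\<Sum>i<l. d * m j i)"
        using Suc d(1) by (intro Suc.IH) (auto simp: p_def)
      ultimately show ?thesis
        using dist_triangle[of "F (Complex (s1 + j * d) y)" "F (Complex (s1 + j * d) (- k))" "F (Complex (s1 + j * d) p)"] by simp
    qed
  qed
  have col: "\<epsilon>\<^sup>2 < 8 * k * d * (\<Sum>i<n. (m j i)\<^sup>2)" if j: "j < J" for j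
  proof -
    have "s1 + j * d \<in> {s1..s2}" using js[OF j] d(1) by simp
    then obtain y1 y2 where y: "y1 \<in> {-k..k}" "y2 \<in> {-k..k}"
      "dist (F (Complex (s1 + j * d) y1)) (F (Complex (s1 + j * d) y2)) > \<epsilon>"
      using neg by (meson not_le)
    have "dist (F (Complex (s1 + j * d) y)) (F (Complex (s1 + j * d) (- k))) \<le> (\<Sum>i<n. d * m j i)"
      if "y \<in> {-k..k}" for y
      using dist_le[OF j, of n y] that d(2) by auto
    from this[OF y(1)] this[OF y(2)] have "\<epsilon> < 2 * (\<Sum>i<n. d * m j i)"
      using y(3) dist_triangle2[of "F (Complex (s1 + j * d) y1)" "F (Complex (s1 + j * d) y2)" "F (Complex (s1 + j * d) (- k))"]
      by linarith
    then have "\<epsilon>\<^sup>2 < (2 * (\<Sum>i<n. d * m j i))\<^sup>2" using e by (intro power_strict_mono) auto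
    also have "\<dots> = 4 * d\<^sup>2 * (\<Sum>i<n. m j i)\<^sup>2" by (simp add: power_mult_distrib flip: sum_distrib_left)
    also have "(\<Sum>i<n. m j i)\<^sup>2 \<le> n * (\<Sum>i<n. (m j i)\<^sup>2)"
      using Cauchy_Schwarz_ineq_sum[of "\<lambda>_. 1" "m j" "{..<n}"] by simp
    then have "4 * d\<^sup>2 * (\<Sum>i<n. m j i)\<^sup>2 \<le> 4 * d\<^sup>2 * (n * (\<Sum>i<n. (m j i)\<^sup>2))"
      by (intro mult_left_mono) auto
    also have "\<dots> = 4 * d * (n * d) * (\<Sum>i<n. (m j i)\<^sup>2)" by (simp add: power2_eq_square)
    also have "\<dots> = 8 * k * d * (\<Sum>i<n. (m j i)\<^sup>2)" using d(2) by simp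
    finally show ?thesis .
  qed
  have par: "(\<Sum>(j,i)\<in>{..<J} \<times> {i. i < n \<and> i mod 2 = p}. (m j i)\<^sup>2) \<le> 576 * B\<^sup>2 / d\<^sup>2" for p
  proof -
    let ?I = "{..<J} \<times> {i. i < n \<and> i mod 2 = p}"
    have "(\<Sum>x\<in>?I. (norm (deriv F (case_prod u x)))\<^sup>2) \<le> 576 * B\<^sup>2 / d\<^sup>2"
    proof (rule separated_derivative_area[OF hol inj B _ d(1)])
      show "finite ?I" by simp
      show "ball (case_prod u x) (d / 2) \<subseteq> S" if x: "x \<in> ?I" for x
      proof -
        obtain j i where ji: "x = (j, i)" "j < J" "i < n" using x by auto
        then have "u j i \<in> seg j i" using u by blast
        then show ?thesis using seg_ball[OF ji(2,3)] ji(1) by simp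
      qed
      fix x y assume xy: "x \<in> ?I" "y \<in> ?I" "x \<noteq> y"
      obtain j i j' i' where x: "x = (j, i)" and y: "y = (j', i')" by (metis surj_pair)
      have us: "u j i \<in> seg j i" "u j' i' \<in> seg j' i'" using u xy x y by auto
      show "d \<le> dist (case_prod u x) (case_prod u y)"
      proof (cases "j = j'")
        case False
        then have "1 \<le> \<bar>real j - real j'\<bar>" by linarith
        then have "1 * d \<le> \<bar>real j - real j'\<bar> * d" using d by (intro mult_right_mono) auto
        also have "\<dots> = \<bar>Re (u j i - u j' i')\<bar>" using us d(1)
          by (simp add: seg_def abs_mult flip: left_diff_distrib)
        also have "\<dots> \<le> dist (u j i) (u j' i')" using abs_Re_le_cmod[of "u j i - u j' i'"] by (simp add: dist_norm)
        finally show ?thesis by (simp add: x y)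
      next
        case True
        then have "i \<noteq> i'" "i mod 2 = i' mod 2" using xy x y by auto
        have *: "d \<le> dist (u j i) (u j' i')" if "i + 2 \<le> i'" "u j i \<in> seg j i" "u j' i' \<in> seg j' i'" for i i' j j'
        proof -
          have "real (i + 2) * d \<le> real i' * d" using that d by (intro mult_right_mono) auto
          then have "d \<le> Im (u j' i') - Im (u j i)" using that(2,3) by (auto simp: seg_def algebra_simps)
          also have "\<dots> \<le> \<bar>Im (u j i - u j' i')\<bar>" by simp
          also have "\<dots> \<le> dist (u j i) (u j' i')" using abs_Im_le_cmod[of "u j i - u j' i'"] by (simp add: dist_norm)
          finally show ?thesis .
        qed
        have "i + 2 \<le> i' \<or> i' + 2 \<le> i" using \<open>i \<noteq> i'\<close> \<open>i mod 2 = i' mod 2\<close> by presburger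
        then show ?thesis using *[OF _ us] *[OF _ us(2,1)] by (auto simp: x y dist_commute)
      qed
    qed
    then show ?thesis by (simp add: m_def case_prod_unfold)
  qed
  have split: "(\<Sum>j<J. \<Sum>i<n. (m j i)\<^sup>2) \<le> 1152 * B\<^sup>2 / d\<^sup>2"
  proof -
    have "(\<Sum>j<J. \<Sum>i<n. (m j i)\<^sup>2) = (\<Sum>(j,i)\<in>{..<J} \<times> {..<n}. (m j i)\<^sup>2)"
      by (simp add: sum.cartesian_product)
    also have "{..<J} \<times> {..<n} = {..<J} \<times> {i. i < n \<and> i mod 2 = 0} \<union> {..<J} \<times> {i. i < n \<and> i mod 2 = 1}"
      by auto
    also have "(\<Sum>(j,i)\<in>\<dots>. (m j i)\<^sup>2) = (\<Sum>(j,i)\<in>{..<J} \<times> {i. i < n \<and> i mod 2 = 0}. (m j i)\<^sup>2)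
        + (\<Sum>(j,i)\<in>{..<J} \<times> {i. i < n \<and> i mod 2 = 1}. (m j i)\<^sup>2)"
      by (rule sum.union_disjoint) auto
    also have "\<dots> \<le> 576 * B\<^sup>2 / d\<^sup>2 + 576 * B\<^sup>2 / d\<^sup>2" by (intro add_mono par)
    finally show ?thesis by simp
  qed
  have "J > 0" by (simp add: J_def)
  have "J * \<epsilon>\<^sup>2 = (\<Sum>j<J. \<epsilon>\<^sup>2)" by simp
  also have "\<dots> < (\<Sum>j<J. 8 * k * d * (\<Sum>i<n. (m j i)\<^sup>2))"
    by (rule sum_strict_mono) (use col \<open>J > 0\<close> in auto)
  also have "\<dots> = 8 * k * d * (\<Sum>j<J. \<Sum>i<n. (m j i)\<^sup>2)" by (simp add: sum_distrib_left)
  also have "\<dots> \<le> 8 * k * d * (1152 * B\<^sup>2 / d\<^sup>2)" using split k d by (intro mult_left_mono) auto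
  also have "\<dots> = 9216 * k * B\<^sup>2 / d" using d by (simp add: power2_eq_square)
  finally have "J * \<epsilon>\<^sup>2 < 9216 * k * B\<^sup>2 / d" .
  then have "J * d * \<epsilon>\<^sup>2 < 9216 * k * B\<^sup>2" using d(1) by (simp add: field_simps)
  moreover have "(s2 - s1) * \<epsilon>\<^sup>2 \<le> J * d * \<epsilon>\<^sup>2" using Jd by (intro mult_right_mono) auto
  ultimately show False using long by (simp add: mult.commute)
qed

text \<open>For the full height of the strip, take a limit over closed subrectangles: the sets of good abscissae are compact and decreasing.\<close>

lemma short_image_segment:
  fixes F :: "complex \<Rightarrow> complex" and h T \<epsilon> t :: real
  defines "S \<equiv> {u. Re u < T \<and> \<bar>Im u\<bar> < h}"
  assumes hol: "F holomorphic_on S" and inj: "inj_on F S" and B: "F ` S \<subseteq> cball 0 B"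
    and h: "h > 0" and e: "\<epsilon> > 0"
  obtains s where "s < t" "s < T"
    "\<And>u v. Re u = s \<Longrightarrow> Re v = s \<Longrightarrow> \<bar>Im u\<bar> < h \<Longrightarrow> \<bar>Im v\<bar> < h \<Longrightarrow> dist (F u) (F v) \<le> \<epsilon>"
proof -
  have "Complex (T - 1) 0 \<in> S" using h by (simp add: S_def)
  then have B0: "0 \<le> B" using B by (metis image_subset_iff mem_cball_0 norm_ge_zero order_trans)
  define s2 where "s2 = min t T - 1"
  define s1 where "s1 = s2 - 9216 * h * B\<^sup>2 / \<epsilon>\<^sup>2 - 1"
  have s: "s1 < s2" "s2 < T" "s2 < t"
  proof -
    have "0 \<le> 9216 * h * B\<^sup>2 / \<epsilon>\<^sup>2" using h by simp
    then show "s1 < s2" by (simp add: s1_def)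
  qed (auto simp: s2_def)
  define k where "k = (\<lambda>n. h * (1 - 1 / (real n + 2)))"
  have k: "0 < k n" "k n < h" for n
  proof -
    have "0 < 1 - 1 / (real n + 2)" "1 - 1 / (real n + 2) < 1" by (auto simp: field_simps)
    then show "0 < k n" "k n < h" unfolding k_def using h by (auto intro: mult_pos_pos)
  qed
  have kmono: "k n \<le> k n'" if "n \<le> n'" for n n' using h that by (auto simp: k_def frac_le)
  define P where "P = (\<lambda>n. {s\<in>{s1..s2}. \<forall>y1\<in>{-k n..k n}. \<forall>y2\<in>{-k n..k n}. dist (F (Complex s y1)) (F (Complex s y2)) \<le> \<epsilon>})"
  have "P n \<noteq> {}" for n
  proof -
    have "9216 * k n * B\<^sup>2 \<le> 9216 * h * B\<^sup>2"
      using k[of n] by (intro mult_right_mono mult_left_mono) auto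
    also have "\<dots> \<le> \<epsilon>\<^sup>2 * (s2 - s1)" using e by (simp add: s1_def distrib_left)
    finally show ?thesis
      using short_image_segment_rect[of F T h B "k n" s1 s2 \<epsilon>] hol inj B B0 k s e by (auto simp: S_def P_def)
  qed
  moreover have "compact (P n)" for n
  proof -
    have cl: "closed {s\<in>{s1..s2}. dist (F (Complex s y1)) (F (Complex s y2)) \<le> \<epsilon>}" if y: "y1 \<in> {-k n..k n}" "y2 \<in> {-k n..k n}" for y1 y2
    proof -
      have c: "continuous_on {s1..s2} (\<lambda>s. F (Complex s y))" if "y \<in> {-k n..k n}" for y
      proof (rule continuous_on_compose2[OF holomorphic_on_imp_continuous_on[OF hol]])
        show "continuous_on {s1..s2} (\<lambda>s. Complex s y)"
          by (simp add: Complex_eq) (intro continuous_intros)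
        show "(\<lambda>s. Complex s y) ` {s1..s2} \<subseteq> S" using that k[of n] s by (auto simp: S_def)
      qed
      show ?thesis
        by (rule continuous_on_closed_Collect_le) (use c y in \<open>auto intro!: continuous_intros\<close>)
    qed
    have "P n = {s1..s2} \<inter> (\<Inter>y1\<in>{-k n..k n}. \<Inter>y2\<in>{-k n..k n}. {s\<in>{s1..s2}. dist (F (Complex s y1)) (F (Complex s y2)) \<le> \<epsilon>})"
      by (auto simp: P_def)
    moreover have "compact ({s1..s2} \<inter> (\<Inter>y1\<in>{-k n..k n}. \<Inter>y2\<in>{-k n..k n}. {s\<in>{s1..s2}. dist (F (Complex s y1)) (F (Complex s y2)) \<le> \<epsilon>}))"
      by (intro compact_Int_closed closed_INT ballI cl) auto
    ultimately show ?thesis by simp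
  qed
  moreover have "P n' \<subseteq> P n" if "n \<le> n'" for n n'
    using kmono[OF that] by (auto simp: P_def)
  ultimately have "(\<Inter>n. P n) \<noteq> {}" using compact_nest[of P] by blast
  then obtain s where sP: "\<And>n. s \<in> P n" by blast
  show ?thesis
  proof
    show "s < t" "s < T" using sP[of 0] s by (auto simp: P_def)
    fix u v assume uv: "Re u = s" "Re v = s" "\<bar>Im u\<bar> < h" "\<bar>Im v\<bar> < h"
    have "(\<lambda>n. 1 / (real n + 2)) \<longlonglongrightarrow> 0"
      using LIMSEQ_ignore_initial_segment[OF lim_1_over_n, of 2] by (simp add: add.commute)
    then have "k \<longlonglongrightarrow> h * (1 - 0)" unfolding k_def by (intro tendsto_intros)
    then have "\<forall>\<^sub>F n in sequentially. max \<bar>Im u\<bar> \<bar>Im v\<bar> < k n" using uv by (intro order_tendstoD) auto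
    then obtain n where "max \<bar>Im u\<bar> \<bar>Im v\<bar> < k n" by (auto simp: eventually_sequentially)
    then have "Im u \<in> {-k n..k n}" "Im v \<in> {-k n..k n}" by auto
    then have "dist (F (Complex s (Im u))) (F (Complex s (Im v))) \<le> \<epsilon>" using sP[of n] by (auto simp: P_def)
    moreover have "Complex s (Im u) = u" "Complex s (Im v) = v" using uv by (auto simp: complex_eq_iff)
    ultimately show "dist (F u) (F v) \<le> \<epsilon>" by simp
  qed
qed

section \<open>The Riemann map of the complement of a continuum\<close>

text \<open>The map \<open>\<Phi>\<close> is a conformal bijection of the punctured disc onto \<open>- K\<close> with inverse \<open>\<Psi>\<close>; the
  puncture \<open>z0\<close> is a simple pole and corresponds to infinity.  The function \<open>H\<close> is \<open>\<Phi>\<close> with the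
  pole removed.\<close>

locale exterior_map =
  fixes K :: "complex set" and z0 :: complex and \<Phi> \<Psi> H :: "complex \<Rightarrow> complex" and \<rho> B :: real
  assumes K: "compact K"
    and z0: "norm z0 < 1"
    and hol\<Phi>: "\<Phi> holomorphic_on ball 0 1 - {z0}"
    and \<Phi>_notin: "\<And>z. z \<in> ball 0 1 - {z0} \<Longrightarrow> \<Phi> z \<notin> K"
    and \<Psi>_in: "\<And>v. v \<notin> K \<Longrightarrow> \<Psi> v \<in> ball 0 1 - {z0}"
    and \<Phi>\<Psi>: "\<And>v. v \<notin> K \<Longrightarrow> \<Phi> (\<Psi> v) = v"
    and \<Psi>\<Phi>: "\<And>z. z \<in> ball 0 1 - {z0} \<Longrightarrow> \<Psi> (\<Phi> z) = z"
    and cont\<Psi>: "continuous_on (- K) \<Psi>"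
    and holH: "H holomorphic_on ball 0 1"
    and H0: "H z0 \<noteq> 0"
    and H_eq: "\<And>z. z \<in> ball 0 1 - {z0} \<Longrightarrow> H z = (z - z0) * \<Phi> z"
    and \<rho>: "\<rho> < 1" "norm z0 < \<rho>"
    and bound: "\<And>z. \<rho> \<le> norm z \<Longrightarrow> norm z < 1 \<Longrightarrow> norm (\<Phi> z) \<le> B"

text \<open>The inversion about \<open>k0\<close> turns \<open>- K\<close> together with infinity into a plane domain \<open>W\<close>.  A
  bounded component of \<open>- W\<close> would have a compact clopen neighbourhood in \<open>- W\<close>, and this would
  come from a clopen part of the continuum \<open>K\<close> that misses \<open>k0\<close>.  So \<open>W\<close> is simply connected,
  and the Riemann mapping theorem applies to it.\<close>

lemma exterior_map_exists:
  fixes K :: "complex set"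
  assumes K: "compact K" "connected K" "connected (- K)" and k: "k0 \<in> K" "k1 \<in> K" "k0 \<noteq> k1"
  shows "\<exists>z0 \<Phi> \<Psi> H \<rho> B. exterior_map K z0 \<Phi> \<Psi> H \<rho> B"
proof -
  have clK: "closed K" using K compact_imp_closed by blast
  define inv where "inv = (\<lambda>w. k0 + inverse w)"
  define W where "W = insert 0 {w. inv w \<notin> K}"
  have inv_inv: "inverse (inv w - k0) = w" for w by (simp add: inv_def)
  have inv_inv': "inv (inverse (v - k0)) = v" for v by (simp add: inv_def)
  have inv0: "inv 0 = k0" by (simp add: inv_def)
  have W_not0: "w \<in> W \<longleftrightarrow> inv w \<notin> K" if "w \<noteq> 0" for w using that by (simp add: W_def)
  obtain R where R: "R > 0" "\<And>v. v \<in> K \<Longrightarrow> norm v < R" using K compact_imp_bounded bounded_pos_less by metis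
  define \<eta> where "\<eta> = 1 / (2 * R)"
  have \<eta>: "\<eta> > 0" using R by (simp add: \<eta>_def)
  \<comment> \<open>Points near \<open>0\<close> correspond to points near infinity, hence outside the bounded set \<open>K\<close>.\<close>
  have small: "cball 0 \<eta> \<subseteq> W"
  proof
    fix w :: complex assume w: "w \<in> cball 0 \<eta>"
    show "w \<in> W"
    proof (cases "w = 0")
      case False
      have "inv w \<notin> K"
      proof
        assume "inv w \<in> K"
        then have "norm (inverse w) < 2 * R"
          using R(2)[of "inv w"] R(2)[OF k(1)] norm_triangle_ineq4[of "inv w" k0] by (simp add: inv_def)
        moreover have "2 * R \<le> norm (inverse w)"
        proof -
          have "2 * R * norm w \<le> 1" using w R(1) by (simp add: \<eta>_def field_simps)
          then have "2 * R \<le> 1 / norm w" using False by (simp add: pos_le_divide_eq)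
          then show ?thesis by (simp add: norm_inverse inverse_eq_divide norm_divide)
        qed
        ultimately show False by simp
      qed
      then show ?thesis using False W_not0 by blast
    qed (simp add: W_def)
  qed
  have cont_inv: "continuous_on (- {0}) inv" unfolding inv_def by (intro continuous_intros) auto
  have oW: "open W"
  proof -
    have "open (- {0} \<inter> inv -` (- K))"
      by (rule continuous_open_preimage[OF cont_inv]) (use clK in auto)
    then have "open (ball 0 \<eta> \<union> (- {0} \<inter> inv -` (- K)))" by (intro open_Un) auto
    moreover have "ball 0 \<eta> \<union> (- {0} \<inter> inv -` (- K)) = W"
    proof -
      have "ball 0 \<eta> \<subseteq> W" using small ball_subset_cball by blast
      moreover have "0 \<in> ball (0::complex) \<eta>" using \<eta> by simp
      moreover have "- {0} \<inter> inv -` (- K) = W - {0}" using W_not0 by blast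
      ultimately show ?thesis by blast
    qed
    ultimately show ?thesis by simp
  qed
  have conW: "connected W"
  proof -
    have "connected ((\<lambda>v. inverse (v - k0)) ` (- K))"
    proof (rule connected_continuous_image[OF _ K(3)])
      show "continuous_on (- K) (\<lambda>v. inverse (v - k0))" using k(1) by (intro continuous_intros) auto
    qed
    moreover have "(\<lambda>v. inverse (v - k0)) ` (- K) = W - {0}"
    proof
      show "(\<lambda>v. inverse (v - k0)) ` (- K) \<subseteq> W - {0}"
        using k(1) by (auto simp: W_def inv_inv')
      show "W - {0} \<subseteq> (\<lambda>v. inverse (v - k0)) ` (- K)"
      proof
        fix w assume "w \<in> W - {0}"
        then show "w \<in> (\<lambda>v. inverse (v - k0)) ` (- K)"
          by (intro image_eqI[of _ _ "inv w"]) (auto simp: inv_inv W_def)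
      qed
    qed
    ultimately have c: "connected (W - {0})" by simp
    have "0 islimpt W" using oW by (intro interior_limit_point) (auto simp: interior_open W_def)
    then have "0 \<in> closure (W - {0})" by (simp add: islimpt_in_closure)
    then show ?thesis
      using connected_intermediate_closure[OF c, of W] closure_subset[of "W - {0}"] by blast
  qed
  have cptl: "\<not> bounded C" if C: "C \<in> components (- W)" for C
  proof
    assume bC: "bounded C"
    have clW: "closed (- W)" using oW by (rule closed_Compl)
    have "compact C" using bC closed_components[OF clW C] compact_eq_bounded_closed by blast
    then obtain D where D: "openin (top_of_set (- W)) D" "compact D" "C \<subseteq> D"
      using Sura_Bura_clopen_subset[OF closed_imp_locally_compact[OF clW] C, of UNIV] by auto
    define T where "T = inv ` D"
    have D0: "0 \<notin> D" "D \<subseteq> - W" using D(1) openin_imp_subset by (auto simp: W_def)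
    have TK: "T \<subseteq> K" using D0 by (auto simp: T_def W_def)
    have k0T: "k0 \<notin> T" using D0 by (auto simp: T_def inv_def)
    have "compact T" unfolding T_def
      by (rule compact_continuous_image) (use D D0 continuous_on_subset[OF cont_inv] in auto)
    then have clT: "closedin (top_of_set K) T"
      using TK compact_imp_closed closed_subset by blast
    obtain O' where O': "open O'" "D = - W \<inter> O'" using D(1) by (auto simp: openin_open)
    have opT: "openin (top_of_set K) T"
    proof -
      have contr: "continuous_on (- {k0}) (\<lambda>v. inverse (v - k0))" by (intro continuous_intros) auto
      have "open (- {k0} \<inter> (\<lambda>v. inverse (v - k0)) -` O')"
        by (rule continuous_open_preimage[OF contr]) (use O'(1) in auto)
      moreover have "T = K \<inter> (- {k0} \<inter> (\<lambda>v. inverse (v - k0)) -` O')"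
      proof
        show "T \<subseteq> K \<inter> (- {k0} \<inter> (\<lambda>v. inverse (v - k0)) -` O')"
          using TK k0T O'(2) by (auto simp: T_def inv_inv)
        show "K \<inter> (- {k0} \<inter> (\<lambda>v. inverse (v - k0)) -` O') \<subseteq> T"
        proof
          fix v assume v: "v \<in> K \<inter> (- {k0} \<inter> (\<lambda>v. inverse (v - k0)) -` O')"
          then have "inverse (v - k0) \<in> D" using O'(2) by (auto simp: W_def inv_inv')
          then show "v \<in> T" unfolding T_def by (intro image_eqI[of _ _ "inverse (v - k0)"]) (auto simp: inv_inv')
        qed
      qed
      ultimately show ?thesis by (metis openin_open_Int)
    qed
    have "T \<noteq> {}" using C D(3) in_components_nonempty by (auto simp: T_def)
    then have "T = K" using K(2) clT opT connected_clopen by blast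
    then show False using k0T k by blast
  qed
  have "simply_connected W"
    using simply_connected_eq_unbounded_complement_components[OF oW] conW cptl by blast
  moreover have "W \<noteq> {}" "W \<noteq> UNIV"
  proof -
    show "W \<noteq> {}" by (simp add: W_def)
    have "inverse (k1 - k0) \<notin> W" using k by (simp add: W_def inv_inv')
    then show "W \<noteq> UNIV" by blast
  qed
  ultimately obtain f g where fg: "f holomorphic_on W" "g holomorphic_on ball 0 1"
      "\<And>w. w \<in> W \<Longrightarrow> f w \<in> ball 0 1 \<and> g (f w) = w"
      "\<And>z. z \<in> ball 0 1 \<Longrightarrow> g z \<in> W \<and> f (g z) = z"
    using Riemann_mapping_theorem[of W] oW by blast
  define z0 where "z0 = f 0"
  have W0: "0 \<in> W" by (simp add: W_def)
  have z0: "z0 \<in> ball 0 1" "g z0 = 0" using fg(3)[OF W0] by (auto simp: z0_def)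
  have g0: "g z = 0 \<longleftrightarrow> z = z0" if "z \<in> ball 0 1" for z
    using fg(4)[OF that] z0 by (auto simp: z0_def)
  \<comment> \<open>Dividing by the simple zero of \<open>g\<close> shows that the pole of \<open>\<Phi>\<close> at \<open>z0\<close> is simple.\<close>
  define g1 where "g1 = (\<lambda>z. if z = z0 then deriv g z0 else (g z - g z0) / (z - z0))"
  have holg1: "g1 holomorphic_on ball 0 1" unfolding g1_def
    by (rule pole_lemma[OF fg(2)]) (use z0 in simp)
  have "inj_on g (ball 0 1)" using fg(4) by (metis inj_onI)
  then have "deriv g z0 \<noteq> 0" using holomorphic_injective_imp_regular[OF fg(2) _ _ z0(1)] by simp
  then have g1n: "g1 z \<noteq> 0" if "z \<in> ball 0 1" for z using g0[OF that] z0 by (simp add: g1_def)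
  have gg1: "g z = (z - z0) * g1 z" if "z \<in> ball 0 1" for z using z0 by (simp add: g1_def)
  define \<Phi> where "\<Phi> = (\<lambda>z. inv (g z))"
  define \<Psi> where "\<Psi> = (\<lambda>v. f (inverse (v - k0)))"
  define H where "H = (\<lambda>z. (z - z0) * k0 + inverse (g1 z))"
  have inW: "inverse (v - k0) \<in> W" "inverse (v - k0) \<noteq> 0" if "v \<notin> K" for v
    using that k by (auto simp: W_def inv_inv')
  obtain \<rho>' where \<rho>': "\<rho>' < 1" "\<And>z. z \<in> f ` cball 0 \<eta> \<Longrightarrow> norm z \<le> \<rho>'"
  proof -
    have "compact (f ` cball 0 \<eta>)"
      using continuous_on_subset[OF holomorphic_on_imp_continuous_on[OF fg(1)] small] by (intro compact_continuous_image) auto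
    moreover have "f ` cball 0 \<eta> \<noteq> {}" using \<eta> by auto
    ultimately obtain x where x: "x \<in> f ` cball 0 \<eta>" "\<forall>y\<in>f ` cball 0 \<eta>. norm y \<le> norm x"
      using continuous_attains_sup[of "f ` cball 0 \<eta>" norm] by (auto intro: continuous_intros)
    moreover have "norm x < 1" using x(1) small fg(3) by auto
    ultimately show ?thesis using that by blast
  qed
  define \<rho> where "\<rho> = (max \<rho>' (norm z0) + 1) / 2"
  have \<rho>: "\<rho> < 1" "\<rho>' < \<rho>" "norm z0 < \<rho>" using \<rho>'(1) z0(1) by (auto simp: \<rho>_def)
  have "exterior_map K z0 \<Phi> \<Psi> H \<rho> (norm k0 + 1 / \<eta>)"
  proof
    show "compact K" by fact
    show "norm z0 < 1" using z0 by simp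
    show "\<Phi> holomorphic_on ball 0 1 - {z0}" unfolding \<Phi>_def inv_def
      using g0 by (intro holomorphic_intros holomorphic_on_subset[OF fg(2)]) auto
    show "\<Phi> z \<notin> K" if "z \<in> ball 0 1 - {z0}" for z
      using fg(4)[of z] g0[of z] that W_not0 by (auto simp: \<Phi>_def)
    show "\<Psi> v \<in> ball 0 1 - {z0}" if "v \<notin> K" for v
    proof -
      have "g (\<Psi> v) = inverse (v - k0)" "\<Psi> v \<in> ball 0 1" using fg(3)[OF inW(1)[OF that]] by (auto simp: \<Psi>_def)
      then have "\<Psi> v \<noteq> z0" using inW(2)[OF that] g0[of "\<Psi> v"] by metis
      then show ?thesis using \<open>\<Psi> v \<in> ball 0 1\<close> by blast
    qed
    show "\<Phi> (\<Psi> v) = v" if "v \<notin> K" for v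
      using fg(3)[OF inW(1)[OF that]] by (simp add: \<Phi>_def \<Psi>_def inv_inv')
    show "\<Psi> (\<Phi> z) = z" if "z \<in> ball 0 1 - {z0}" for z
      using fg(4)[of z] that by (simp add: \<Phi>_def \<Psi>_def inv_inv)
    show "continuous_on (- K) \<Psi>" unfolding \<Psi>_def
    proof (rule continuous_on_compose2[OF holomorphic_on_imp_continuous_on[OF fg(1)]])
      show "continuous_on (- K) (\<lambda>v. inverse (v - k0))" using k(1) by (intro continuous_intros) auto
    qed (use inW in auto)
    show "H holomorphic_on ball 0 1" unfolding H_def by (intro holomorphic_intros holg1 g1n)
    show "H z0 \<noteq> 0" using g1n[OF z0(1)] by (simp add: H_def)
    show "H z = (z - z0) * \<Phi> z" if "z \<in> ball 0 1 - {z0}" for z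
    proof -
      have nz: "z - z0 \<noteq> 0" and "z \<in> ball 0 1" using that by auto
      have "inverse (g z) = inverse (z - z0) * inverse (g1 z)"
        by (simp only: gg1[OF \<open>z \<in> ball 0 1\<close>] inverse_mult_distrib)
      then have "(z - z0) * inverse (g z) = inverse (g1 z)"
        using nz by (simp flip: mult.assoc)
      then show ?thesis by (simp add: H_def \<Phi>_def inv_def distrib_left)
    qed
    show "\<rho> < 1" "norm z0 < \<rho>" by fact+
    show "norm (\<Phi> z) \<le> norm k0 + 1 / \<eta>" if "\<rho> \<le> norm z" "norm z < 1" for z
    proof -
      have "g z \<notin> cball 0 \<eta>"
      proof
        assume "g z \<in> cball 0 \<eta>"
        then have "z \<in> f ` cball 0 \<eta>" using fg(4)[of z] that(2) by (metis image_eqI mem_ball_0)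
        then show False using \<rho>'(2) \<rho> that by force
      qed
      then have "\<eta> < norm (g z)" by simp
      then have "norm (inverse (g z)) \<le> 1 / \<eta>" 
        using \<eta> le_imp_inverse_le[of \<eta> "norm (g z)"] by (simp add: norm_inverse inverse_eq_divide norm_divide)
      then show ?thesis unfolding \<Phi>_def inv_def using norm_triangle_ineq[of k0 "inverse (g z)"] by linarith
    qed
  qed
  then show ?thesis by blast
qed

text \<open>The extension of a function by its limits is automatically continuous.\<close>

lemma continuous_on_limit_extension:
  fixes f g :: "'a::metric_space \<Rightarrow> 'b::metric_space"
  assumes lp: "\<And>x. x \<in> T \<Longrightarrow> x islimpt S" and lim: "\<And>x. x \<in> T \<Longrightarrow> (f \<longlongrightarrow> g x) (at x within S)"
  shows "continuous_on T g"
  unfolding continuous_on_iff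
proof (intro ballI allI impI)
  fix x and e :: real assume x: "x \<in> T" and e: "e > 0"
  obtain d where d: "d > 0" "\<And>z. z \<in> S \<Longrightarrow> 0 < dist z x \<Longrightarrow> dist z x < d \<Longrightarrow> dist (f z) (g x) < e / 2"
    using lim[OF x] e unfolding tendsto_iff eventually_at by (metis half_gt_zero zero_less_dist_iff)
  show "\<exists>d>0. \<forall>x'\<in>T. dist x' x < d \<longrightarrow> dist (g x') (g x) < e"
  proof (intro exI[of _ d] conjI ballI impI d(1))
    fix y assume y: "y \<in> T" "dist y x < d"
    show "dist (g y) (g x) < e"
    proof (cases "y = x")
      case False
      obtain d' where d': "d' > 0" "\<And>z. z \<in> S \<Longrightarrow> 0 < dist z y \<Longrightarrow> dist z y < d' \<Longrightarrow> dist (f z) (g y) < e / 2"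
        using lim[OF y(1)] e unfolding tendsto_iff eventually_at by (metis half_gt_zero zero_less_dist_iff)
      have "min d' (min (dist y x) (d - dist y x)) > 0" using False d' y(2) by simp
      then obtain z where z: "z \<in> S" "z \<noteq> y" "dist z y < min d' (min (dist y x) (d - dist y x))"
        using lp[OF y(1)] unfolding islimpt_approachable by blast
      have "dist z x > 0" using z(3) by (auto simp: dist_commute)
      moreover have "dist z x < d" using z(3) dist_triangle[of z x y] by simp
      ultimately have "dist (f z) (g x) < e / 2" using d(2)[OF z(1)] by blast
      moreover have "dist (f z) (g y) < e / 2" using d'(2)[OF z(1)] z by simp
      ultimately show ?thesis using dist_triangle3[of "g y" "g x" "f z"] by simp
    qed (use e in simp)
  qed
qed

context exterior_map
begin

lemma cluster_in_frontier:
  assumes z: "\<And>n. z n \<in> ball 0 1 - {z0}" and lim: "z \<longlonglongrightarrow> \<zeta>" "norm \<zeta> = 1" and w: "(\<lambda>n. \<Phi> (z n)) \<longlonglongrightarrow> w"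
  shows "w \<in> frontier K"
proof -
  have "w \<in> K"
  proof (rule ccontr)
    assume "w \<notin> K"
    then have "isCont \<Psi> w" using cont\<Psi> K by (simp add: continuous_on_eq_continuous_at compact_imp_closed open_Compl)
    then have "(\<lambda>n. \<Psi> (\<Phi> (z n))) \<longlonglongrightarrow> \<Psi> w" using w isCont_tendsto_compose by blast
    then have "z \<longlonglongrightarrow> \<Psi> w" using \<Psi>\<Phi>[OF z] by simp
    then have "\<zeta> = \<Psi> w" using lim(1) LIMSEQ_unique by blast
    then show False using \<Psi>_in[OF \<open>w \<notin> K\<close>] lim(2) by simp
  qed
  moreover have "w \<in> closure (- K)"
    using w \<Phi>_notin[OF z] unfolding closure_sequential by (intro exI[of _ "\<lambda>n. \<Phi> (z n)"]) auto
  ultimately show ?thesis using closure_subset[of K] by (auto simp: frontier_closures)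
qed

end

section \<open>Boundary values of the Riemann map\<close>

lemma LIMSEQ_one_over_Suc: "(\<lambda>n. 1 / (real n + 1)) \<longlonglongrightarrow> 0"
  using LIMSEQ_ignore_initial_segment[OF lim_1_over_n, of 1] by (simp add: add.commute)

lemma LIMSEQ_if_dist_less:
  assumes "\<And>n. dist (z n) l < 1 / (real n + 1)" shows "z \<longlonglongrightarrow> l"
proof -
  have "(\<lambda>n. dist (z n) l) \<longlonglongrightarrow> 0"
    by (rule Lim_null_comparison[OF _ LIMSEQ_one_over_Suc])
       (use assms in \<open>auto intro!: always_eventually less_imp_le\<close>)
  then show ?thesis using tendsto_dist_iff by blast
qed

lemma strip_exp_Re_pos: "\<bar>Im u\<bar> < pi / 2 \<Longrightarrow> Re (exp u) > 0"
  by (simp add: Re_exp cos_gt_zero_pi abs_less_iff)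

lemma norm_less_reflect:
  fixes w :: complex
  shows "norm (1 - w) < norm (1 + w) \<longleftrightarrow> Re w > 0"
proof -
  have "norm (1 - w) < norm (1 + w) \<longleftrightarrow> (norm (1 - w))\<^sup>2 < (norm (1 + w))\<^sup>2"
    using power_strict_mono[of "norm (1 - w)" "norm (1 + w)" 2] power_less_imp_less_base[of "norm (1 - w)" 2 "norm (1 + w)"]
    by auto
  also have "\<dots> \<longleftrightarrow> Re w > 0" unfolding cmod_power2 by (simp add: power2_eq_square algebra_simps)
  finally show ?thesis .
qed

text \<open>The strip \<open>\<bar>Im u\<bar> < pi / 2\<close> is mapped conformally onto the unit disc in such a way that the left
  end of the strip corresponds to \<open>\<zeta>\<close>.  Vertical lines become circular crosscuts around \<open>\<zeta>\<close>.\<close>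

definition strip_disc :: "complex \<Rightarrow> complex \<Rightarrow> complex" where
  "strip_disc \<zeta> u = \<zeta> * (1 - exp u) / (1 + exp u)"

definition disc_strip :: "complex \<Rightarrow> complex \<Rightarrow> complex" where
  "disc_strip \<zeta> z = Ln ((\<zeta> - z) / (\<zeta> + z))"

lemma strip_exp_nz:
  assumes "\<bar>Im u\<bar> < pi / 2" shows "1 + exp u \<noteq> 0"
proof
  assume "1 + exp u = 0"
  then have "Re (1 + exp u) = 0" by simp
  then show False using strip_exp_Re_pos[OF assms] by simp
qed

lemma strip_disc_norm:
  assumes "norm \<zeta> = 1" "\<bar>Im u\<bar> < pi / 2" shows "norm (strip_disc \<zeta> u) < 1"
  using norm_less_reflect[of "exp u"] strip_exp_Re_pos[OF assms(2)] strip_exp_nz[OF assms(2)] assms(1)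
  by (simp add: strip_disc_def norm_divide norm_mult)

lemma strip_disc_dist:
  assumes "norm \<zeta> = 1" "\<bar>Im u\<bar> < pi / 2" shows "norm (strip_disc \<zeta> u - \<zeta>) \<le> 2 * exp (Re u)"
proof -
  have nz: "1 + exp u \<noteq> 0" using strip_exp_nz assms by blast
  have "strip_disc \<zeta> u - \<zeta> = \<zeta> * (- 2 * exp u) / (1 + exp u)"
    using nz by (simp add: strip_disc_def field_simps)
  then have "norm (strip_disc \<zeta> u - \<zeta>) = 2 * exp (Re u) / norm (1 + exp u)"
    using assms by (simp add: norm_divide norm_mult)
  moreover have "1 \<le> norm (1 + exp u)"
    using strip_exp_Re_pos[OF assms(2)] abs_Re_le_cmod[of "1 + exp u"] by simp
  ultimately show ?thesis by (simp add: divide_le_eq mult_le_cancel_left1)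
qed

lemma disc_strip_inverse:
  assumes "norm \<zeta> = 1" "norm z < 1"
  shows "\<bar>Im (disc_strip \<zeta> z)\<bar> < pi / 2" "strip_disc \<zeta> (disc_strip \<zeta> z) = z"
    and "exp (disc_strip \<zeta> z) = (\<zeta> - z) / (\<zeta> + z)"
proof -
  define w where "w = (\<zeta> - z) / (\<zeta> + z)"
  have nz: "\<zeta> + z \<noteq> 0" "\<zeta> - z \<noteq> 0" "\<zeta> \<noteq> 0"
    using assms by (auto simp: add_eq_0_iff)
  have e: "1 - w = 2 * z / (\<zeta> + z)" "1 + w = 2 * \<zeta> / (\<zeta> + z)"
    using nz by (auto simp: w_def field_simps)
  have "norm (1 - w) < norm (1 + w)" unfolding e using assms nz
    by (simp add: norm_divide norm_mult divide_strict_right_mono)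
  then have Rew: "Re w > 0" using norm_less_reflect by blast
  then have w0: "w \<noteq> 0" by auto
  show ex: "exp (disc_strip \<zeta> z) = (\<zeta> - z) / (\<zeta> + z)" using w0 by (simp add: disc_strip_def w_def)
  show "\<bar>Im (disc_strip \<zeta> z)\<bar> < pi / 2" using Rew w0 Re_Ln_pos_lt[of w] by (simp add: disc_strip_def w_def)
  have "strip_disc \<zeta> (disc_strip \<zeta> z) = \<zeta> * (1 - w) / (1 + w)" by (simp add: strip_disc_def ex w_def)
  also have "\<dots> = z" unfolding e using nz by simp
  finally show "strip_disc \<zeta> (disc_strip \<zeta> z) = z" .
qed

lemma disc_strip_Re_small:
  assumes "norm \<zeta> = 1" "norm z < 1" "dist z \<zeta> < min 1 (exp t)"
  shows "Re (disc_strip \<zeta> z) < t"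
proof -
  have "(\<zeta> + z) + (\<zeta> - z) = 2 * \<zeta>" by simp
  then have "norm (2 * \<zeta>) \<le> norm (\<zeta> + z) + norm (\<zeta> - z)"
    using norm_triangle_ineq[of "\<zeta> + z" "\<zeta> - z"] by simp
  moreover have "norm (2 * \<zeta>) = 2" using assms(1) by (simp add: norm_mult)
  moreover have lt: "norm (\<zeta> - z) < min 1 (exp t)" using assms(3) by (simp add: dist_norm norm_minus_commute)
  ultimately have 1: "1 \<le> norm (\<zeta> + z)" by linarith
  have "exp (Re (disc_strip \<zeta> z)) = norm (\<zeta> - z) / norm (\<zeta> + z)"
    using disc_strip_inverse(3)[OF assms(1,2)] by (metis norm_exp_eq_Re norm_divide)
  also have "\<dots> \<le> norm (\<zeta> - z)" using 1 by (simp add: divide_le_eq mult_le_cancel_left1)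
  also have "\<dots> < exp t" using lt by simp
  finally show ?thesis by simp
qed

lemma continuous_on_disc_strip:
  assumes "norm \<zeta> = 1" shows "continuous_on (ball 0 1) (disc_strip \<zeta>)"
proof -
  have "(\<zeta> - z) / (\<zeta> + z) \<notin> \<real>\<^sub>\<le>\<^sub>0" "\<zeta> + z \<noteq> 0" if "z \<in> ball 0 1" for z
  proof -
    have z: "norm z < 1" using that by simp
    show "\<zeta> + z \<noteq> 0" using assms z by (auto simp: add_eq_0_iff)
    have "Re (exp (disc_strip \<zeta> z)) > 0" using disc_strip_inverse(1)[OF assms z] strip_exp_Re_pos by blast
    then have "Re ((\<zeta> - z) / (\<zeta> + z)) > 0" by (simp only: disc_strip_inverse(3)[OF assms z])
    then show "(\<zeta> - z) / (\<zeta> + z) \<notin> \<real>\<^sub>\<le>\<^sub>0" by (simp add: complex_nonpos_Reals_iff)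
  qed
  then show ?thesis unfolding disc_strip_def by (intro continuous_intros) auto
qed

lemma inj_on_strip_disc:
  assumes "norm \<zeta> = 1" shows "inj_on (strip_disc \<zeta>) {u. \<bar>Im u\<bar> < pi / 2}"
proof (rule inj_onI)
  fix u v assume uv: "u \<in> {u. \<bar>Im u\<bar> < pi / 2}" "v \<in> {u. \<bar>Im u\<bar> < pi / 2}" "strip_disc \<zeta> u = strip_disc \<zeta> v"
  have nz: "1 + exp u \<noteq> 0" "1 + exp v \<noteq> 0" "\<zeta> \<noteq> 0" using strip_exp_nz uv assms by auto
  have "(1 - exp u) * (1 + exp v) = (1 - exp v) * (1 + exp u)"
  proof -
    have "\<zeta> * (1 - exp u) * (1 + exp v) = \<zeta> * (1 - exp v) * (1 + exp u)"
      using uv(3) frac_eq_eq[OF nz(1,2)] by (simp only: strip_disc_def)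
    then show ?thesis using nz(3) mult_cancel_left[of \<zeta>] unfolding mult.assoc by blast
  qed
  then have "exp u = exp v" by (simp add: algebra_simps)
  moreover have "\<bar>Im u - Im v\<bar> < 2 * pi" using uv(1,2) by auto
  ultimately show "u = v" using exp_complex_eqI by blast
qed

context exterior_map
begin

text \<open>By the length-area estimate there are crosscuts \<open>Re u = s n\<close> converging to \<open>\<zeta>\<close> with images of
  small diameter; along a subsequence they converge to a point \<open>p\<close>.  If \<open>\<Phi>\<close> had another cluster
  value \<open>w\<close>, take a neighbourhood \<open>N\<close> of \<open>w\<close> away from \<open>p\<close> with connected trace.  Its preimage is
  connected and accumulates at \<open>\<zeta>\<close>, so it crosses all but finitely many of the crosscuts, although
  these are mapped close to \<open>p\<close>.\<close>

lemma boundary_limit_exists: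
  assumes nb: "\<And>w. w \<in> frontier K \<Longrightarrow> connected_nbhds (- K) w" and \<zeta>: "norm \<zeta> = 1"
  shows "\<exists>p. (\<Phi> \<longlongrightarrow> p) (at \<zeta> within ball 0 1)"
proof -
  \<comment> \<open>To the left of \<open>T\<close> the strip is mapped into the annulus where \<open>\<Phi>\<close> is bounded.\<close>
  define T where "T = ln ((1 - \<rho>) / 2)"
  have eT: "2 * exp T = 1 - \<rho>" using \<rho> by (simp add: T_def)
  define S where "S = {u. Re u < T \<and> \<bar>Im u\<bar> < pi / 2}"
  have L_S: "\<rho> \<le> norm (strip_disc \<zeta> u)" "norm (strip_disc \<zeta> u) < 1" "strip_disc \<zeta> u \<in> ball 0 1 - {z0}" if "u \<in> S" for u
  proof -
    have u: "\<bar>Im u\<bar> < pi / 2" "Re u < T" using that by (auto simp: S_def)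
    have "norm (strip_disc \<zeta> u - \<zeta>) \<le> 2 * exp (Re u)" using strip_disc_dist[OF \<zeta> u(1)] .
    also have "\<dots> < 2 * exp T" using u(2) by simp
    finally have "norm (strip_disc \<zeta> u - \<zeta>) < 1 - \<rho>" by (simp only: eT)
    then show 1: "\<rho> \<le> norm (strip_disc \<zeta> u)"
      using \<zeta> norm_triangle_ineq3[of "strip_disc \<zeta> u" \<zeta>] by linarith
    show 2: "norm (strip_disc \<zeta> u) < 1" using strip_disc_norm[OF \<zeta> u(1)] .
    show "strip_disc \<zeta> u \<in> ball 0 1 - {z0}" using 1 2 \<rho>(2) by auto
  qed
  define F where "F = (\<lambda>u. \<Phi> (strip_disc \<zeta> u))"
  have holF: "F holomorphic_on S"
  proof -
    have "strip_disc \<zeta> holomorphic_on S" unfolding strip_disc_def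
      using strip_exp_nz by (intro holomorphic_intros) (auto simp: S_def)
    moreover have "strip_disc \<zeta> ` S \<subseteq> ball 0 1 - {z0}" using L_S(3) by blast
    ultimately show ?thesis unfolding F_def
      using holomorphic_on_compose_gen[OF _ hol\<Phi>, of "strip_disc \<zeta>" S] by (simp add: o_def)
  qed
  have injF: "inj_on F S"
  proof (rule inj_onI)
    fix u v assume uv: "u \<in> S" "v \<in> S" "F u = F v"
    then have "strip_disc \<zeta> u = strip_disc \<zeta> v" using \<Psi>\<Phi> L_S(3) unfolding F_def by metis
    then show "u = v" using inj_on_strip_disc[OF \<zeta>] uv(1,2) by (auto simp: S_def inj_on_def)
  qed
  have bF: "F ` S \<subseteq> cball 0 B" using bound L_S by (auto simp: F_def)
  have "\<exists>s. s < - real n \<and> s < T \<and> (\<forall>u v. Re u = s \<longrightarrow> Re v = s \<longrightarrow> \<bar>Im u\<bar> < pi/2 \<longrightarrow> \<bar>Im v\<bar> < pi/2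
      \<longrightarrow> dist (F u) (F v) \<le> 1 / (real n + 1))" for n
  proof -
    obtain s where "s < - real n" "s < T"
      "\<And>u v. Re u = s \<Longrightarrow> Re v = s \<Longrightarrow> \<bar>Im u\<bar> < pi/2 \<Longrightarrow> \<bar>Im v\<bar> < pi/2 \<Longrightarrow> dist (F u) (F v) \<le> 1 / (real n + 1)"
      by (rule short_image_segment[of F T "pi/2" B "1 / (real n + 1)" "- real n"])
        (use holF injF bF in \<open>auto simp: S_def\<close>)
    then show ?thesis by blast
  qed
  then obtain s where s: "\<And>n. s n < - real n" "\<And>n. s n < T"
    "\<And>n u v. Re u = s n \<Longrightarrow> Re v = s n \<Longrightarrow> \<bar>Im u\<bar> < pi/2 \<Longrightarrow> \<bar>Im v\<bar> < pi/2 \<Longrightarrow> dist (F u) (F v) \<le> 1 / (real n + 1)"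
    by metis
  define q where "q = (\<lambda>n. F (complex_of_real (s n)))"
  have "\<forall>n. q n \<in> cball 0 B" using bF s(2) by (auto simp: q_def S_def image_subset_iff)
  then obtain p r where r: "strict_mono r" "(q \<circ> r) \<longlonglongrightarrow> p"
    using seq_compactE[OF compact_imp_seq_compact[OF compact_cball]] by metis
  have near: "\<exists>n0. \<forall>n\<ge>n0. \<forall>u. Re u = s (r n) \<longrightarrow> \<bar>Im u\<bar> < pi/2 \<longrightarrow> dist (F u) p < e" if e: "e > 0" for e
  proof -
    have "\<forall>\<^sub>F n in sequentially. dist ((q \<circ> r) n) p < e / 2" using r(2) e by (auto dest!: tendstoD[of _ _ _ "e/2"])
    moreover have "\<forall>\<^sub>F n in sequentially. 1 / (real n + 1) < e / 2"
      using order_tendstoD(2)[OF LIMSEQ_one_over_Suc half_gt_zero[OF e]] .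
    ultimately have "\<forall>\<^sub>F n in sequentially. dist ((q \<circ> r) n) p < e / 2 \<and> 1 / (real n + 1) < e / 2" by (rule eventually_conj)
    then obtain n0 where n0: "\<And>n. n \<ge> n0 \<Longrightarrow> dist ((q \<circ> r) n) p < e / 2 \<and> 1 / (real n + 1) < e / 2"
      by (auto simp: eventually_sequentially)
    have "dist (F u) p < e" if n: "n \<ge> n0" and u: "Re u = s (r n)" "\<bar>Im u\<bar> < pi/2" for n u
    proof -
      have "r n \<ge> n" using r(1) seq_suble by blast
      then have "dist (F u) (q (r n)) \<le> 1 / (real (r n) + 1)" unfolding q_def using u by (intro s(3)) auto
      also have "\<dots> \<le> 1 / (real n + 1)" using \<open>r n \<ge> n\<close> by (intro divide_left_mono) auto
      also have "\<dots> < e / 2" using n0[OF n] by simp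
      finally show ?thesis using n0[OF n] dist_triangle[of "F u" p "q (r n)"] by simp
    qed
    then show ?thesis by blast
  qed
  have "(\<Phi> \<longlongrightarrow> p) (at \<zeta> within ball 0 1)"
  proof (rule ccontr)
    assume "\<not> (\<Phi> \<longlongrightarrow> p) (at \<zeta> within ball 0 1)"
    then obtain e where e: "e > 0" "\<And>d. d > 0 \<Longrightarrow> \<exists>z\<in>ball 0 1. dist z \<zeta> < d \<and> e \<le> dist (\<Phi> z) p"
      unfolding tendsto_iff eventually_at by (metis not_le)
    have "\<exists>z. z \<in> ball 0 1 \<and> dist z \<zeta> < min (1 - \<rho>) (1 / (real n + 1)) \<and> e \<le> dist (\<Phi> z) p" for n
      using e(2)[of "min (1 - \<rho>) (1 / (real n + 1))"] \<rho> by auto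
    then obtain z where z: "\<And>n. z n \<in> ball 0 1 \<and> dist (z n) \<zeta> < min (1 - \<rho>) (1 / (real n + 1)) \<and> e \<le> dist (\<Phi> (z n)) p"
      by metis
    have z\<rho>: "\<rho> \<le> norm (z n)" for n
      using z[of n] \<zeta> norm_triangle_ineq3[of "z n" \<zeta>] by (simp add: dist_norm)
    have zb: "z n \<in> ball 0 1 - {z0}" for n using z[of n] z\<rho>[of n] \<rho>(2) by auto
    have "\<forall>n. \<Phi> (z n) \<in> cball 0 B" using bound z\<rho> z by auto
    then obtain w k where k: "strict_mono k" "((\<lambda>n. \<Phi> (z n)) \<circ> k) \<longlonglongrightarrow> w"
      using seq_compactE[OF compact_imp_seq_compact[OF compact_cball]] by metis
    have "z \<longlonglongrightarrow> \<zeta>" by (rule LIMSEQ_if_dist_less) (use z in auto)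
    then have zk: "(z \<circ> k) \<longlonglongrightarrow> \<zeta>" using k(1) LIMSEQ_subseq_LIMSEQ by blast
    have "e \<le> dist w p"
      by (rule LIMSEQ_le_const[OF tendsto_dist[OF k(2) tendsto_const]]) (use z in auto)
    have wK: "w \<in> frontier K"
      by (rule cluster_in_frontier[of "z \<circ> k" \<zeta> w]) (use zb zk \<zeta> k(2) in \<open>auto simp: o_def\<close>)
    obtain N where N: "open N" "w \<in> N" "N \<subseteq> ball w (e/2)" "connected (N \<inter> - K)"
      by (rule connected_nbhdsE[OF nb[OF wK] half_gt_zero[OF e(1)]])
    define Q where "Q = (\<lambda>v. Re (disc_strip \<zeta> (\<Psi> v))) ` (N \<inter> - K)"
    have "continuous_on (N \<inter> - K) (\<lambda>v. disc_strip \<zeta> (\<Psi> v))"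
    proof (rule continuous_on_compose2[OF continuous_on_disc_strip[OF \<zeta>]])
      show "continuous_on (N \<inter> - K) \<Psi>" by (rule continuous_on_subset[OF cont\<Psi>]) auto
      show "\<Psi> ` (N \<inter> - K) \<subseteq> ball 0 1" using \<Psi>_in by blast
    qed
    then have "continuous_on (N \<inter> - K) (\<lambda>v. Re (disc_strip \<zeta> (\<Psi> v)))" by (rule continuous_on_Re)
    then have connQ: "connected Q" unfolding Q_def using N(4) connected_continuous_image by blast
    obtain n0 where n0: "\<And>n u. n \<ge> n0 \<Longrightarrow> Re u = s (r n) \<Longrightarrow> \<bar>Im u\<bar> < pi/2 \<Longrightarrow> dist (F u) p < e / 2"
      using near[of "e/2"] e(1) by auto
    have sQ: "s (r n) \<notin> Q" if "n \<ge> n0" for n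
    proof
      assume "s (r n) \<in> Q"
      then obtain v where v: "v \<in> N" "v \<notin> K" "Re (disc_strip \<zeta> (\<Psi> v)) = s (r n)" by (auto simp: Q_def)
      have "norm (\<Psi> v) < 1" using \<Psi>_in[OF v(2)] by simp
      note ds = disc_strip_inverse[OF \<zeta> this]
      have "F (disc_strip \<zeta> (\<Psi> v)) = v" using ds(2) \<Phi>\<Psi>[OF v(2)] by (simp add: F_def)
      then have "dist v p < e / 2" using n0[OF that v(3) ds(1)] by simp
      moreover have "dist w v < e / 2" using N(3) v(1) by auto
      ultimately show False using \<open>e \<le> dist w p\<close> dist_triangle[of w p v] by simp
    qed
    have "\<forall>\<^sub>F n in sequentially. \<Phi> (z (k n)) \<in> N" using topological_tendstoD[OF k(2) N(1,2)] by (simp add: o_def)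
    then obtain n1 where n1: "\<And>n. n \<ge> n1 \<Longrightarrow> \<Phi> (z (k n)) \<in> N" by (auto simp: eventually_sequentially)
    have ds\<Phi>: "Re (disc_strip \<zeta> (z (k n))) \<in> Q" if "n \<ge> n1" for n
      unfolding Q_def using n1[OF that] \<Phi>_notin[OF zb] \<Psi>\<Phi>[OF zb] by (intro image_eqI[of _ _ "\<Phi> (z (k n))"]) auto
    have low: "\<exists>n\<ge>n1. Re (disc_strip \<zeta> (z (k n))) < t" for t
    proof -
      have "\<forall>\<^sub>F n in sequentially. dist ((z \<circ> k) n) \<zeta> < min 1 (exp t)"
        using tendstoD[OF zk, of "min 1 (exp t)"] by simp
      then obtain n2 where "\<And>n. n \<ge> n2 \<Longrightarrow> dist (z (k n)) \<zeta> < min 1 (exp t)" by (auto simp: eventually_sequentially)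
      then have "Re (disc_strip \<zeta> (z (k (max n1 n2)))) < t" using z by (intro disc_strip_Re_small[OF \<zeta>]) auto
      then show ?thesis by (intro exI[of _ "max n1 n2"]) auto
    qed
    define t0 where "t0 = Re (disc_strip \<zeta> (z (k n1)))"
    have t0: "t0 \<in> Q" using ds\<Phi>[of n1] by (simp add: t0_def)
    obtain m :: nat where m: "- t0 < real m" using reals_Archimedean2 by blast
    define m' where "m' = max m n0"
    have "s (r m') < - real (r m')" by (rule s(1))
    moreover have "r m' \<ge> m" using r(1) seq_suble[of r m'] by (simp add: m'_def)
    ultimately have "s (r m') < t0" using m by linarith
    moreover obtain n where "n \<ge> n1" "Re (disc_strip \<zeta> (z (k n))) < s (r m')" using low by blast
    ultimately have "s (r m') \<in> Q"
      using connQ t0 ds\<Phi> unfolding connected_iff_interval by (meson less_imp_le)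
    then show False using sQ[of m'] by (simp add: m'_def)
  qed
  then show ?thesis by blast
qed

end

section \<open>The boundary of a continuum as a Jordan curve\<close>

text \<open>Finitely many rotations of the arc cover the circle.  The product of the correspondingly rotated
  copies of \<open>P\<close> vanishes on the whole circle, and hence in the disc by the maximum principle; but
  unless \<open>P\<close> vanishes, each factor has only finitely many zeros in a smaller disc.\<close>

lemma vanishing_on_boundary_arc:
  fixes P :: "complex \<Rightarrow> complex"
  assumes cont: "continuous_on (cball 0 1) P" and hol: "P holomorphic_on ball 0 1"
    and c: "norm c = 1" and d: "d > 0"
    and zero: "\<And>z. norm z = 1 \<Longrightarrow> dist z c < d \<Longrightarrow> P z = 0"
    and x: "x \<in> ball 0 1"
  shows "P x = 0"
proof (rule ccontr)
  assume Px: "P x \<noteq> 0"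
  define O' where "O' = (\<lambda>y::complex. {z. dist (c / y * z) c < d})"
  have oO: "open (O' y)" for y unfolding O'_def
    by (intro open_Collect_less continuous_intros)
  have cov: "sphere 0 1 \<subseteq> (\<Union>y\<in>sphere 0 1. O' y)"
  proof
    fix y :: complex assume y: "y \<in> sphere 0 1"
    then have "y \<noteq> 0" by auto
    then have "y \<in> O' y" using d by (simp add: O'_def)
    then show "y \<in> (\<Union>y\<in>sphere 0 1. O' y)" using y by blast
  qed
  obtain Y where Y: "Y \<subseteq> sphere 0 1" "finite Y" "sphere 0 1 \<subseteq> (\<Union>y\<in>Y. O' y)"
    by (rule compactE_image[OF compact_sphere oO cov])
  have rot: "norm (c / y) = 1" if "y \<in> Y" for y using Y(1) that c by (auto simp: norm_divide)
  define G where "G = (\<lambda>z. \<Prod>y\<in>Y. P (c / y * z))"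
  have nr: "norm (c / y * z) = norm z" if "y \<in> Y" for y z
    using rot[OF that] by (simp only: norm_mult mult_1)
  have contG: "continuous_on (cball 0 1) G" unfolding G_def
  proof (rule continuous_on_prod)
    fix y assume y: "y \<in> Y"
    show "continuous_on (cball 0 1) (\<lambda>z. P (c / y * z))"
    proof (rule continuous_on_compose2[OF cont])
      show "continuous_on (cball 0 1) (\<lambda>z. c / y * z)" by (intro continuous_intros)
      show "(\<lambda>z. c / y * z) ` cball 0 1 \<subseteq> cball 0 1"
        using nr[OF y] by (simp only: image_subset_iff mem_cball_0) simp
    qed
  qed
  have holP: "(\<lambda>z. P (c / y * z)) holomorphic_on ball 0 1" if "y \<in> Y" for y
  proof -
    have "(P \<circ> (\<lambda>z. c / y * z)) holomorphic_on ball 0 1"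
    proof (rule holomorphic_on_compose_gen[OF _ hol])
      show "(\<lambda>z. c / y * z) holomorphic_on ball 0 1" by (intro holomorphic_intros)
      show "(\<lambda>z. c / y * z) ` ball 0 1 \<subseteq> ball 0 1"
        using nr[OF that] by (simp only: image_subset_iff mem_ball_0) simp
    qed
    then show ?thesis by (simp add: o_def)
  qed
  have holG: "G holomorphic_on ball 0 1" unfolding G_def by (intro holomorphic_on_prod holP)
  have G0: "G z = 0" if z: "norm z = 1" for z
  proof -
    obtain y where y: "y \<in> Y" "z \<in> O' y" using Y(3) z by auto
    have "norm (c / y * z) = 1" using rot[OF y(1)] z by (simp only: norm_mult)
    then have "P (c / y * z) = 0" using zero y(2) by (simp add: O'_def)
    then show ?thesis unfolding G_def using y(1) Y(2) by (intro prod_zero) auto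
  qed
  have G00: "G z = 0" if z: "z \<in> ball 0 1" for z
  proof -
    have "norm (G z) \<le> 0"
    proof (rule maximum_modulus_frontier[of G "cball 0 1" 0 z])
      show "G holomorphic_on interior (cball 0 1)" using holG by simp
      show "continuous_on (closure (cball 0 1)) G" using contG by simp
      show "bounded (cball (0::complex) 1)" by simp
      show "norm (G w) \<le> 0" if "w \<in> frontier (cball 0 1)" for w using that G0 by simp
      show "z \<in> cball 0 1" using z by simp
    qed
    then show ?thesis by simp
  qed
  have fin: "finite {z \<in> cball 0 (1/2). P (c / y * z) = 0}" if y: "y \<in> Y" for y
  proof (rule holomorphic_compact_finite_zeros[OF holP[OF y]])
    have rn: "norm (c / y) = 1" "c / y \<noteq> 0" using rot[OF y] by auto
    show "\<not> (\<lambda>z. P (c / y * z)) constant_on ball 0 1"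
    proof
      assume "(\<lambda>z. P (c / y * z)) constant_on ball 0 1"
      then obtain k where k: "\<And>z. z \<in> ball 0 1 \<Longrightarrow> P (c / y * z) = k" unfolding constant_on_def by blast
      have Pk: "P z = k" if "z \<in> ball 0 1" for z
      proof -
        have "z / (c / y) \<in> ball 0 1" using that rn(1) by (simp only: mem_ball_0 norm_divide[of z "c/y"] div_by_1)
        then have "P (c / y * (z / (c / y))) = k" by (rule k)
        moreover have "w * (z / w) = z" if "w \<noteq> 0" for w using that by simp
        ultimately show ?thesis using rn(2) by metis
      qed
      have "P x = k" using Pk x by blast
      moreover have "P c = k"
      proof -
        have "continuous_on (closure (ball 0 1)) P" using cont by simp
        moreover have "c \<in> closure (ball (0::complex) 1)" using c by simp
        ultimately show ?thesis using continuous_constant_on_closure[of "ball 0 1" P k c] Pk by simp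
      qed
      moreover have "P c = 0" using zero[of c] c d by simp
      ultimately show False using Px by simp
    qed
  qed auto
  have "cball 0 (1/2) \<subseteq> (\<Union>y\<in>Y. {z \<in> cball 0 (1/2). P (c / y * z) = 0})"
  proof
    fix z :: complex assume z: "z \<in> cball 0 (1/2)"
    then have "G z = 0" by (intro G00) auto
    then obtain y where "y \<in> Y" "P (c / y * z) = 0" using Y(2) by (auto simp: G_def)
    then show "z \<in> (\<Union>y\<in>Y. {z \<in> cball 0 (1/2). P (c / y * z) = 0})" using z by auto
  qed
  moreover have "finite (\<Union>y\<in>Y. {z \<in> cball 0 (1/2). P (c / y * z) = 0})" using Y(2) fin by blast
  ultimately have "finite (cball (0::complex) (1/2))" using finite_subset by blast
  then show False using uncountable_cball[of "1/2" "0::complex"] uncountable_infinite by auto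
qed

text \<open>A positive multiple of the signed distance of \<open>z\<close> from the line through \<open>a\<close> and \<open>b\<close>.\<close>

definition side :: "complex \<Rightarrow> complex \<Rightarrow> complex \<Rightarrow> real" where
  "side a b z = Im ((z - a) * cnj (b - a))"

lemma side_affine: "side a b ((1 - t) *\<^sub>R x + t *\<^sub>R y) = (1 - t) * side a b x + t * side a b y"
  by (simp add: side_def algebra_simps)

lemma side_ends [simp]: "side a b a = 0" "side a b b = 0"
  by (simp_all add: side_def algebra_simps)

text \<open>A line through two points of the unit circle meets the closed disc exactly in the chord.\<close>

lemma side_zero_cball:
  assumes "norm a = 1" "norm b = 1" "a \<noteq> b" "norm z \<le> 1" "side a b z = 0"
  obtains t where "0 \<le> t" "t \<le> 1" "z = (1 - t) *\<^sub>R a + t *\<^sub>R b" "norm z = 1 \<longrightarrow> z = a \<or> z = b"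
proof -
  define t where "t = Re ((z - a) * cnj (b - a)) / (norm (b - a))\<^sup>2"
  have nz: "(norm (b - a))\<^sup>2 > 0" using assms(3) by simp
  have "(z - a) * cnj (b - a) = of_real (t * (norm (b - a))\<^sup>2)"
    using assms(5) nz by (auto simp: side_def complex_eq_iff t_def)
  also have "\<dots> = of_real t * (b - a) * cnj (b - a)" by (simp only: of_real_mult complex_norm_square mult.assoc)
  finally have "z - a = of_real t * (b - a)" using assms(3) by simp
  then have z: "z = (1 - t) *\<^sub>R a + t *\<^sub>R b" by (simp add: scaleR_conv_of_real algebra_simps)
  have "(norm z)\<^sup>2 = 1 - t * (1 - t) * (norm (b - a))\<^sup>2"
  proof -
    have "a \<bullet> a = 1" "b \<bullet> b = 1" using assms by (simp_all add: dot_square_norm)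
    then show ?thesis unfolding z power2_norm_eq_inner
      by (simp add: inner_add_left inner_add_right inner_diff_left inner_diff_right inner_commute[of b a] algebra_simps power2_eq_square)
  qed
  moreover have "(norm z)\<^sup>2 \<le> 1" using assms(4) by (simp add: power_le_one)
  ultimately have "0 \<le> t * (1 - t) * (norm (b - a))\<^sup>2" by simp
  then have "0 \<le> t * (1 - t)" using nz by (simp add: zero_le_mult_iff)
  then have "0 \<le> t \<and> t \<le> 1" by (auto simp: zero_le_mult_iff)
  moreover have "z = a \<or> z = b" if "norm z = 1"
  proof -
    have "t * (1 - t) * (norm (b - a))\<^sup>2 = 0" using \<open>(norm z)\<^sup>2 = 1 - t * (1 - t) * (norm (b - a))\<^sup>2\<close> that by simp
    then have "t = 0 \<or> t = 1" using nz by auto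
    then show ?thesis using z by auto
  qed
  ultimately show ?thesis using that z by blast
qed

lemma continuous_on_side: "continuous_on A (side a b)"
  unfolding side_def by (intro continuous_intros)

text \<open>If \<open>a\<close> and \<open>b\<close> are on different sides of the chord \<open>p q\<close>, then the two chords cross, so that \<open>p\<close> and \<open>q\<close> are on different sides of the chord \<open>a b\<close>.\<close>

lemma chords_cross:
  assumes n: "norm a = 1" "norm b = 1" "norm p = 1" "norm q = 1" and "p \<noteq> q"
    and s: "side p q a > 0" "side p q b < 0"
  shows "side a b p * side a b q < 0"
proof -
  have ab: "a \<noteq> b" using s by auto
  define t where "t = side p q a / (side p q a - side p q b)"
  have t: "0 \<le> t" "t \<le> 1" using s by (auto simp: t_def)
  define x where "x = (1 - t) *\<^sub>R a + t *\<^sub>R b"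
  have "side p q x = 0" unfolding x_def side_affine using s by (simp add: t_def field_simps)
  moreover have "norm x \<le> 1"
  proof -
    have "norm x \<le> \<bar>1 - t\<bar> * norm a + \<bar>t\<bar> * norm b" unfolding x_def by (rule norm_triangle_le) simp
    then show ?thesis using n t by simp
  qed
  ultimately obtain r where r: "0 \<le> r" "r \<le> 1" "x = (1 - r) *\<^sub>R p + r *\<^sub>R q"
    using side_zero_cball[OF n(3,4) \<open>p \<noteq> q\<close>, of x] by blast
  have "side a b x = 0" unfolding x_def side_affine by simp
  then have eq: "(1 - r) * side a b p + r * side a b q = 0" unfolding r(3) side_affine .
  have "side p q p = 0" "side p q q = 0" by (auto simp: side_def)
  have np: "side a b p \<noteq> 0"
  proof
    assume "side a b p = 0"
    then have "p = a \<or> p = b" using side_zero_cball[OF n(1,2) ab, of p] n(3) by (metis order_refl)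
    then show False using s \<open>side p q p = 0\<close> by auto
  qed
  have nq: "side a b q \<noteq> 0"
  proof
    assume "side a b q = 0"
    then have "q = a \<or> q = b" using side_zero_cball[OF n(1,2) ab, of q] n(4) by (metis order_refl)
    then show False using s \<open>side p q q = 0\<close> by auto
  qed
  show ?thesis
  proof (rule ccontr)
    assume "\<not> ?thesis"
    then have "(side a b p > 0 \<and> side a b q > 0) \<or> (side a b p < 0 \<and> side a b q < 0)"
      using np nq by (auto simp: mult_less_0_iff)
    moreover have pos: "(1 - r) * x + r * y > 0" if "x > 0" "y > 0" for x y
      using r that by (cases "r = 0") (auto intro: add_nonneg_pos)
    moreover have "(1 - r) * (- side a b p) + r * (- side a b q) = - ((1 - r) * side a b p + r * side a b q)"
      by (simp add: algebra_simps)
    ultimately have "(1 - r) * side a b p + r * side a b q \<noteq> 0"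
      using pos[of "side a b p" "side a b q"] pos[of "- side a b p" "- side a b q"] by fastforce
    then show False using eq by simp
  qed
qed

text \<open>The two points of the circle in the directions perpendicular to the chord are at distance 1 from the centre, whereas the line through \<open>p\<close> and \<open>q\<close> is closer to the centre.\<close>

lemma side_arcs_nonempty:
  assumes n: "norm p = 1" "norm q = 1" "p \<noteq> q"
  obtains a b where "norm a = 1" "norm b = 1" "side p q a > 0" "side p q b < 0"
proof -
  define u where "u = \<i> * (q - p) / of_real (norm (q - p))"
  have nu: "norm u = 1" using n(3) by (simp add: u_def norm_mult norm_divide)
  have "u * cnj (q - p) = \<i> * of_real (norm (q - p))"
  proof -
    have "u * cnj (q - p) = \<i> * ((q - p) * cnj (q - p)) / of_real (norm (q - p))" by (simp add: u_def)
    also have "\<dots> = \<i> * of_real ((norm (q - p))\<^sup>2) / of_real (norm (q - p))" by (simp only: complex_norm_square)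
    also have "\<dots> = \<i> * of_real (norm (q - p))" using n(3) by (simp add: power2_eq_square)
    finally show ?thesis .
  qed
  then have su: "Im (u * cnj (q - p)) = norm (q - p)" by simp
  have "\<bar>Im (p * cnj (q - p))\<bar> < norm (q - p)"
  proof -
    have "p * cnj p = 1" using n(1) by (metis complex_norm_square of_real_1 one_power2)
    then have "Im (p * cnj (q - p)) = Im (p * cnj q)" by (simp add: right_diff_distrib)
    moreover have "(norm (q - p))\<^sup>2 = 2 - 2 * Re (p * cnj q)"
    proof -
      have "(norm (q - p))\<^sup>2 = (norm q)\<^sup>2 + (norm p)\<^sup>2 - 2 * Re (p * cnj q)"
        unfolding cmod_power2 by (simp add: power2_eq_square algebra_simps)
      then show ?thesis using n by simp
    qed
    moreover have "(Re (p * cnj q))\<^sup>2 + (Im (p * cnj q))\<^sup>2 = 1"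
      using n cmod_power2[of "p * cnj q"] by (simp add: norm_mult)
    moreover have "I\<^sup>2 = d - d\<^sup>2 / 4" if "d = 2 - 2 * R" "R\<^sup>2 + I\<^sup>2 = 1" for R I d :: real
    proof -
      have "I\<^sup>2 = 1 - R\<^sup>2" using that(2) by simp
      then show ?thesis unfolding that(1) by (simp add: power2_eq_square field_simps)
    qed
    ultimately have "(Im (p * cnj (q - p)))\<^sup>2 = (norm (q - p))\<^sup>2 - ((norm (q - p))\<^sup>2)\<^sup>2 / 4"
      by metis
    also have "\<dots> < (norm (q - p))\<^sup>2" using n(3) by simp
    finally show ?thesis by (intro power2_less_imp_less[of "\<bar>Im (p * cnj (q - p))\<bar>" "norm (q - p)"]) auto
  qed
  then have "side p q u > 0" "side p q (- u) < 0" using su by (auto simp: side_def left_diff_distrib)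
  then show ?thesis using that[of u "- u"] nu by simp
qed

context exterior_map
begin

text \<open>The boundary function \<open>e\<close> is continuous, and it is onto because \<open>\<Psi>\<close> has limit points.  For
  injectivity, suppose that \<open>e p = e q = w\<close> and look at \<open>P z = (z - z0) * (\<Phi> z - w)\<close>, whose zeros
  are exactly the points of the circle where \<open>e\<close> takes the value \<open>w\<close>.  These do not fill an arc,
  and so there are points \<open>a\<close> and \<open>b\<close> on both arcs between \<open>p\<close> and \<open>q\<close> such that \<open>P\<close> has no zero
  on the chord from \<open>a\<close> to \<open>b\<close>.  The preimage of a connected trace close to \<open>w\<close> misses this chord,
  although it contains points close to \<open>p\<close> and points close to \<open>q\<close>.\<close>

theorem frontier_homeomorphic_circle:
  assumes nb: "\<And>w. w \<in> frontier K \<Longrightarrow> connected_nbhds (- K) w"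
  shows "frontier K homeomorphic sphere (0::complex) 1"
proof -
  obtain e where e: "\<And>\<zeta>. norm \<zeta> = 1 \<Longrightarrow> (\<Phi> \<longlongrightarrow> e \<zeta>) (at \<zeta> within ball 0 1)"
    using boundary_limit_exists[OF nb] by metis
  define H' where "H' = (\<lambda>z. if norm z < 1 then H z else (z - z0) * e z)"
  have lp: "z islimpt ball 0 1" if "z \<in> cball 0 1" for z :: complex
    using that islimpt_ball[of z 0 1] by simp
  have lim: "(H \<longlongrightarrow> H' z) (at z within ball 0 1)" if z: "z \<in> cball 0 1" for z
  proof (cases "norm z < 1")
    case True
    then show ?thesis using holomorphic_on_imp_continuous_on[OF holH]
      by (simp add: H'_def continuous_on_def)
  next
    case False
    then have nz: "norm z = 1" using z by simp
    have "((\<lambda>x. (x - z0) * \<Phi> x) \<longlongrightarrow> (z - z0) * e z) (at z within ball 0 1)"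
      by (intro tendsto_intros e nz)
    moreover have "\<forall>\<^sub>F x in at z within ball 0 1. (x - z0) * \<Phi> x = H x"
    proof -
      have "\<forall>\<^sub>F x in at z within ball 0 1. x \<noteq> z0"
        by (rule eventually_neq_at_within)
      moreover have "\<forall>\<^sub>F x in at z within ball 0 1. x \<in> ball 0 1"
        by (simp add: eventually_at_filter)
      ultimately show ?thesis by eventually_elim (use H_eq in auto)
    qed
    ultimately show ?thesis using False by (simp add: H'_def Lim_transform_eventually)
  qed
  have contH': "continuous_on (cball 0 1) H'"
    by (rule continuous_on_limit_extension[OF lp lim])
  have H'_in: "H' z = H z" if "z \<in> ball 0 1" for z using that by (simp add: H'_def)
  have z0n: "z - z0 \<noteq> 0" if "norm z = 1" for z using that z0 by auto
  have H'_sph: "H' z = (z - z0) * e z" if "norm z = 1" for z using that by (simp add: H'_def)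
  have conte: "continuous_on (sphere 0 1) e"
  proof -
    have "continuous_on (sphere 0 1) (\<lambda>z. H' z / (z - z0))"
      by (intro continuous_intros continuous_on_subset[OF contH']) (use z0n in auto)
    then show ?thesis
      by (rule continuous_on_eq) (use H'_sph z0n in auto)
  qed
  have e_in: "e \<zeta> \<in> frontier K" if \<zeta>: "norm \<zeta> = 1" for \<zeta>
  proof -
    have "\<zeta> islimpt ball 0 1 - {z0}"
    proof -
      have "insert z0 (ball 0 1 - {z0}) = ball 0 1" using z0 by auto
      moreover have "\<zeta> islimpt ball 0 1" using lp[of \<zeta>] \<zeta> by simp
      ultimately show ?thesis by (metis islimpt_insert)
    qed
    then obtain z where z: "\<And>n. z n \<in> ball 0 1 - {z0} - {\<zeta>}" "z \<longlonglongrightarrow> \<zeta>"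
      unfolding islimpt_sequential by auto
    have "(\<lambda>n. \<Phi> (z n)) \<longlonglongrightarrow> e \<zeta>"
      using e[OF \<zeta>] z unfolding tendsto_at_iff_sequentially by (auto simp: o_def)
    then show ?thesis using cluster_in_frontier[of z \<zeta>] z \<zeta> by auto
  qed
  have e_onto: "w \<in> e ` sphere 0 1" if w: "w \<in> frontier K" for w
  proof -
    have "w \<in> closure (- K)" using w by (simp add: frontier_closures)
    then obtain v where v: "\<And>n. v n \<in> - K" "v \<longlonglongrightarrow> w" unfolding closure_sequential by auto
    have "\<forall>n. \<Psi> (v n) \<in> cball 0 1" using \<Psi>_in v(1) by (force simp: less_imp_le)
    then obtain \<zeta> r where r: "\<zeta> \<in> cball 0 1" "strict_mono r" "((\<lambda>n. \<Psi> (v n)) \<circ> r) \<longlonglongrightarrow> \<zeta>"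
      using seq_compactE[OF compact_imp_seq_compact[OF compact_cball]] by metis
    have 1: "(\<lambda>n. H' (\<Psi> (v (r n)))) \<longlonglongrightarrow> H' \<zeta>"
      using continuous_on_tendsto_compose[OF contH' r(3)[unfolded o_def] r(1)] \<Psi>_in v(1) by (auto simp: less_imp_le)
    have "H' (\<Psi> (v (r n))) = (\<Psi> (v (r n)) - z0) * v (r n)" for n
      using H'_in H_eq[OF \<Psi>_in] \<Phi>\<Psi> \<Psi>_in v(1) by auto
    moreover have "(\<lambda>n. (\<Psi> (v (r n)) - z0) * v (r n)) \<longlonglongrightarrow> (\<zeta> - z0) * w"
      using r(3) LIMSEQ_subseq_LIMSEQ[OF v(2) r(2)] by (intro tendsto_intros) (auto simp: o_def)
    ultimately have eq: "H' \<zeta> = (\<zeta> - z0) * w" using 1 LIMSEQ_unique by auto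
    have "w \<in> K" using w K compact_imp_closed frontier_subset_closed by blast
    have "norm \<zeta> = 1"
    proof (rule ccontr)
      assume "norm \<zeta> \<noteq> 1"
      then have \<zeta>: "\<zeta> \<in> ball 0 1" using r(1) by simp
      show False
      proof (cases "\<zeta> = z0")
        case True then show False using eq H'_in[OF \<zeta>] H0 by simp
      next
        case False
        then have "\<Phi> \<zeta> = w" using eq H'_in[OF \<zeta>] H_eq[of \<zeta>] \<zeta> by simp
        then show False using \<Phi>_notin[of \<zeta>] \<zeta> False \<open>w \<in> K\<close> by auto
      qed
    qed
    then have "e \<zeta> = w" using eq H'_sph z0n by simp
    then show ?thesis using \<open>norm \<zeta> = 1\<close> by auto
  qed
  have inje: "inj_on e (sphere 0 1)"
  proof (rule inj_onI, rule ccontr)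
    fix p q assume pq: "p \<in> sphere 0 1" "q \<in> sphere 0 1" "e p = e q" "p \<noteq> q"
    define w where "w = e p"
    have n: "norm p = 1" "norm q = 1" using pq by auto
    have wK: "w \<in> frontier K" using e_in[OF n(1)] by (simp add: w_def)
    then have "w \<in> K" using K compact_imp_closed frontier_subset_closed by blast
    define P where "P = (\<lambda>z. H' z - (z - z0) * w)"
    have contP: "continuous_on (cball 0 1) P" unfolding P_def using contH' by (intro continuous_intros)
    have holP: "P holomorphic_on ball 0 1"
    proof -
      have "(\<lambda>z. H z - (z - z0) * w) holomorphic_on ball 0 1" using holH by (intro holomorphic_intros)
      then show ?thesis by (rule holomorphic_transform) (simp add: P_def H'_in)
    qed
    have P_in: "P z = (z - z0) * (\<Phi> z - w)" if "z \<in> ball 0 1 - {z0}" for z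
      using that H'_in[of z] H_eq[of z] by (simp add: P_def right_diff_distrib)
    have Pn: "P z \<noteq> 0" if "z \<in> ball 0 1" for z
    proof (cases "z = z0")
      case True then show ?thesis using H'_in[OF that] H0 by (simp add: P_def)
    next
      case False
      then show ?thesis using P_in[of z] \<Phi>_notin[of z] that \<open>w \<in> K\<close> by auto
    qed
    have P_sph: "P z = 0 \<longleftrightarrow> e z = w" if "norm z = 1" for z
      using H'_sph[OF that] z0n[OF that] by (simp add: P_def flip: right_diff_distrib)
    have notarc: "\<exists>a. norm a = 1 \<and> a \<in> A \<and> e a \<noteq> w" if A: "open A" "c \<in> A" "norm c = 1" for A c
    proof (rule ccontr)
      assume no: "\<not> ?thesis"
      obtain d where d: "d > 0" "ball c d \<subseteq> A" using A open_contains_ball by blast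
      have "P z = 0" if "norm z = 1" "dist z c < d" for z
        using no d(2) that P_sph by (auto simp: dist_commute subset_iff)
      then have "P 0 = 0" using vanishing_on_boundary_arc[OF contP holP A(3) d(1)] by simp
      then show False using Pn[of 0] by simp
    qed
    obtain a' b' where ab': "norm a' = 1" "norm b' = 1" "side p q a' > 0" "side p q b' < 0"
      using side_arcs_nonempty[OF n pq(4)] .
    have "continuous_on UNIV (side p q)" by (rule continuous_on_side)
    then have "open {z. side p q z > 0}" "open {z. side p q z < 0}"
      by (auto intro!: open_Collect_less continuous_intros)
    then obtain a b where a: "norm a = 1" "side p q a > 0" "e a \<noteq> w" and b: "norm b = 1" "side p q b < 0" "e b \<noteq> w"
      using notarc[of "{z. side p q z > 0}" a'] notarc[of "{z. side p q z < 0}" b'] ab' by auto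
    have ab: "a \<noteq> b" using a b by auto
    have cross: "side a b p * side a b q < 0" using chords_cross[OF a(1) b(1) n pq(4) a(2) b(2)] .
    have seg: "closed_segment a b \<subseteq> cball 0 1" using a b by (intro closed_segment_subset) auto
    have Pseg: "P z \<noteq> 0" if "z \<in> closed_segment a b" for z
    proof (cases "norm z < 1")
      case True then show ?thesis using Pn by simp
    next
      case False
      then have nz: "norm z = 1" using seg that by force
      obtain t where "z = (1 - t) *\<^sub>R a + t *\<^sub>R b" using \<open>z \<in> closed_segment a b\<close> by (auto simp: closed_segment_def)
      then have "side a b z = 0" by (simp add: side_affine)
      then have "z = a \<or> z = b" using side_zero_cball[OF a(1) b(1) ab, of z] nz by (metis order_refl)
      then show ?thesis using P_sph a b by auto
    qed
    obtain z1 where z1: "z1 \<in> closed_segment a b" "\<forall>z\<in>closed_segment a b. norm (P z1) \<le> norm (P z)"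
      using continuous_attains_inf[of "closed_segment a b" "\<lambda>z. norm (P z)"] continuous_on_subset[OF contP seg]
      by (auto intro: continuous_on_norm)
    define c where "c = norm (P z1)"
    have c: "c > 0" using Pseg[OF z1(1)] by (simp add: c_def)
    obtain N where N: "open N" "w \<in> N" "N \<subseteq> ball w (c / 2)" "connected (N \<inter> - K)"
      by (rule connected_nbhdsE[OF nb[OF wK] half_gt_zero[OF c]])
    define Q where "Q = (\<lambda>v. side a b (\<Psi> v)) ` (N \<inter> - K)"
    have "connected Q" unfolding Q_def
    proof (rule connected_continuous_image[OF _ N(4)])
      show "continuous_on (N \<inter> - K) (\<lambda>v. side a b (\<Psi> v))"
        by (rule continuous_on_compose2[OF continuous_on_side[of UNIV]]) (use continuous_on_subset[OF cont\<Psi>] in auto)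
    qed
    have "0 \<notin> Q"
    proof
      assume "0 \<in> Q"
      then obtain v where v: "v \<in> N" "v \<notin> K" "side a b (\<Psi> v) = 0" by (auto simp: Q_def)
      have \<Psi>v: "\<Psi> v \<in> ball 0 1 - {z0}" using \<Psi>_in[OF v(2)] .
      then obtain t where "0 \<le> t" "t \<le> 1" "\<Psi> v = (1 - t) *\<^sub>R a + t *\<^sub>R b"
        using side_zero_cball[OF a(1) b(1) ab _ v(3)] by auto
      then have "\<Psi> v \<in> closed_segment a b" by (auto simp: closed_segment_def)
      then have "c \<le> norm (P (\<Psi> v))" using z1 by (simp add: c_def)
      also have "\<dots> = norm (\<Psi> v - z0) * norm (v - w)" using P_in[OF \<Psi>v] \<Phi>\<Psi>[OF v(2)] by (simp add: norm_mult)
      also have "\<dots> \<le> 2 * norm (v - w)"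
        using \<Psi>v z0 norm_triangle_ineq4[of "\<Psi> v" z0] by (intro mult_right_mono) auto
      also have "\<dots> < c" using v(1) N(3) by (auto simp: dist_norm norm_minus_commute)
      finally show False by simp
    qed
    have sgn: "\<exists>x\<in>Q. x * side a b \<zeta> > 0" if \<zeta>: "norm \<zeta> = 1" "e \<zeta> = w" "side a b \<zeta> \<noteq> 0" for \<zeta>
    proof -
      have "((\<lambda>z. side a b z * side a b \<zeta>) \<longlongrightarrow> side a b \<zeta> * side a b \<zeta>) (at \<zeta> within ball 0 1)"
        using continuous_on_side[of UNIV a b]
        by (intro tendsto_intros) (auto simp: continuous_on_def intro: tendsto_within_subset)
      moreover have "side a b \<zeta> * side a b \<zeta> > 0" using \<zeta>(3) by (auto simp: zero_less_mult_iff linorder_neq_iff)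
      ultimately have "\<forall>\<^sub>F z in at \<zeta> within ball 0 1. side a b z * side a b \<zeta> > 0" by (rule order_tendstoD)
      moreover have "\<forall>\<^sub>F z in at \<zeta> within ball 0 1. \<Phi> z \<in> N"
        using topological_tendstoD[OF e[OF \<zeta>(1)] N(1)] N(2) \<zeta>(2) by simp
      moreover have "\<forall>\<^sub>F z in at \<zeta> within ball 0 1. z \<noteq> z0"
        by (rule eventually_neq_at_within)
      moreover have "\<forall>\<^sub>F z in at \<zeta> within ball 0 1. z \<in> ball 0 1"
        by (simp add: eventually_at_filter)
      ultimately have "\<forall>\<^sub>F z in at \<zeta> within ball 0 1. z \<in> ball 0 1 - {z0} \<and> \<Phi> z \<in> N \<and> side a b z * side a b \<zeta> > 0"
        by eventually_elim auto
      moreover have "at \<zeta> within ball 0 1 \<noteq> bot" using lp[of \<zeta>] \<zeta>(1) by (simp add: trivial_limit_within)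
      ultimately obtain z where z: "z \<in> ball 0 1 - {z0}" "\<Phi> z \<in> N" "side a b z * side a b \<zeta> > 0"
        using eventually_happens by blast
      have "side a b z \<in> Q" unfolding Q_def using z(1,2) \<Phi>_notin[OF z(1)] \<Psi>\<Phi>[OF z(1)]
        by (intro image_eqI[of _ _ "\<Phi> z"]) auto
      then show ?thesis using z(3) by blast
    qed
    have nz: "side a b p \<noteq> 0" "side a b q \<noteq> 0" using cross by auto
    obtain x y where xy: "x \<in> Q" "x * side a b p > 0" "y \<in> Q" "y * side a b q > 0"
      using sgn[OF n(1) _ nz(1)] sgn[OF n(2) _ nz(2)] pq(3) by (auto simp: w_def)
    have "x < 0 \<and> 0 < y \<or> y < 0 \<and> 0 < x"
      using xy cross by (auto simp: zero_less_mult_iff mult_less_0_iff)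
    then have "0 \<in> Q" using \<open>connected Q\<close> xy unfolding connected_iff_interval by (meson less_imp_le)
    then show False using \<open>0 \<notin> Q\<close> by blast
  qed
  have "e ` sphere 0 1 = frontier K" using e_in e_onto by auto
  then have "sphere (0::complex) 1 homeomorphic frontier K"
    using homeomorphic_compact[OF compact_sphere conte _ inje] by blast
  then show ?thesis using homeomorphic_sym by blast
qed

end

section \<open>Compact plane sets with connected complement\<close>

lemma plane_boundary_iff:
  fixes E :: "complex set"
  assumes E: "compact E" "connected (- E)"
  shows "(\<forall>z\<in>frontier E. connected_nbhds (- E) z) \<longleftrightarrow>
    (\<forall>C\<in>components (frontier E). (\<exists>z. C = {z}) \<or> C homeomorphic sphere (0::complex) 1) \<and>
    (\<forall>e>0. finite {C \<in> components (frontier E). e \<le> diameter C})" (is "?L \<longleftrightarrow> ?R1 \<and> ?R2")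
proof
  assume L: ?L
  have ?R2 using finite_large_components[OF E(1)] L by blast
  moreover have ?R1
  proof
    fix C assume "C \<in> components (frontier E)"
    then obtain K where K: "K \<in> components E" "C = frontier K"
      using component_frontier_eq[of E] E by auto
    have compK: "compact K" by (rule compact_components[OF E(1) K(1)])
    have conK: "connected K" "K \<noteq> {}" using K(1) in_components_connected in_components_nonempty by blast+
    have conCK: "connected (- K)" using connected_Compl_component[OF _ E K(1)] by simp
    show "(\<exists>z. C = {z}) \<or> C homeomorphic sphere (0::complex) 1"
    proof (cases "\<exists>k0\<in>K. \<exists>k1\<in>K. k0 \<noteq> k1")
      case True
      then obtain z0 \<Phi> \<Psi> H \<rho> B where em: "exterior_map K z0 \<Phi> \<Psi> H \<rho> B"
        using exterior_map_exists[OF compK conK(1) conCK] by blast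
      have "connected_nbhds (- K) w" if "w \<in> frontier K" for w
        using connected_nbhds_component[OF E(1) K(1) that] L that frontier_component[OF E(1) K(1)] by blast
      then show ?thesis using exterior_map.frontier_homeomorphic_circle[OF em] K(2) by blast
    next
      case False
      then obtain k where "K = {k}" using conK(2) by blast
      then show ?thesis using K(2) by (simp add: frontier_def)
    qed
  qed
  ultimately show "?R1 \<and> ?R2" by blast
next
  assume "?R1 \<and> ?R2"
  then show ?L using connected_nbhds_if_Jordan_components[OF E] by blast
qed

section \<open>Invariance under homeomorphisms\<close>

lemma connected_nbhds_homeomorphism:
  fixes h :: "'a::metric_space \<Rightarrow> 'b::metric_space"
  assumes h: "homeomorphism S T h k" and o: "open S" "open T" and z: "z \<in> S"
    and UV: "h ` (U \<inter> S) = V \<inter> T" and nb: "connected_nbhds U z"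
  shows "connected_nbhds V (h z)"
  unfolding connected_nbhds_def
proof (intro allI impI)
  fix r :: real assume r: "r > 0"
  have conth: "continuous_on S h" using h by (simp add: homeomorphism_def)
  have "open (S \<inter> h -` ball (h z) r)" using continuous_open_preimage[OF conth o(1)] by simp
  moreover have "z \<in> S \<inter> h -` ball (h z) r" using z r by simp
  ultimately obtain d where d: "d > 0" "ball z d \<subseteq> S \<inter> h -` ball (h z) r"
    using open_contains_ball by metis
  obtain N where N: "open N" "z \<in> N" "N \<subseteq> ball z d" "connected (N \<inter> U)"
    by (rule connected_nbhdsE[OF nb d(1)])
  have NS: "N \<subseteq> S" using N(3) d(2) by blast
  have "openin (top_of_set T) (h ` N)"
    using homeomorphism_imp_open_map[OF h open_subset[OF NS N(1)]] .
  then have "open (h ` N)" using o(2) openin_open_trans by blast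
  moreover have "h ` N \<subseteq> ball (h z) r" using N(3) d(2) by blast
  moreover have "h ` N \<inter> V = h ` (N \<inter> U)"
  proof -
    have inj: "inj_on h S" using h by (metis homeomorphism_def inj_on_inverseI)
    have "h ` N \<subseteq> T" using NS h by (auto simp: homeomorphism_def)
    then have "h ` N \<inter> V = h ` N \<inter> h ` (U \<inter> S)" using UV by blast
    also have "\<dots> = h ` (N \<inter> (U \<inter> S))" using inj_on_image_Int[OF inj NS, of "U \<inter> S"] by simp
    also have "N \<inter> (U \<inter> S) = N \<inter> U" using NS by blast
    finally show ?thesis .
  qed
  moreover have "connected (h ` (N \<inter> U))"
  proof (rule connected_continuous_image[OF _ N(4)])
    show "continuous_on (N \<inter> U) h" by (rule continuous_on_subset[OF conth]) (use NS in blast)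
  qed
  ultimately show "\<exists>N. open N \<and> h z \<in> N \<and> N \<subseteq> ball (h z) r \<and> connected (N \<inter> V)"
    using N(2) by (intro exI[of _ "h ` N"]) auto
qed

lemma components_homeomorphic_image:
  assumes h: "homeomorphism A B h k" and C: "C \<in> components A"
  shows "h ` C \<in> components B"
proof -
  have hc: "continuous_on A h" "h ` A = B" "\<And>x. x \<in> A \<Longrightarrow> k (h x) = x"
    and kc: "continuous_on B k" "k ` B = A" "\<And>y. y \<in> B \<Longrightarrow> h (k y) = y"
    using h by (auto simp: homeomorphism_def)
  have CA: "C \<subseteq> A" "C \<noteq> {}" "connected C"
    using C in_components_subset in_components_nonempty in_components_connected by blast+
  have mx: "T = h ` C" if T: "T \<noteq> {}" "T \<subseteq> B" "h ` C \<subseteq> T" "connected T" for T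
  proof -
    have "connected (k ` T)"
      by (rule connected_continuous_image[OF _ T(4)]) (rule continuous_on_subset[OF kc(1) T(2)])
    moreover have "k ` T \<subseteq> A" using image_mono[OF T(2), of k] kc(2) by simp
    moreover have "C \<subseteq> k ` T"
    proof
      fix x assume x: "x \<in> C"
      then have "k (h x) = x" "h x \<in> T" using hc(3) CA T(3) by blast+
      then show "x \<in> k ` T" by (metis imageI)
    qed
    moreover have "C \<inter> k ` T \<noteq> {}" using \<open>C \<subseteq> k ` T\<close> CA(2) by blast
    ultimately have "k ` T = C" using components_maximal[OF C, of "k ` T"] by blast
    moreover have "h ` k ` T = T" using kc(3) T(2) by force
    ultimately show ?thesis by simp
  qed
  have "connected (h ` C)"
    by (rule connected_continuous_image[OF continuous_on_subset[OF hc(1) CA(1)] CA(3)])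
  moreover have "h ` C \<subseteq> B" using image_mono[OF CA(1), of h] hc(2) by simp
  moreover have "h ` C \<noteq> {}" using CA(2) by simp
  ultimately show ?thesis unfolding in_components_maximal using mx by simp
qed

lemma components_homeomorphic_eq:
  assumes h: "homeomorphism A B h k"
  shows "components B = (\<lambda>C. h ` C) ` components A"
proof
  show "(\<lambda>C. h ` C) ` components A \<subseteq> components B" using components_homeomorphic_image[OF h] by blast
  show "components B \<subseteq> (\<lambda>C. h ` C) ` components A"
  proof
    fix D assume D: "D \<in> components B"
    have "k ` D \<in> components A" using components_homeomorphic_image[OF _ D] h homeomorphism_sym by blast
    moreover have "h ` k ` D = D"
    proof -
      have "h (k y) = y" if "y \<in> D" for y
        using h D that in_components_subset by (fastforce simp: homeomorphism_def)
      then show ?thesis by force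
    qed
    ultimately show "D \<in> (\<lambda>C. h ` C) ` components A" by (metis imageI)
  qed
qed

text \<open>Uniform continuity: sets of small diameter have images of small diameter.\<close>

lemma finite_large_continuous_image:
  fixes h :: "'a::metric_space \<Rightarrow> 'b::metric_space"
  assumes A: "compact A" "continuous_on A h" and J: "\<And>C. C \<in> J \<Longrightarrow> C \<subseteq> A"
    and fin: "\<And>e. e > 0 \<Longrightarrow> finite {C \<in> J. e \<le> diameter C}" and e: "e > 0"
  shows "finite {D \<in> (\<lambda>C. h ` C) ` J. e \<le> diameter D}"
proof -
  have "uniformly_continuous_on A h" using A compact_uniformly_continuous by blast
  then obtain d where d: "d > 0" "\<And>x y. x \<in> A \<Longrightarrow> y \<in> A \<Longrightarrow> dist x y < d \<Longrightarrow> dist (h x) (h y) < e / 2"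
    using half_gt_zero[OF e] unfolding uniformly_continuous_on_def by (metis dist_commute)
  have "d \<le> diameter C" if C: "C \<in> J" "e \<le> diameter (h ` C)" for C
  proof (rule ccontr)
    assume "\<not> d \<le> diameter C"
    have bC: "bounded C" using A(1) J[OF C(1)] bounded_subset compact_imp_bounded by blast
    have "compact (h ` A)" using A compact_continuous_image by blast
    then have "bounded (h ` C)" using J[OF C(1)] bounded_subset compact_imp_bounded image_mono by metis
    then obtain x y where xy: "x \<in> C" "y \<in> C" "e / 2 < dist (h x) (h y)"
      using diameter_lower_bounded[of "h ` C" "e / 2"] e C(2) by auto
    have "dist x y < d" using diameter_bounded_bound[OF bC xy(1,2)] \<open>\<not> d \<le> diameter C\<close> by simp
    then show False using d(2)[of x y] xy J[OF C(1)] by auto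
  qed
  then have "{D \<in> (\<lambda>C. h ` C) ` J. e \<le> diameter D} \<subseteq> (\<lambda>C. h ` C) ` {C \<in> J. d \<le> diameter C}" by blast
  then show ?thesis using fin[OF d(1)] finite_subset by blast
qed

text \<open>Replaces the enumeration in the definition by a condition that is visibly invariant under homeomorphisms of compact sets.\<close>

lemma null_diameters_iff:
  fixes J :: "ecomplex set set"
  assumes pos: "\<And>C. C \<in> J \<Longrightarrow> diameter C > 0"
  shows "countable J \<and> null_diameters J \<longleftrightarrow> (\<forall>e>0. finite {C \<in> J. e \<le> diameter C})"
proof
  assume L: "countable J \<and> null_diameters J"
  show "\<forall>e>0. finite {C \<in> J. e \<le> diameter C}"
  proof (intro allI impI)
    fix e :: real assume e: "e > 0"
    show "finite {C \<in> J. e \<le> diameter C}"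
    proof (cases "finite J")
      case False
      then obtain C :: "nat \<Rightarrow> ecomplex set" where C: "bij_betw C UNIV J" "(\<lambda>n. diameter (C n)) \<longlonglongrightarrow> 0"
        using L unfolding null_diameters_def by blast
      obtain n0 where n0: "\<And>n. n \<ge> n0 \<Longrightarrow> diameter (C n) < e"
        using order_tendstoD(2)[OF C(2) e] by (auto simp: eventually_sequentially)
      have "{D \<in> J. e \<le> diameter D} \<subseteq> C ` {..<n0}"
      proof
        fix D assume D: "D \<in> {D \<in> J. e \<le> diameter D}"
        then obtain n where n: "D = C n" using C(1) by (auto simp: bij_betw_def)
        then have "n < n0" using n0[of n] D by (force simp: not_less)
        then show "D \<in> C ` {..<n0}" using n by blast
      qed
      then show ?thesis using finite_subset by blast
    qed simp
  qed
next
  assume R: "\<forall>e>0. finite {C \<in> J. e \<le> diameter C}"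
  have "J = (\<Union>n::nat. {C \<in> J. 1 / (real n + 1) \<le> diameter C})"
  proof -
    have "\<exists>n::nat. 1 / (real n + 1) \<le> diameter C" if "C \<in> J" for C
    proof -
      obtain n :: nat where "1 / diameter C < n" using reals_Archimedean2 by blast
      then have "1 / (real n + 1) \<le> diameter C" using pos[OF that] by (simp add: field_simps)
      then show ?thesis by blast
    qed
    then show ?thesis by blast
  qed
  moreover have "finite {C \<in> J. 1 / (real n + 1) \<le> diameter C}" for n :: nat
    using R[rule_format, of "1 / (real n + 1)"] by simp
  then have "countable {C \<in> J. 1 / (real n + 1) \<le> diameter C}" for n :: nat
    by (rule countable_finite)
  then have "countable (\<Union>n::nat. {C \<in> J. 1 / (real n + 1) \<le> diameter C})" by (intro countable_UN) auto
  ultimately have cJ: "countable J" by simp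
  moreover have "null_diameters J"
  proof (cases "finite J")
    case False
    define C where "C = from_nat_into J"
    have C: "bij_betw C UNIV J" unfolding C_def using bij_betw_from_nat_into[OF cJ False] .
    have "(\<lambda>n. diameter (C n)) \<longlonglongrightarrow> 0"
    proof (rule order_tendstoI)
      fix a :: real assume "a < 0"
      moreover have "diameter (C n) > 0" for n using pos C by (auto simp: bij_betw_def)
      ultimately show "\<forall>\<^sub>F n in sequentially. a < diameter (C n)" by (auto intro!: always_eventually elim: less_trans)
    next
      fix e :: real assume e: "0 < e"
      have "finite (C -` {D \<in> J. e \<le> diameter D})"
        using R e C by (intro finite_vimageI) (auto simp: bij_betw_def)
      then obtain n0 where n0: "\<And>n. n \<in> C -` {D \<in> J. e \<le> diameter D} \<Longrightarrow> n < n0"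
        using finite_nat_set_iff_bounded by metis
      have "diameter (C n) < e" if "n \<ge> n0" for n
        using n0[of n] that C by (force simp: bij_betw_def not_less)
      then show "\<forall>\<^sub>F n in sequentially. diameter (C n) < e" by (auto simp: eventually_sequentially)
    qed
    then show ?thesis unfolding null_diameters_def using C by blast
  qed (simp add: null_diameters_def)
  ultimately show "countable J \<and> null_diameters J" by blast
qed

section \<open>Charts of the extended plane\<close>

lemma stereo_surj:
  assumes "norm x = 1" shows "\<exists>z. stereo z = x"
proof -
  obtain w t where x: "x = (w, t)" by (cases x)
  have n: "(norm w)\<^sup>2 + t\<^sup>2 = 1" using assms by (simp add: x norm_Pair)
  show ?thesis
  proof (cases "t = 1")
    case True
    then show ?thesis using n x by (intro exI[of _ Infty]) simp
  next
    case False
    define z where "z = (1 / (1 - t)) *\<^sub>R w"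
    have "t\<^sup>2 \<le> 1" using n zero_le_power2[of "norm w"] by linarith
    then have t: "t < 1" using False abs_square_le_1[of t] by linarith
    have "(norm w)\<^sup>2 = 1 - t\<^sup>2" using n by simp
    also have "\<dots> = (1 - t) * (1 + t)" by (simp add: power2_eq_square algebra_simps)
    finally have nw: "(norm w)\<^sup>2 = (1 - t) * (1 + t)" .
    have "(norm z)\<^sup>2 = (norm w)\<^sup>2 / (1 - t)\<^sup>2" by (simp add: z_def power_divide)
    then have nz: "(norm z)\<^sup>2 = (1 + t) / (1 - t)" unfolding nw using t by (simp add: power2_eq_square)
    have "1 + (norm z)\<^sup>2 = 2 / (1 - t)" "(norm z)\<^sup>2 - 1 = 2 * t / (1 - t)" unfolding nz using t by (simp_all add: field_simps)
    then have "stereo (Finite z) = x" using t by (simp add: x z_def add.commute)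
    then show ?thesis by blast
  qed
qed

text \<open>The metric of the extended plane is a continuous function of the chordal metric of the sphere, and vice versa.\<close>

lemma stereo_homeomorphism:
  obtains g where "homeomorphism UNIV (sphere 0 1) stereo g"
proof -
  define g where "g = inv stereo"
  have gs: "g (stereo x) = x" for x using inj_stereo by (simp add: g_def)
  have sg: "stereo (g y) = y" if "norm y = 1" for y
    using stereo_surj[OF that] gs by auto
  have chord: "(dist u v)\<^sup>2 = 2 - 2 * (u \<bullet> v)" if "norm u = 1" "norm v = 1" for u v :: "complex \<times> real"
  proof -
    have "u \<bullet> u = 1" "v \<bullet> v = 1" using that by (simp_all add: dot_square_norm)
    then show ?thesis unfolding dist_norm power2_norm_eq_inner
      by (simp add: inner_diff_left inner_diff_right inner_commute[of v u])
  qed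
  have b: "-1 \<le> stereo x \<bullet> stereo y" "stereo x \<bullet> stereo y \<le> 1" for x y
    using Cauchy_Schwarz_ineq2[of "stereo x" "stereo y"] by (auto simp: abs_le_iff)
  have cos_dist: "stereo x \<bullet> stereo y = cos (dist x y)" for x y
    using b[of x y] by (simp add: dist_ecomplex_def cos_arccos)
  have "continuous_on UNIV stereo"
    unfolding continuous_on_eq_continuous_at[OF open_UNIV]
  proof
    fix x :: ecomplex
    have "((\<lambda>y. sqrt (2 - 2 * cos (dist y x))) \<longlongrightarrow> sqrt (2 - 2 * cos (dist x x))) (at x)"
      by (intro tendsto_intros)
    moreover have "sqrt (2 - 2 * cos (dist y x)) = dist (stereo y) (stereo x)" for y
    proof -
      have "2 - 2 * cos (dist y x) = (dist (stereo y) (stereo x))\<^sup>2" by (simp add: chord cos_dist)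
      then show ?thesis by simp
    qed
    ultimately have "((\<lambda>y. dist (stereo y) (stereo x)) \<longlongrightarrow> 0) (at x)" by simp
    then show "isCont stereo x" unfolding isCont_def using tendsto_dist_iff by blast
  qed
  moreover have "continuous_on (sphere 0 1) g"
    unfolding continuous_on_def
  proof
    fix y :: "complex \<times> real" assume y: "y \<in> sphere 0 1"
    have "((\<lambda>v. arccos (v \<bullet> y)) \<longlongrightarrow> arccos (y \<bullet> y)) (at y within sphere 0 1)"
    proof -
      have "continuous_on (sphere 0 1) (\<lambda>v. arccos (v \<bullet> y))"
      proof (rule continuous_on_compose2[OF continuous_on_arccos'])
        show "continuous_on (sphere 0 1) (\<lambda>v. v \<bullet> y)" by (intro continuous_intros)
        show "(\<lambda>v. v \<bullet> y) ` sphere 0 1 \<subseteq> {- 1..1}"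
        proof clarify
          fix a b assume "(a, b) \<in> sphere (0::complex \<times> real) 1"
          then show "(a, b) \<bullet> y \<in> {- 1..1}" using y Cauchy_Schwarz_ineq2[of "(a, b)" y] by (auto simp: abs_le_iff)
        qed
      qed
      then show ?thesis using y unfolding continuous_on_def by blast
    qed
    moreover have "arccos (y \<bullet> y) = 0" using y by (simp add: dot_square_norm)
    ultimately have "((\<lambda>v. arccos (v \<bullet> y)) \<longlongrightarrow> 0) (at y within sphere 0 1)" by simp
    moreover have "\<forall>\<^sub>F v in at y within sphere 0 1. arccos (v \<bullet> y) = dist (g v) (g y)"
      using y sg by (auto simp: eventually_at_filter dist_ecomplex_def intro!: always_eventually)
    ultimately have "((\<lambda>v. dist (g v) (g y)) \<longlongrightarrow> 0) (at y within sphere 0 1)"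
      by (rule Lim_transform_eventually)
    then show "(g \<longlongrightarrow> g y) (at y within sphere 0 1)" using tendsto_dist_iff by blast
  qed
  moreover have "stereo ` UNIV = sphere 0 1"
  proof
    show "sphere 0 1 \<subseteq> stereo ` UNIV"
    proof
      fix y :: "complex \<times> real" assume "y \<in> sphere 0 1"
      then have "stereo (g y) = y" using sg by simp
      then show "y \<in> stereo ` UNIV" by (metis rangeI)
    qed
  qed auto
  moreover have "g ` sphere 0 1 = UNIV"
  proof -
    have "x \<in> g ` sphere 0 1" for x
      by (rule image_eqI[of _ _ "stereo x"]) (simp_all add: gs)
    then show ?thesis by blast
  qed
  ultimately have "homeomorphism UNIV (sphere 0 1) stereo g"
    unfolding homeomorphism_def using gs sg by simp
  then show ?thesis using that by blast
qed

lemma compact_UNIV_ecomplex: "compact (UNIV :: ecomplex set)"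
proof -
  obtain g where "homeomorphism (UNIV :: ecomplex set) (sphere 0 1) stereo g" using stereo_homeomorphism .
  then have "continuous_on (sphere 0 1) g" "g ` sphere 0 1 = UNIV" by (auto simp: homeomorphism_def)
  then show ?thesis using compact_continuous_image[of "sphere 0 1" g] by simp
qed

lemma ecomplex_chart:
  obtains h k where "homeomorphism (UNIV - {p :: ecomplex}) (UNIV :: complex set) h k"
proof -
  obtain g where g: "homeomorphism (UNIV :: ecomplex set) (sphere 0 1) stereo g" using stereo_homeomorphism .
  have "(UNIV - {p}) homeomorphic (sphere 0 1 - {stereo p})"
  proof -
    have "stereo ` (UNIV - {p}) = sphere 0 1 - {stereo p}"
    proof -
      have "stereo ` (UNIV - {p}) = stereo ` UNIV - stereo ` {p}"
        using inj_stereo by (simp add: image_set_diff)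
      then show ?thesis using g by (simp add: homeomorphism_def)
    qed
    then show ?thesis using homeomorphism_of_subsets[OF g, of "UNIV - {p}"] unfolding homeomorphic_def by blast
  qed
  moreover have "(sphere 0 1 - {stereo p}) homeomorphic (UNIV :: complex set)"
    using homeomorphic_punctured_affine_sphere_affine[of 1 "stereo p" 0 UNIV "UNIV :: complex set"] by simp
  ultimately have "(UNIV - {p}) homeomorphic (UNIV :: complex set)" using homeomorphic_trans by blast
  then show ?thesis using that unfolding homeomorphic_def by blast
qed

section \<open>Generalized Jordan domains and connected neighbourhoods\<close>

lemma simply_connected_at_iff: "simply_connected_at U z \<longleftrightarrow> connected_nbhds U z"
  by (simp add: simply_connected_at_def connected_nbhds_def)

text \<open>A chart at a point outside \<open>U\<close> reduces this to open connected subsets of the plane.\<close>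

lemma connected_delete_point:
  fixes U :: "ecomplex set"
  assumes U: "open U" "connected U" and ne: "U \<noteq> UNIV"
  shows "connected (U - {p})"
proof -
  obtain q where q: "q \<notin> U" using ne by blast
  obtain h k where hk: "homeomorphism (UNIV - {q}) (UNIV :: complex set) h k" using ecomplex_chart .
  have Uq: "U \<subseteq> UNIV - {q}" using q by blast
  have ch: "continuous_on (UNIV - {q}) h" and ck: "continuous_on UNIV k"
    and kh: "\<And>x. x \<noteq> q \<Longrightarrow> k (h x) = x"
    using hk by (auto simp: homeomorphism_def)
  have inj: "inj_on h (UNIV - {q})" using kh by (metis DiffD2 inj_on_inverseI singletonI)
  have "open (h ` U)"
    using homeomorphism_imp_open_map[OF hk open_subset[OF Uq U(1)]] by simp
  moreover have "connected (h ` U)"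
    by (rule connected_continuous_image[OF continuous_on_subset[OF ch Uq] U(2)])
  ultimately have "connected (h ` U - {h p})" by (intro connected_open_delete) auto
  then have "connected (k ` (h ` U - {h p}))"
    by (rule connected_continuous_image[OF continuous_on_subset[OF ck], rotated]) simp
  moreover have "k ` (h ` U - {h p}) = U - {p}" if "p \<in> U"
  proof -
    have "h ` U - {h p} = h ` (U - {p})"
      using inj_on_image_set_diff[OF inj, of U "{p}"] Uq that by auto
    then have "k ` (h ` U - {h p}) = (\<lambda>x. k (h x)) ` (U - {p})" by (simp add: image_image)
    also have "\<dots> = (\<lambda>x. x) ` (U - {p})" by (rule image_cong) (use kh Uq in auto)
    finally show ?thesis by simp
  qed
  moreover have "U - {p} = U" if "p \<notin> U" using that by blast
  ultimately show ?thesis using U(2) by metis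
qed

text \<open>The chart at a point \<open>p\<close> of \<open>U\<close> maps the complement of \<open>U\<close> to a compact plane set with connected complement, and both conditions are transported by the chart.\<close>

theorem generalized_Jordan_iff_simply_connected_at_boundary:
  assumes U: "domain U"
  shows "generalized_Jordan_domain U \<longleftrightarrow> simply_connected_at_boundary U"
proof (cases "frontier U = {}")
  case True
  then show ?thesis using U
    by (simp add: generalized_Jordan_domain_def simply_connected_at_boundary_def
        Jordan_boundary_components_def null_diameters_def)
next
  case False
  have oU: "open U" and cU: "connected U" using U by (auto simp: domain_def)
  have ne: "U \<noteq> UNIV" "U \<noteq> {}" using False by auto
  obtain p where p: "p \<in> U" using ne by blast
  obtain h k where hk: "homeomorphism (UNIV - {p}) (UNIV :: complex set) h k" using ecomplex_chart .
  have ch: "continuous_on (UNIV - {p}) h" and him: "h ` (UNIV - {p}) = UNIV" and ck: "continuous_on UNIV k"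
    and kim: "k ` UNIV = UNIV - {p}"
    and kh: "\<And>x. x \<noteq> p \<Longrightarrow> k (h x) = x" and hkk: "\<And>y. h (k y) = y"
    using hk by (auto simp: homeomorphism_def)
  have inj: "inj_on h (UNIV - {p})" using kh by (metis DiffD2 inj_on_inverseI singletonI)
  define E where "E = h ` (- U)"
  have Up: "- U \<subseteq> UNIV - {p}" using p by blast
  have frU: "frontier U \<subseteq> - U" using oU frontier_disjoint_eq by blast
  have compCU: "compact (- U)" using compact_UNIV_ecomplex compact_Int_closed[of UNIV "- U"] oU by (simp add: closed_Compl)
  have compE: "compact E" unfolding E_def
    by (rule compact_continuous_image[OF continuous_on_subset[OF ch Up] compCU])
  have Ec: "- E = h ` (U - {p})"
  proof -
    have "h ` ((UNIV - {p}) - (- U)) = h ` (UNIV - {p}) - h ` (- U)"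
      by (rule inj_on_image_set_diff[OF inj]) (use Up in auto)
    moreover have "(UNIV - {p}) - (- U) = U - {p}" by blast
    ultimately show ?thesis using him by (simp add: E_def Compl_eq_Diff_UNIV)
  qed
  have conE: "connected (- E)" unfolding Ec
    by (rule connected_continuous_image[OF continuous_on_subset[OF ch] connected_delete_point[OF oU cU ne(1)]]) auto
  have frE: "frontier E = h ` frontier U"
  proof -
    have "interior E = h ` interior (- U)"
    proof
      have "openin (top_of_set UNIV) (h ` interior (- U))"
        by (rule homeomorphism_imp_open_map[OF hk open_subset]) (use Up interior_subset in auto)
      then show "h ` interior (- U) \<subseteq> interior E"
        by (intro interior_maximal) (auto simp: E_def interior_subset image_mono)
      have "openin (top_of_set (UNIV - {p})) (k ` interior E)"
        by (rule homeomorphism_imp_open_map[of UNIV "UNIV - {p}" k h]) (use hk homeomorphism_sym in auto)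
      then have "open (k ` interior E)" by (rule openin_open_trans) auto
      moreover have "k ` interior E \<subseteq> - U"
      proof -
        have "k y \<in> - U" if "y \<in> E" for y
        proof -
          obtain x where x: "x \<notin> U" "y = h x" using \<open>y \<in> E\<close> by (auto simp: E_def)
          then have "x \<noteq> p" using p by blast
          then show ?thesis using x kh by simp
        qed
        then show ?thesis using interior_subset[of E] by blast
      qed
      ultimately have "k ` interior E \<subseteq> interior (- U)" by (rule interior_maximal[rotated])
      then have "h ` k ` interior E \<subseteq> h ` interior (- U)" by (rule image_mono)
      then show "interior E \<subseteq> h ` interior (- U)" by (simp add: image_image hkk)
    qed
    moreover have "h ` (- U - interior (- U)) = h ` (- U) - h ` interior (- U)"
      by (rule inj_on_image_set_diff[OF inj]) (use Up interior_subset in auto)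
    moreover have "frontier U = - U - interior (- U)"
      using frontier_complement[of U] oU by (simp add: frontier_def closed_Compl)
    moreover have "frontier E = E - interior E"
      using compact_imp_closed[OF compE] by (simp add: frontier_def)
    ultimately show ?thesis by (simp only: E_def)
  qed
  have frp: "frontier U \<subseteq> UNIV - {p}" using frU Up by blast
  have hf: "homeomorphism (frontier U) (frontier E) h k"
    by (rule homeomorphism_of_subsets[OF hk frp]) (use frE in auto)
  have compF: "compact (frontier U)"
    using compCU frU by (metis closed_Int_compact frontier_closed inf.absorb_iff2 inf_commute)
  have nb_iff: "connected_nbhds (- E) (h z) \<longleftrightarrow> connected_nbhds U z" if z: "z \<in> frontier U" for z
  proof
    have o: "open (UNIV - {p})" by (simp add: open_delete)
    have zp: "z \<in> UNIV - {p}" using z frp by blast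
    have im: "h ` (U \<inter> (UNIV - {p})) = - E \<inter> UNIV" 
    proof -
      have "U \<inter> (UNIV - {p}) = U - {p}" by blast
      then show ?thesis by (simp only: Ec Int_UNIV_right)
    qed
    show "connected_nbhds U z \<Longrightarrow> connected_nbhds (- E) (h z)"
      using connected_nbhds_homeomorphism[OF hk o open_UNIV zp im] .
    have "k ` (- E \<inter> UNIV) = U \<inter> (UNIV - {p})"
    proof -
      have "k ` (- E) = (\<lambda>x. k (h x)) ` (U - {p})" by (simp add: Ec image_image)
      also have "\<dots> = (\<lambda>x. x) ` (U - {p})" by (rule image_cong) (use kh in auto)
      finally show ?thesis by auto
    qed
    from connected_nbhds_homeomorphism[OF homeomorphism_symD[OF hk] open_UNIV o UNIV_I this, of "h z"]
    show "connected_nbhds (- E) (h z) \<Longrightarrow> connected_nbhds U z" using kh[of z] zp by simp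
  qed
  have comps: "components (frontier E) = (\<lambda>C. h ` C) ` components (frontier U)"
    by (rule components_homeomorphic_eq[OF hf])
  have compsU: "components (frontier U) = (\<lambda>C. k ` C) ` components (frontier E)"
    by (rule components_homeomorphic_eq[OF homeomorphism_symD[OF hf]])
  have sub: "C \<subseteq> frontier U" if "C \<in> components (frontier U)" for C using that in_components_subset by blast
  have cC: "compact C" if "C \<in> components (frontier U)" for C
    by (rule compact_components[OF compF that])
  have C_hom: "C homeomorphic h ` C" if "C \<in> components (frontier U)" for C
  proof -
    have "homeomorphism C (h ` C) h k" by (rule homeomorphism_of_subsets[OF hf sub[OF that] subset_refl refl])
    then show ?thesis unfolding homeomorphic_def by blast
  qed
  have Jor: "Jordan_curve C \<longleftrightarrow> h ` C homeomorphic sphere (0::complex) 1" if "C \<in> components (frontier U)" for C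
  proof -
    have "h ` C homeomorphic C" by (rule iffD1[OF homeomorphic_sym C_hom[OF that]])
    then show ?thesis
      unfolding Jordan_curve_def using homeomorphic_trans[OF C_hom[OF that]] homeomorphic_trans[of "h ` C" C] by blast
  qed
  have sing: "(\<exists>z. C = {z}) \<longleftrightarrow> (\<exists>w. h ` C = {w})" if C: "C \<in> components (frontier U)" for C
  proof
    assume "\<exists>w. h ` C = {w}"
    then obtain w where "h ` C = {w}" by blast
    then have "k ` h ` C = {k w}" by simp
    moreover have "k ` h ` C = C"
    proof -
      have "k (h x) = x" if "x \<in> C" for x using kh sub[OF C] frp that by blast
      then show ?thesis by force
    qed
    ultimately show "\<exists>z. C = {z}" by metis
  qed auto
  define \<C> where "\<C> = components (frontier U)"
  have fin_iff: "(\<forall>e>0. finite {C \<in> \<C>. e \<le> diameter C}) \<longleftrightarrow> (\<forall>e>0. finite {C \<in> components (frontier E). e \<le> diameter C})"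
  proof
    assume *: "\<forall>e>0. finite {C \<in> \<C>. e \<le> diameter C}"
    show "\<forall>e>0. finite {C \<in> components (frontier E). e \<le> diameter C}"
      unfolding comps
      using finite_large_continuous_image[OF compF continuous_on_subset[OF ch frp], of \<C>] * sub by (auto simp: \<C>_def)
  next
    assume *: "\<forall>e>0. finite {C \<in> components (frontier E). e \<le> diameter C}"
    have "compact (frontier E)" using compE compact_frontier by blast
    then show "\<forall>e>0. finite {C \<in> \<C>. e \<le> diameter C}"
      unfolding \<C>_def compsU
      using finite_large_continuous_image[of "frontier E" k "components (frontier E)"] * continuous_on_subset[OF ck]
        in_components_subset by blast
  qed
  have pt_or: "generalized_Jordan_domain U \<longleftrightarrow>
     (\<forall>C\<in>\<C>. (\<exists>z. C = {z}) \<or> Jordan_curve C) \<and> (\<forall>e>0. finite {C \<in> \<C>. e \<le> diameter C})"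
  proof (cases "\<forall>C\<in>\<C>. (\<exists>z. C = {z}) \<or> Jordan_curve C")
    case True
    define J where "J = Jordan_boundary_components U"
    have J: "J = {C \<in> \<C>. Jordan_curve C}" by (simp add: J_def \<C>_def Jordan_boundary_components_def)
    have pos: "diameter C > 0" if C: "C \<in> J" for C
    proof -
      have "sphere (0::complex) 1 homeomorphic C" using C homeomorphic_sym by (auto simp: J Jordan_curve_def)
      then obtain f g where fg: "homeomorphism (sphere (0::complex) 1) C f g" unfolding homeomorphic_def by blast
      have "g (f 1) = 1" "g (f (- 1)) = - 1" "f 1 \<in> C" "f (- 1) \<in> C" using fg by (auto simp: homeomorphism_def)
      then obtain x y where xy: "x \<in> C" "y \<in> C" "x \<noteq> y" by (metis one_neq_neg_one)
      have "bounded C" using cC C compact_imp_bounded by (auto simp: J \<C>_def)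
      then have "dist x y \<le> diameter C" using xy diameter_bounded_bound by blast
      then show ?thesis using xy(3) by (metis less_le_trans zero_less_dist_iff)
    qed
    have "{C \<in> J. e \<le> diameter C} = {C \<in> \<C>. e \<le> diameter C}" if "e > 0" for e
    proof -
      have "C \<in> J" if "C \<in> \<C>" "e \<le> diameter C" for C
      proof -
        have "C \<noteq> {z}" for z using that(2) \<open>e > 0\<close> by auto
        then show ?thesis using True that(1) J by blast
      qed
      then show ?thesis using J by blast
    qed
    then have "(\<forall>e>0. finite {C \<in> J. e \<le> diameter C}) \<longleftrightarrow> (\<forall>e>0. finite {C \<in> \<C>. e \<le> diameter C})" by simp
    then show ?thesis using True U null_diameters_iff[of J, OF pos]
      by (auto simp: generalized_Jordan_domain_def J_def \<C>_def)
  next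
    case False
    then show ?thesis by (auto simp: generalized_Jordan_domain_def \<C>_def)
  qed
  have "(\<forall>C\<in>\<C>. (\<exists>z. C = {z}) \<or> Jordan_curve C) \<longleftrightarrow>
      (\<forall>D\<in>components (frontier E). (\<exists>w. D = {w}) \<or> D homeomorphic sphere (0::complex) 1)"
    unfolding comps \<C>_def using sing Jor by simp
  then have "generalized_Jordan_domain U \<longleftrightarrow> (\<forall>w\<in>frontier E. connected_nbhds (- E) w)"
    using pt_or fin_iff plane_boundary_iff[OF compE conE] by simp
  also have "\<dots> \<longleftrightarrow> simply_connected_at_boundary U"
    unfolding simply_connected_at_boundary_def simply_connected_at_iff frE using nb_iff by simp
  finally show ?thesis .
qed

section \<open>Cluster sets\<close>

lemma cluster_set_closedin: "closedin (mtopology_of X) (cluster_set X U f z0)"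
proof -
  interpret Metric_space "mspace X" "mdist X" by simp
  have mt: "mtopology_of X = mtopology" by (simp add: mtopology_of_def)
  define C where "C = cluster_set X U f z0"
  have "C \<subseteq> mspace X" by (auto simp: C_def cluster_set_def)
  moreover have "\<exists>r>0. disjnt C (mball w r)" if w: "w \<in> mspace X - C" for w
  proof (rule ccontr)
    assume no: "\<not> ?thesis"
    have "\<exists>z\<in>U. dist z z0 < 1 / (real n + 1) \<and> f z \<in> mspace X \<and> mdist X (f z) w < 1 / (real n + 1)" for n :: nat
    proof -
      have pos: "1 / (2 * (real n + 1)) > 0" by simp
      then have "\<not> disjnt C (mball w (1 / (2 * (real n + 1))))" using no by blast
      then obtain c where c: "c \<in> C" "c \<in> mball w (1 / (2 * (real n + 1)))" unfolding disjnt_def by blast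
      obtain z where z: "\<And>k. z k \<in> U" "z \<longlonglongrightarrow> z0" "limitin mtopology (\<lambda>k. f (z k)) c sequentially"
        using c(1) by (auto simp: C_def cluster_set_def mt)
      have "\<forall>\<^sub>F k in sequentially. dist (z k) z0 < 1 / (real n + 1)"
        using tendstoD[OF z(2), of "1 / (real n + 1)"] by simp
      moreover have "\<forall>\<^sub>F k in sequentially. f (z k) \<in> mspace X \<and> mdist X (f (z k)) c < 1 / (2 * (real n + 1))"
        using z(3) pos unfolding limitin_metric by blast
      ultimately have "\<forall>\<^sub>F k in sequentially. dist (z k) z0 < 1 / (real n + 1) \<and> f (z k) \<in> mspace X \<and> mdist X (f (z k)) c < 1 / (2 * (real n + 1))"
        by (rule eventually_conj)
      then obtain k where k: "dist (z k) z0 < 1 / (real n + 1)" "f (z k) \<in> mspace X" "mdist X (f (z k)) c < 1 / (2 * (real n + 1))"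
        by (auto simp: eventually_sequentially)
      have "mdist X c w < 1 / (2 * (real n + 1))" using c(2) by (simp add: commute)
      moreover have "c \<in> mspace X" using c(2) by simp
      ultimately have "mdist X (f (z k)) w < 1 / (2 * (real n + 1)) + 1 / (2 * (real n + 1))"
        using triangle[OF k(2), of c w] k(3) w by fastforce
      also have "\<dots> = 1 / (real n + 1)" by (simp add: field_simps)
      finally show ?thesis using k z(1) by blast
    qed
    then obtain z where z: "\<And>n. z n \<in> U" "\<And>n. dist (z n) z0 < 1 / (real n + 1)" "\<And>n. f (z n) \<in> mspace X"
      "\<And>n. mdist X (f (z n)) w < 1 / (real n + 1)" by metis
    have "z \<longlonglongrightarrow> z0" using z(2) by (rule LIMSEQ_if_dist_less)
    moreover have "limitin mtopology (\<lambda>n. f (z n)) w sequentially"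
      unfolding limitin_metric
    proof (intro conjI allI impI)
      show "w \<in> mspace X" using w by blast
      fix e :: real assume "e > 0"
      then have "\<forall>\<^sub>F n in sequentially. 1 / (real n + 1) < e" using order_tendstoD(2)[OF LIMSEQ_one_over_Suc] by blast
      then show "\<forall>\<^sub>F n in sequentially. f (z n) \<in> mspace X \<and> mdist X (f (z n)) w < e"
        by eventually_elim (metis z(3,4) less_trans)
    qed
    ultimately have "w \<in> C" using w z(1) unfolding C_def cluster_set_def mt by blast
    then show False using w by blast
  qed
  ultimately show ?thesis unfolding mt C_def[symmetric] closedin_metric by blast
qed

text \<open>If the cluster set splits, normality gives disjoint open neighbourhoods \<open>V1\<close> and \<open>V2\<close> of the two
  pieces.  By compactness \<open>f\<close> maps all points of \<open>U\<close> near \<open>z0\<close> into \<open>V1 \<union> V2\<close>, and the image of a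
  connected trace meets both.\<close>

lemma connected_cluster_set:
  assumes X: "compact_space (mtopology_of X)" and f: "continuous_map (top_of_set U) (mtopology_of X) f"
    and nb: "connected_nbhds U z0"
  shows "connectedin (mtopology_of X) (cluster_set X U f z0)"
proof -
  interpret Metric_space "mspace X" "mdist X" by simp
  have mt: "mtopology_of X = mtopology" by (simp add: mtopology_of_def)
  define C where "C = cluster_set X U f z0"
  have CM: "C \<subseteq> mspace X" by (auto simp: C_def cluster_set_def)
  have clC: "closedin mtopology C" using cluster_set_closedin[of X U f z0] by (simp add: mt C_def)
  have fU: "f z \<in> mspace X" if "z \<in> U" for z
    using f that by (auto simp: continuous_map_def mt Pi_iff)
  have "\<not> (\<exists>E1 E2. closedin mtopology E1 \<and> closedin mtopology E2 \<and> C \<subseteq> E1 \<union> E2 \<and> E1 \<inter> E2 \<inter> C = {} \<and> E1 \<inter> C \<noteq> {} \<and> E2 \<inter> C \<noteq> {})"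
  proof
    assume "\<exists>E1 E2. closedin mtopology E1 \<and> closedin mtopology E2 \<and> C \<subseteq> E1 \<union> E2 \<and> E1 \<inter> E2 \<inter> C = {} \<and> E1 \<inter> C \<noteq> {} \<and> E2 \<inter> C \<noteq> {}"
    then obtain E1 E2 where E: "closedin mtopology E1" "closedin mtopology E2" "C \<subseteq> E1 \<union> E2" "E1 \<inter> E2 \<inter> C = {}"
      "E1 \<inter> C \<noteq> {}" "E2 \<inter> C \<noteq> {}" by blast
    have "normal_space mtopology" using metrizable_imp_normal_space metrizable_space_mtopology by blast
    moreover have "closedin mtopology (E1 \<inter> C)" "closedin mtopology (E2 \<inter> C)" using E clC by auto
    moreover have "disjnt (E1 \<inter> C) (E2 \<inter> C)" using E(4) by (auto simp: disjnt_def)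
    ultimately obtain V1 V2 where V: "openin mtopology V1" "openin mtopology V2" "E1 \<inter> C \<subseteq> V1" "E2 \<inter> C \<subseteq> V2" "disjnt V1 V2"
      unfolding normal_space_def by meson
    have CV: "C \<subseteq> V1 \<union> V2" using E(3) V(3,4) by blast
    have "\<exists>r>0. \<forall>z\<in>ball z0 r \<inter> U. f z \<in> V1 \<union> V2"
    proof (rule ccontr)
      assume no: "\<not> ?thesis"
      have "\<exists>z\<in>U. dist z z0 < 1 / (real n + 1) \<and> f z \<notin> V1 \<union> V2" for n :: nat
        using no[simplified, rule_format, of "1 / (real n + 1)"] by (auto simp: dist_commute)
      then obtain z where z: "\<And>n. z n \<in> U" "\<And>n. dist (z n) z0 < 1 / (real n + 1)" "\<And>n. f (z n) \<notin> V1 \<union> V2" by metis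
      have zl: "z \<longlonglongrightarrow> z0" using z(2) by (rule LIMSEQ_if_dist_less)
      have "range (\<lambda>n. f (z n)) \<subseteq> mspace X" using fU z(1) by blast
      then obtain w r where w: "w \<in> mspace X" "strict_mono r" "limitin mtopology ((\<lambda>n. f (z n)) \<circ> r) w sequentially"
        using X unfolding mt compact_space_sequentially by blast
      have "(z \<circ> r) \<longlonglongrightarrow> z0" using zl w(2) LIMSEQ_subseq_LIMSEQ by blast
      then have "w \<in> C" unfolding C_def cluster_set_def mt
        using w z(1) by (auto simp: o_def intro!: exI[of _ "z \<circ> r"])
      then have "w \<in> V1 \<union> V2" using CV by blast
      moreover have "openin mtopology (V1 \<union> V2)" using V by blast
      ultimately have "\<forall>\<^sub>F n in sequentially. ((\<lambda>n. f (z n)) \<circ> r) n \<in> V1 \<union> V2"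
        using w(3) unfolding limitin_def by blast
      then show False using z(3) by (auto simp: eventually_sequentially)
    qed
    then obtain r where r: "r > 0" "\<And>z. z \<in> ball z0 r \<inter> U \<Longrightarrow> f z \<in> V1 \<union> V2" by blast
    obtain N where N: "open N" "z0 \<in> N" "N \<subseteq> ball z0 r" "connected (N \<inter> U)"
      by (rule connected_nbhdsE[OF nb r(1)])
    have conn: "connectedin mtopology (f ` (N \<inter> U))"
    proof (rule connectedin_continuous_map_image)
      show "continuous_map (top_of_set U) mtopology f" using f by (simp add: mt)
      show "connectedin (top_of_set U) (N \<inter> U)" using N(4) by (simp add: connectedin_subtopology)
    qed
    have sub: "f ` (N \<inter> U) \<subseteq> V1 \<union> V2" using r(2) N(3) by blast
    have hit: "f ` (N \<inter> U) \<inter> V \<noteq> {}" if V: "openin mtopology V" "C \<inter> V \<noteq> {}" for V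
    proof -
      obtain c where c: "c \<in> C" "c \<in> V" using V(2) by blast
      obtain z where z: "\<And>k. z k \<in> U" "z \<longlonglongrightarrow> z0" "limitin mtopology (\<lambda>k. f (z k)) c sequentially"
        using c(1) by (auto simp: C_def cluster_set_def mt)
      have "\<forall>\<^sub>F k in sequentially. f (z k) \<in> V" using z(3) V(1) c(2) unfolding limitin_def by blast
      moreover have "\<forall>\<^sub>F k in sequentially. z k \<in> N" using topological_tendstoD[OF z(2) N(1,2)] .
      ultimately have "\<forall>\<^sub>F k in sequentially. f (z k) \<in> V \<and> z k \<in> N" by (rule eventually_conj)
      then obtain k where "f (z k) \<in> V" "z k \<in> N" by (auto simp: eventually_sequentially)
      then show ?thesis using z(1) by blast
    qed
    have "f ` (N \<inter> U) \<inter> V1 \<noteq> {}" "f ` (N \<inter> U) \<inter> V2 \<noteq> {}"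
      using hit[OF V(1)] hit[OF V(2)] V(3,4) E(5,6) by blast+
    moreover have "V1 \<inter> V2 \<inter> f ` (N \<inter> U) = {}" using V(5) by (auto simp: disjnt_def)
    ultimately show False using conn sub V(1,2) unfolding connectedin by blast
  qed
  then show ?thesis unfolding mt C_def[symmetric] connectedin_closedin using CM by simp
qed

text \<open>The extended plane is locally connected because it has charts.\<close>

lemma ecomplex_connected_basis:
  fixes S :: "ecomplex set"
  assumes S: "open S" "y \<in> S"
  obtains G where "open G" "connected G" "y \<in> G" "G \<subseteq> S"
proof -
  obtain p :: ecomplex where p: "p \<noteq> y" by (metis ecomplex.distinct(1))
  obtain h k where hk: "homeomorphism (UNIV - {p}) (UNIV :: complex set) h k" using ecomplex_chart .
  have ch: "continuous_on (UNIV - {p}) h" and ck: "continuous_on UNIV k"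
    and kh: "\<And>x. x \<noteq> p \<Longrightarrow> k (h x) = x"
    using hk by (auto simp: homeomorphism_def)
  have o: "open (S - {p})" using S(1) by (simp add: open_delete)
  have "open (h ` (S - {p}))"
    using homeomorphism_imp_open_map[OF hk open_subset[OF _ o]] by auto
  moreover have "h y \<in> h ` (S - {p})" using S(2) p by blast
  ultimately obtain e where e: "e > 0" "ball (h y) e \<subseteq> h ` (S - {p})" using open_contains_ball by metis
  have oG: "open (k ` ball (h y) e)"
  proof -
    have "openin (top_of_set (UNIV - {p})) (k ` ball (h y) e)"
      by (rule homeomorphism_imp_open_map[OF homeomorphism_symD[OF hk]]) auto
    then show ?thesis by (rule openin_open_trans) (simp add: open_delete)
  qed
  have cG: "connected (k ` ball (h y) e)"
    by (rule connected_continuous_image[OF continuous_on_subset[OF ck]]) auto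
  have yG: "y \<in> k ` ball (h y) e" using kh[of y] p e(1) by (intro image_eqI[of _ _ "h y"]) auto
  have "k ` ball (h y) e \<subseteq> S"
  proof -
    have "k ` ball (h y) e \<subseteq> k ` h ` (S - {p})" by (rule image_mono[OF e(2)])
    also have "\<dots> = (\<lambda>x. k (h x)) ` (S - {p})" by (simp add: image_image)
    also have "\<dots> = (\<lambda>x. x) ` (S - {p})" by (rule image_cong) (use kh in auto)
    also have "\<dots> \<subseteq> S" by auto
    finally show ?thesis .
  qed
  then show ?thesis using that oG cG yG by blast
qed

lemma open_components_ecomplex:
  fixes S :: "ecomplex set"
  assumes S: "open S" and C: "C \<in> components S"
  shows "open C"
proof -
  have "\<exists>G. open G \<and> y \<in> G \<and> G \<subseteq> C" if y: "y \<in> C" for y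
  proof -
    have "y \<in> S" using y C in_components_subset by blast
    then obtain G where G: "open G" "connected G" "y \<in> G" "G \<subseteq> S" using ecomplex_connected_basis[OF S] by metis
    then have "G \<subseteq> C" using components_maximal[OF C G(2,4)] y by blast
    then show ?thesis using G by blast
  qed
  then show ?thesis using open_subopen[of C] by blast
qed

lemma infinitely_many_in_closure:
  fixes z :: "nat \<Rightarrow> 'a::metric_space"
  assumes "z \<longlonglongrightarrow> z0" "infinite {n. z n \<in> W}" shows "z0 \<in> closure W"
  unfolding closure_approachable
proof (intro allI impI)
  fix e :: real assume "e > 0"
  then obtain n0 where n0: "\<And>n. n \<ge> n0 \<Longrightarrow> dist (z n) z0 < e"
    using tendstoD[OF assms(1)] by (auto simp: eventually_sequentially)
  obtain n where "n \<ge> n0" "z n \<in> W"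
    using assms(2) by (metis finite_nat_set_iff_bounded_le mem_Collect_eq nat_le_linear)
  then show "\<exists>y\<in>W. dist y z0 < e" using n0 by blast
qed

text \<open>Consider the components of the trace of the disc.  No component contains all points of \<open>U\<close> close
  to \<open>z0\<close>.  If one of them accumulates at \<open>z0\<close>, split it off.  Otherwise every sequence converging
  to \<open>z0\<close> runs through infinitely many components, and infinitely many of these are distributed alternately to the two pieces.\<close>

lemma splitting_if_not_connected_nbhds:
  fixes U :: "ecomplex set"
  assumes U: "open U" and z0: "z0 \<in> closure U" and r: "r > 0"
    and no: "\<nexists>N. open N \<and> z0 \<in> N \<and> N \<subseteq> ball z0 r \<and> connected (N \<inter> U)"
  obtains W W' where "open W" "open W'" "W \<inter> W' = {}" "W \<union> W' = ball z0 r \<inter> U" "z0 \<in> closure W" "z0 \<in> closure W'"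
proof -
  define D where "D = ball z0 r \<inter> U"
  have oD: "open D" using U by (simp add: D_def open_Int)
  have oC: "open V" if "V \<in> components D" for V using open_components_ecomplex[OF oD that] .
  have split: "open (\<Union>\<V>)" "open (D - \<Union>\<V>)" if "\<V> \<subseteq> components D" for \<V>
  proof -
    show "open (\<Union>\<V>)" using that oC by blast
    have "D - \<Union>\<V> = \<Union>(components D - \<V>)"
    proof
      show "D - \<Union>\<V> \<subseteq> \<Union>(components D - \<V>)" using Union_components[of D] by blast
      show "\<Union>(components D - \<V>) \<subseteq> D - \<Union>\<V>"
      proof
        fix x assume "x \<in> \<Union>(components D - \<V>)"
        then obtain V where V: "V \<in> components D" "V \<notin> \<V>" "x \<in> V" by blast
        moreover have "x \<notin> V'" if "V' \<in> \<V>" for V'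
          using components_eq[OF V(1), of V'] that \<open>\<V> \<subseteq> components D\<close> V by blast
        ultimately show "x \<in> D - \<Union>\<V>" using in_components_subset by blast
      qed
    qed
    then show "open (D - \<Union>\<V>)" using oC by auto
  qed
  have A: "z0 \<in> closure (D - V)" if V: "V \<in> components D" for V
  proof (rule ccontr)
    assume "z0 \<notin> closure (D - V)"
    then have "open (- closure (D - V))" "z0 \<in> - closure (D - V)" by auto
    then obtain s where s: "s > 0" "ball z0 s \<subseteq> - closure (D - V)" using open_contains_ball by metis
    define N where "N = V \<union> ball z0 (min s r)"
    have VD: "V \<subseteq> D" using V in_components_subset by blast
    have "ball z0 (min s r) \<inter> U \<subseteq> V"
    proof
      fix x assume x: "x \<in> ball z0 (min s r) \<inter> U"
      then have "x \<in> ball z0 s" "x \<in> D" by (simp_all add: D_def)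
      moreover from this have "x \<notin> D - V" using s(2) closure_subset[of "D - V"] by blast
      ultimately show "x \<in> V" by blast
    qed
    then have "N \<inter> U = V" using VD by (auto simp: N_def D_def)
    moreover have "open N" using oC[OF V] by (simp add: N_def open_Un)
    moreover have "z0 \<in> N" "N \<subseteq> ball z0 r" using s(1) r VD by (auto simp: N_def D_def)
    ultimately show False using no in_components_connected[OF V] by metis
  qed
  show ?thesis
  proof (cases "\<exists>V\<in>components D. z0 \<in> closure V")
    case True
    then obtain V where V: "V \<in> components D" "z0 \<in> closure V" by blast
    show ?thesis
    proof (rule that[of V "D - V"])
      show "open V" using oC V by blast
      show "open (D - V)" using split(2)[of "{V}"] V by simp
      show "V \<union> (D - V) = ball z0 r \<inter> U" using V in_components_subset by (auto simp: D_def)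
    qed (use V A in auto)
  next
    case False
    have "z0 \<in> closure D"
    proof -
      have "z0 \<in> ball z0 r \<inter> closure U" using z0 r by simp
      moreover have "ball z0 r \<inter> closure U \<subseteq> closure D"
        unfolding D_def by (rule open_Int_closure_subset[OF open_ball])
      ultimately show ?thesis by blast
    qed
    then obtain z where z: "\<And>n. z n \<in> D" "z \<longlonglongrightarrow> z0" unfolding closure_sequential by auto
    define V where "V = (\<lambda>n. connected_component_set D (z n))"
    have V: "V n \<in> components D" "z n \<in> V n" for n using z(1) by (auto simp: V_def componentsI)
    \<comment> \<open>A component visited infinitely often would accumulate at \<open>z0\<close>.\<close>
    have "infinite (range V)"
    proof
      assume "finite (range V)"
      then obtain n where "infinite {m. V m = V n}"
        using pigeonhole_infinite[of UNIV V] by auto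
      moreover have "{m. V m = V n} \<subseteq> {m. z m \<in> V n}"
      proof
        fix m assume "m \<in> {m. V m = V n}"
        then show "m \<in> {m. z m \<in> V n}" using V(2)[of m] by simp
      qed
      ultimately have "infinite {m. z m \<in> V n}" using infinite_super by blast
      then show False using infinitely_many_in_closure[OF z(2)] False V(1) by blast
    qed
    then obtain e :: "nat \<Rightarrow> ecomplex set" where e: "inj e" "range e \<subseteq> range V"
      using infinite_countable_subset by blast
    have inf: "infinite {n. z n \<in> \<Union>(range (\<lambda>i. e (g i)))}" if g: "inj g" for g :: "nat \<Rightarrow> nat"
    proof -
      have "\<exists>n. e (g i) = V n" for i using e(2) by blast
      then obtain n where n: "\<And>i. e (g i) = V (n i)" by metis
      have "inj n"
      proof (rule injI)
        fix i j assume "n i = n j"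
        then have "e (g i) = e (g j)" using n by simp
        then show "i = j" using e(1) g by (auto dest: injD)
      qed
      then have "infinite (range n)" by (simp add: range_inj_infinite)
      moreover have "range n \<subseteq> {n. z n \<in> \<Union>(range (\<lambda>i. e (g i)))}"
      proof clarify
        fix i
        have "z (n i) \<in> e (g i)" using n V(2) by simp
        then show "z (n i) \<in> \<Union>(range (\<lambda>i. e (g i)))" by blast
      qed
      ultimately show ?thesis using infinite_super by blast
    qed
    define \<V> where "\<V> = range (\<lambda>i. e (2 * i))"
    have ec: "e i \<in> components D" for i
    proof -
      have "e i \<in> range V" using e(2) by (rule subsetD) simp
      then show ?thesis using V(1) by auto
    qed
    have "\<V> \<subseteq> components D" using ec by (auto simp: \<V>_def)
    have "\<Union>(range (\<lambda>i. e (2 * i + 1))) \<subseteq> D - \<Union>\<V>"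
    proof
      fix x assume "x \<in> \<Union>(range (\<lambda>i. e (2 * i + 1)))"
      then obtain i where i: "x \<in> e (2 * i + 1)" by blast
      have "x \<notin> e (2 * j)" for j
      proof
        assume "x \<in> e (2 * j)"
        then have "e (2 * j) = e (2 * i + 1)" using components_eq[OF ec ec] i by blast
        then have "2 * j = 2 * i + 1" using e(1) by (auto dest: injD)
        then show False by presburger
      qed
      then show "x \<in> D - \<Union>\<V>" using i ec in_components_subset by (fastforce simp: \<V>_def)
    qed
    moreover have "z0 \<in> closure (\<Union>(range (\<lambda>i. e (2 * i + 1))))"
      by (rule infinitely_many_in_closure[OF z(2) inf]) (auto simp: inj_on_def)
    ultimately have "z0 \<in> closure (D - \<Union>\<V>)" using closure_mono by blast
    moreover have "z0 \<in> closure (\<Union>\<V>)" unfolding \<V>_def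
      by (rule infinitely_many_in_closure[OF z(2) inf]) (auto simp: inj_on_def)
    ultimately show ?thesis
    proof (intro that[of "\<Union>\<V>" "D - \<Union>\<V>"])
      show "\<Union>\<V> \<union> (D - \<Union>\<V>) = ball z0 r \<inter> U"
      proof -
        have "\<Union>\<V> \<subseteq> D" using Union_mono[OF \<open>\<V> \<subseteq> components D\<close>] by simp
        then show ?thesis by (auto simp: D_def[symmetric])
      qed
    qed (use split[OF \<open>\<V> \<subseteq> components D\<close>] in auto)
  qed
qed

definition unit_interval_copy :: "(real \<Rightarrow> 'x) \<Rightarrow> 'x metric" where
  "unit_interval_copy \<iota> = metric (\<iota> ` {0..1}, \<lambda>x y. dist (inv \<iota> x) (inv \<iota> y))"

lemma unit_interval_copy:
  assumes "inj \<iota>"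
  shows "mspace (unit_interval_copy \<iota>) = \<iota> ` {0..1}"
    and "mdist (unit_interval_copy \<iota>) = (\<lambda>x y. dist (inv \<iota> x) (inv \<iota> y))"
    and "limitin (mtopology_of (unit_interval_copy \<iota>)) (\<lambda>n. \<iota> (a n)) (\<iota> b) sequentially \<longleftrightarrow>
           b \<in> {0..1} \<and> (\<forall>\<^sub>F n in sequentially. a n \<in> {0..1}) \<and> a \<longlonglongrightarrow> b"
    and "continuous_map (top_of_set {0..1}) (mtopology_of (unit_interval_copy \<iota>)) \<iota>"
    and "compact_space (mtopology_of (unit_interval_copy \<iota>))"
    and "continuous_map (mtopology_of (unit_interval_copy \<iota>)) euclideanreal (inv \<iota>)"
proof -
  have i: "inv \<iota> (\<iota> t) = t" for t using assms by simp
  have M: "Metric_space (\<iota> ` {0..1}) (\<lambda>x y. dist (inv \<iota> x) (inv \<iota> y))"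
    by unfold_locales (auto simp: dist_commute i dist_triangle)
  then interpret Metric_space "\<iota> ` {0..1}" "\<lambda>x y. dist (inv \<iota> x) (inv \<iota> y)" .
  show ms: "mspace (unit_interval_copy \<iota>) = \<iota> ` {0..1}"
    and md: "mdist (unit_interval_copy \<iota>) = (\<lambda>x y. dist (inv \<iota> x) (inv \<iota> y))"
    by (simp_all add: unit_interval_copy_def)
  have mt: "mtopology_of (unit_interval_copy \<iota>) = mtopology" by (simp add: mtopology_of_def ms md)
  have mem: "\<iota> t \<in> \<iota> ` {0..1} \<longleftrightarrow> t \<in> {0..1}" for t using assms by (simp add: inj_image_mem_iff)
  show "limitin (mtopology_of (unit_interval_copy \<iota>)) (\<lambda>n. \<iota> (a n)) (\<iota> b) sequentially \<longleftrightarrow>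
           b \<in> {0..1} \<and> (\<forall>\<^sub>F n in sequentially. a n \<in> {0..1}) \<and> a \<longlonglongrightarrow> b"
    unfolding mt limitin_metric mem i tendsto_iff eventually_conj_iff by (meson zero_less_one)
  have cm: "continuous_map (top_of_set {0..1}) mtopology \<iota>"
    unfolding continuous_map_to_metric
  proof (intro ballI allI impI)
    fix x e :: real assume x: "x \<in> topspace (top_of_set {0..1})" and e: "e > 0"
    show "\<exists>W. openin (top_of_set {0..1}) W \<and> x \<in> W \<and> (\<forall>y\<in>W. \<iota> y \<in> mball (\<iota> x) e)"
      using x e by (intro exI[of _ "{0..1} \<inter> ball x e"]) (auto simp: i openin_open_Int)
  qed
  then show "continuous_map (top_of_set {0..1}) (mtopology_of (unit_interval_copy \<iota>)) \<iota>" by (simp add: mt)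
  have "compactin (top_of_set {0..1}) {0..1::real}" by (simp add: compactin_subtopology)
  then have "compactin mtopology (\<iota> ` {0..1})" using image_compactin[OF _ cm] by blast
  then show "compact_space (mtopology_of (unit_interval_copy \<iota>))" by (simp add: mt compact_space_def)
  show "continuous_map (mtopology_of (unit_interval_copy \<iota>)) euclideanreal (inv \<iota>)"
  proof -
    have "continuous_map mtopology Met_TC.mtopology (inv \<iota>)"
      unfolding metric_continuous_map[OF Met_TC.Metric_space_axioms] by auto
    then show ?thesis by (simp add: mt)
  qed
qed

text \<open>For the converse, the map into the copy of the unit interval is a bump on the piece \<open>W\<close> and zero elsewhere on \<open>U\<close>.  Its only cluster values at \<open>z0\<close> are \<open>0\<close> and \<open>1\<close>.\<close>

theorem connected_cluster_sets_iff:
  fixes U :: "ecomplex set" and \<iota> :: "real \<Rightarrow> 'x"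
  assumes U: "open U" and \<iota>: "inj \<iota>"
  shows "simply_connected_at_boundary U \<longleftrightarrow> connected_cluster_sets TYPE('x) U"
proof
  assume "simply_connected_at_boundary U"
  then show "connected_cluster_sets TYPE('x) U"
    unfolding connected_cluster_sets_def simply_connected_at_boundary_def simply_connected_at_iff
    using connected_cluster_set by blast
next
  assume cc: "connected_cluster_sets TYPE('x) U"
  show "simply_connected_at_boundary U"
    unfolding simply_connected_at_boundary_def simply_connected_at_def
  proof (intro ballI allI impI, rule ccontr)
    fix z0 and r :: real
    assume z0: "z0 \<in> frontier U" and r: "r > 0"
      and no: "\<nexists>N. open N \<and> z0 \<in> N \<and> N \<subseteq> ball z0 r \<and> connected (N \<inter> U)"
    have "z0 \<in> closure U" using z0 by (simp add: frontier_def)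
    then obtain W W' where W: "open W" "open W'" "W \<inter> W' = {}" "W \<union> W' = ball z0 r \<inter> U" "z0 \<in> closure W" "z0 \<in> closure W'"
      using splitting_if_not_connected_nbhds[OF U _ r no] by metis
    define g where "g = (\<lambda>z. if z \<in> W then max 0 (1 - 2 * dist z z0 / r) else 0)"
    have g01: "g z \<in> {0..1}" for z using r by (auto simp: g_def)
    define R where "R = U \<inter> {z. dist z z0 > r / 2}"
    have oR: "open R" unfolding R_def by (intro open_Int U open_Collect_less continuous_intros)
    have UWR: "U = W \<union> (W' \<union> R)"
    proof -
      have "z \<in> W \<union> (W' \<union> R)" if "z \<in> U" for z
      proof (cases "dist z z0 < r")
        case True
        then have "z \<in> ball z0 r \<inter> U" using that by (simp add: dist_commute)
        then show ?thesis using W(4) by blast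
      next
        case False
        then show ?thesis using r that by (simp add: R_def)
      qed
      moreover have "W \<union> (W' \<union> R) \<subseteq> U" using W(4) by (auto simp: R_def)
      ultimately show ?thesis by blast
    qed
    have contg: "continuous_on U g"
    proof -
      have "continuous_on W (\<lambda>z. max 0 (1 - 2 * dist z z0 / r))" using r by (intro continuous_intros) auto
      then have 1: "continuous_on W g" by (rule continuous_on_eq) (simp add: g_def)
      have 2: "continuous_on (W' \<union> R) g"
      proof (rule continuous_on_eq[OF continuous_on_const])
        fix z assume "z \<in> W' \<union> R"
        then show "0 = g z" using W(3) r by (auto simp: g_def R_def field_simps)
      qed
      show ?thesis using continuous_on_open_Un[OF W(1) open_Un[OF W(2) oR] 1 2] UWR by simp
    qed
    define X where "X = unit_interval_copy \<iota>"
    note X = unit_interval_copy[OF \<iota>, folded X_def]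
    define f where "f = (\<lambda>z. \<iota> (g z))"
    have "continuous_map (top_of_set U) (top_of_set {0..1}) g"
      using contg g01 by (auto simp: continuous_map_in_subtopology)
    from continuous_map_compose[OF this X(4)]
    have "continuous_map (top_of_set U) (mtopology_of X) f" by (simp only: f_def o_def)
    then have conn: "connectedin (mtopology_of X) (cluster_set X U f z0)"
      using cc X(5) z0 unfolding connected_cluster_sets_def by blast
    have in_cl: "\<iota> b \<in> cluster_set X U f z0 \<longleftrightarrow> b \<in> {0..1} \<and> (\<exists>z. (\<forall>k. z k \<in> U) \<and> z \<longlonglongrightarrow> z0 \<and> (\<lambda>k. g (z k)) \<longlonglongrightarrow> b)" for b
    proof -
      have "limitin (mtopology_of X) (\<lambda>k. f (z k)) (\<iota> b) sequentially \<longleftrightarrow> b \<in> {0..1} \<and> (\<lambda>k. g (z k)) \<longlonglongrightarrow> b" for z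
        unfolding f_def X(3) using g01 by simp
      moreover have "\<iota> b \<in> mspace X \<longleftrightarrow> b \<in> {0..1}" using X(1) \<iota> by (simp add: inj_image_mem_iff)
      ultimately show ?thesis unfolding cluster_set_def by auto
    qed
    have glim: "(\<lambda>k. max 0 (1 - 2 * dist (z k) z0 / r)) \<longlonglongrightarrow> 1" if "z \<longlonglongrightarrow> z0" for z
    proof -
      have "(\<lambda>k. max 0 (1 - 2 * dist (z k) z0 / r)) \<longlonglongrightarrow> max 0 (1 - 2 * dist z0 z0 / r)"
        using that r by (intro tendsto_intros) auto
      then show ?thesis by simp
    qed
    have 1: "\<iota> 1 \<in> cluster_set X U f z0"
    proof -
      obtain z where z: "\<And>n. z n \<in> W" "z \<longlonglongrightarrow> z0" using W(5) unfolding closure_sequential by auto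
      have "(\<lambda>k. g (z k)) \<longlonglongrightarrow> 1" using glim[OF z(2)] z(1) by (simp add: g_def)
      then show ?thesis using in_cl z UWR by auto
    qed
    have 0: "\<iota> 0 \<in> cluster_set X U f z0"
    proof -
      obtain z where z: "\<And>n. z n \<in> W'" "z \<longlonglongrightarrow> z0" using W(6) unfolding closure_sequential by auto
      have "z n \<notin> W" for n using z(1) W(3) by blast
      then have "(\<lambda>k. g (z k)) \<longlonglongrightarrow> 0" by (simp add: g_def)
      then show ?thesis using in_cl z UWR by auto
    qed
    have "connectedin euclideanreal (inv \<iota> ` cluster_set X U f z0)"
      using connectedin_continuous_map_image[OF X(6) conn] .
    then have "connected (inv \<iota> ` cluster_set X U f z0)" by simp
    moreover have "0 \<in> inv \<iota> ` cluster_set X U f z0" "1 \<in> inv \<iota> ` cluster_set X U f z0"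
      using 0 1 \<iota> by (metis image_eqI inv_f_f)+
    ultimately have "1/2 \<in> inv \<iota> ` cluster_set X U f z0"
      using connected_contains_Icc[of _ 0 1] by fastforce
    then obtain c where c: "c \<in> cluster_set X U f z0" "inv \<iota> c = 1/2" by auto
    have "c \<in> \<iota> ` {0..1}" using c(1) X(1) by (auto simp: cluster_set_def)
    then obtain t where "c = \<iota> t" by blast
    moreover from this have "t = 1/2" using c(2) \<iota> by simp
    ultimately have "c = \<iota> (1/2)" by simp
    then obtain z where z: "\<And>k. z k \<in> U" "z \<longlonglongrightarrow> z0" "(\<lambda>k. g (z k)) \<longlonglongrightarrow> 1/2" using c(1) in_cl by auto
    have "\<forall>\<^sub>F k in sequentially. max 0 (1 - 2 * dist (z k) z0 / r) > 3/4"
      using order_tendstoD(1)[OF glim[OF z(2)], of "3/4"] by simp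
    moreover have "\<forall>\<^sub>F k in sequentially. g (z k) < 3/4" "\<forall>\<^sub>F k in sequentially. g (z k) > 1/4"
      using order_tendstoD(2)[OF z(3), of "3/4"] order_tendstoD(1)[OF z(3), of "1/4"] by simp_all
    ultimately have "\<forall>\<^sub>F k in sequentially. False"
    proof eventually_elim
      case (elim k)
      have "g (z k) = max 0 (1 - 2 * dist (z k) z0 / r) \<or> g (z k) = 0" by (simp add: g_def)
      then show False using elim by linarith
    qed
    then show False by simp
  qed
qed

section \<open>The equivalence\<close>

theorem theorem2p1:
  fixes U :: "ecomplex set" and \<iota> :: "real \<Rightarrow> 'x"
  assumes "domain U"
    and "inj \<iota>"
  shows "(generalized_Jordan_domain U \<longleftrightarrow> simply_connected_at_boundary U) \<and>
         (simply_connected_at_boundary U \<longleftrightarrow> connected_cluster_sets TYPE('x) U)"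
  using generalized_Jordan_iff_simply_connected_at_boundary[OF assms(1)]
    connected_cluster_sets_iff[of U \<iota>] assms by (simp add: domain_def)

end
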